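(* Let $\mathcal G=(\mathcal V,\mathcal E)$ be a $\Gamma$-periodic graph, let $\alpha:\mathcal A\to\mathbb R$ be a $\Gamma$-periodic magnetic vector potential on $\mathcal G$ and let $Q:\mathcal V\to\mathbb R$ be a $\Gamma$-periodic electric potential. For a coupling constant $t$ let $H_{t\alpha}=\Delta_{t\alpha}+Q$ be the magnetic Schrödinger operator on $\ell^2(\mathcal V)$ with magnetic potential $t\alpha$ and electric potential $Q$. Then the absolutely continuous spectrum of $H_{t\alpha}$ is not empty for all except finitely many $t\in[0,1]$.
   Context: **Periodic graphs.** $\mathcal G=(\mathcal V,\mathcal E)$ is a connected infinite graph, possibly with loops and multiple edges, embedded into $\mathbb R^d$; $\mathcal V$ is its vertex set and $\mathcal E$ its set of unoriented edges. Each edge in $\mathcal E$ is given two orientations, and $\mathcal A$ is the set of all oriented edges. An oriented edge starting at $u$ and ending at $v$ is written $(u,v)\in\mathcal A$ (multiple edges are distinguished), and $\underline{\mathbf e}=(v,u)$ is the inverse edge of $\mathbf e=(u,v)$. $\Gamma\subset\mathbb R^d$ is a lattice of rank $d$ with basis $a_1,\dots,a_d$. The graph is $\Gamma$-periodic: it is locally finite, $\mathcal G+a=\mathcal G$ for all $a\in\Gamma$, and the quotient graph $\mathcal G_*=\mathcal G/\Gamma$ is finite. **Operators.** A magnetic vector potential is a function $\alpha:\mathcal A\to\mathbb R$ with $\alpha(\underline{\mathbf e})=-\alpha(\mathbf e)$ for all $\mathbf e\in\mathcal A$. Periodicity means $\alpha(\mathbf e+a)=\alpha(\mathbf e)$ and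 $Q(v+a)=Q(v)$ for all $\mathbf e\in\mathcal A$, $v\in\mathcal V$, $a\in\Gamma$. The magnetic Laplacian $\Delta_\alpha$ on $\ell^2(\mathcal V)$ is $$(\Delta_\alpha f)(v)=\sum_{\mathbf e=(v,u)\in\mathcal A}\big(f(v)-e^{i\alpha(\mathbf e)}f(u)\big),\qquad f\in\ell^2(\mathcal V),\ v\in\mathcal V,$$ where the sum is over all oriented edges starting at $v$; $(Qf)(v)=Q(v)f(v)$. The magnetic Schrödinger operator $H_\alpha=\Delta_\alpha+Q$ is bounded and self-adjoint on $\ell^2(\mathcal V)$. *)

theory Defs
  imports "HOL-Analysis.Analysis"
begin

section \<open>Periodic graphs\<close>

definition lattice_generated_by :: "('d::finite \<Rightarrow> real^'d) \<Rightarrow> (real^'d) set" where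
  "lattice_generated_by a = {\<Sum>i\<in>UNIV. of_int (n i) *\<^sub>R a i | n :: 'd \<Rightarrow> int. True}"

definition full_rank_lattice :: "(real^'d::finite) set \<Rightarrow> bool" where
  "full_rank_lattice \<Gamma> \<longleftrightarrow>
     (\<exists>a :: 'd \<Rightarrow> real^'d. inj a \<and> independent (range a) \<and> \<Gamma> = lattice_generated_by a)"

text \<open>
  Vertices are points of the Euclidean space.  Oriented edges are abstract objects with a source
  and a target, so that multiple edges are distinguished; \<open>flip\<close> is orientation reversal and an
  unoriented edge is a pair \<open>{e, flip e}\<close>.  A loop also has two different orientations.
  \<open>shift a e\<close> is the translated edge \<open>e + a\<close>.  The graph is infinite, so there is a vertex.
\<close>

locale periodic_graph =
  fixes \<Gamma> :: "(real^'d::finite) set"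
    and V :: "(real^'d) set"
    and A :: "'e set"
    and src tgt :: "'e \<Rightarrow> real^'d"
    and flip :: "'e \<Rightarrow> 'e"
    and shift :: "real^'d \<Rightarrow> 'e \<Rightarrow> 'e"
  assumes lattice: "full_rank_lattice \<Gamma>"
    and src_in: "\<And>e. e \<in> A \<Longrightarrow> src e \<in> V"
    and tgt_in: "\<And>e. e \<in> A \<Longrightarrow> tgt e \<in> V"
    and flip_in: "\<And>e. e \<in> A \<Longrightarrow> flip e \<in> A"
    and flip_flip: "\<And>e. e \<in> A \<Longrightarrow> flip (flip e) = e"
    and flip_neq: "\<And>e. e \<in> A \<Longrightarrow> flip e \<noteq> e"
    and src_flip: "\<And>e. e \<in> A \<Longrightarrow> src (flip e) = tgt e"
    and tgt_flip: "\<And>e. e \<in> A \<Longrightarrow> tgt (flip e) = src e"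
    and infinite_vertices: "infinite V"
    and connected_graph:
      "\<And>u v. u \<in> V \<Longrightarrow> v \<in> V \<Longrightarrow> (u, v) \<in> {(src e, tgt e) | e. e \<in> A}\<^sup>*"
    and locally_finite: "\<And>v. v \<in> V \<Longrightarrow> finite {e \<in> A. src e = v}"
    and vertex_shift: "\<And>v a. v \<in> V \<Longrightarrow> a \<in> \<Gamma> \<Longrightarrow> v + a \<in> V"
    and shift_in: "\<And>e a. e \<in> A \<Longrightarrow> a \<in> \<Gamma> \<Longrightarrow> shift a e \<in> A"
    and shift_zero: "\<And>e. e \<in> A \<Longrightarrow> shift 0 e = e"
    and shift_add:
      "\<And>e a b. e \<in> A \<Longrightarrow> a \<in> \<Gamma> \<Longrightarrow> b \<in> \<Gamma> \<Longrightarrow> shift (a + b) e = shift a (shift b e)"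
    and src_shift: "\<And>e a. e \<in> A \<Longrightarrow> a \<in> \<Gamma> \<Longrightarrow> src (shift a e) = src e + a"
    and tgt_shift: "\<And>e a. e \<in> A \<Longrightarrow> a \<in> \<Gamma> \<Longrightarrow> tgt (shift a e) = tgt e + a"
    and flip_shift: "\<And>e a. e \<in> A \<Longrightarrow> a \<in> \<Gamma> \<Longrightarrow> flip (shift a e) = shift a (flip e)"
    and finite_vertex_orbits: "finite ((\<lambda>v. (\<lambda>a. v + a) ` \<Gamma>) ` V)"
    and finite_edge_orbits: "finite ((\<lambda>e. (\<lambda>a. shift a e) ` \<Gamma>) ` A)"

definition magnetic_potential :: "'e set \<Rightarrow> ('e \<Rightarrow> 'e) \<Rightarrow> ('e \<Rightarrow> real) \<Rightarrow> bool" where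
  "magnetic_potential A flip \<alpha> \<longleftrightarrow> (\<forall>e\<in>A. \<alpha> (flip e) = - \<alpha> e)"

definition periodic_under ::
    "'g set \<Rightarrow> 'x set \<Rightarrow> ('g \<Rightarrow> 'x \<Rightarrow> 'x) \<Rightarrow> ('x \<Rightarrow> real) \<Rightarrow> bool" where
  "periodic_under \<Gamma> X act f \<longleftrightarrow> (\<forall>x\<in>X. \<forall>a\<in>\<Gamma>. f (act a x) = f x)"


section \<open>The Hilbert space of square-summable functions and the operators\<close>

text \<open>
  A function on \<open>V\<close> is represented by its extension by zero to the whole type.
\<close>

definition ell2 :: "'v set \<Rightarrow> ('v \<Rightarrow> complex) set" where
  "ell2 V = {f. (\<forall>v. v \<notin> V \<longrightarrow> f v = 0) \<and> (\<lambda>v. (cmod (f v))\<^sup>2) summable_on V}"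

definition ell2_inner :: "'v set \<Rightarrow> ('v \<Rightarrow> complex) \<Rightarrow> ('v \<Rightarrow> complex) \<Rightarrow> complex" where
  "ell2_inner V f g = (\<Sum>\<^sub>\<infinity>v\<in>V. cnj (f v) * g v)"

definition ell2_norm :: "'v set \<Rightarrow> ('v \<Rightarrow> complex) \<Rightarrow> real" where
  "ell2_norm V f = sqrt (\<Sum>\<^sub>\<infinity>v\<in>V. (cmod (f v))\<^sup>2)"

text \<open>
  Since all edges start in \<open>V\<close>, both operators map functions vanishing outside \<open>V\<close> to such functions.
\<close>

definition magnetic_laplacian ::
    "'e set \<Rightarrow> ('e \<Rightarrow> 'v) \<Rightarrow> ('e \<Rightarrow> 'v) \<Rightarrow> ('e \<Rightarrow> real) \<Rightarrow> ('v \<Rightarrow> complex) \<Rightarrow> ('v \<Rightarrow> complex)" where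
  "magnetic_laplacian A src tgt \<alpha> f v =
     (\<Sum>e\<in>{e \<in> A. src e = v}. f v - exp (\<i> * complex_of_real (\<alpha> e)) * f (tgt e))"

definition magnetic_schroedinger ::
    "'e set \<Rightarrow> ('e \<Rightarrow> 'v) \<Rightarrow> ('e \<Rightarrow> 'v) \<Rightarrow> ('e \<Rightarrow> real) \<Rightarrow> ('v \<Rightarrow> real) \<Rightarrow>
     ('v \<Rightarrow> complex) \<Rightarrow> ('v \<Rightarrow> complex)" where
  "magnetic_schroedinger A src tgt \<alpha> Q f v =
     magnetic_laplacian A src tgt \<alpha> f v + complex_of_real (Q v) * f v"


section \<open>The absolutely continuous spectrum of a bounded self-adjoint operator\<close>

text \<open>
  The spectral measure of a bounded self-adjoint operator \<open>T\<close> on \<open>ell2 V\<close> at the vector \<open>f\<close> is the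
  finite compactly supported Borel measure \<open>\<mu>\<close> on the line with
  \<open>\<langle>f, p(T) f\<rangle> = \<integral> p d\<mu>\<close> for all polynomials \<open>p\<close> (by linearity, it suffices to
  take monomials).  By the Weierstrass theorem this is the same as requiring the identity
  for the continuous functional calculus, and it determines \<open>\<mu>\<close>.
\<close>

definition spectral_measure ::
    "'v set \<Rightarrow> (('v \<Rightarrow> complex) \<Rightarrow> ('v \<Rightarrow> complex)) \<Rightarrow> ('v \<Rightarrow> complex) \<Rightarrow> real measure \<Rightarrow> bool" where
  "spectral_measure V T f \<mu> \<longleftrightarrow>
     sets \<mu> = sets borel \<and> finite_measure \<mu> \<and>
     (\<exists>R. emeasure \<mu> {x. R < \<bar>x\<bar>} = 0) \<and>
     (\<forall>n. ell2_inner V f ((T ^^ n) f) = complex_of_real (\<integral>x. x ^ n \<partial>\<mu>))"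

definition ac_subspace ::
    "'v set \<Rightarrow> (('v \<Rightarrow> complex) \<Rightarrow> ('v \<Rightarrow> complex)) \<Rightarrow> ('v \<Rightarrow> complex) set" where
  "ac_subspace V T =
     {f \<in> ell2 V. \<exists>\<mu>. spectral_measure V T f \<mu> \<and> absolutely_continuous lborel \<mu>}"

text \<open>
  Spectrum of the restriction of \<open>T\<close> to an invariant subspace \<open>K\<close>: the complement of the set of \<open>z\<close>
  for which \<open>T - z\<close> is a bijection of \<open>K\<close> with bounded inverse.
\<close>

definition spectrum_on ::
    "'v set \<Rightarrow> ('v \<Rightarrow> complex) set \<Rightarrow> (('v \<Rightarrow> complex) \<Rightarrow> ('v \<Rightarrow> complex)) \<Rightarrow> complex set" where
  "spectrum_on V K T =
     {z. \<not> (bij_betw (\<lambda>f v. T f v - z * f v) K K \<and>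
            (\<exists>C. \<forall>f\<in>K. ell2_norm V f \<le> C * ell2_norm V (\<lambda>v. T f v - z * f v)))}"

definition ac_spectrum ::
    "'v set \<Rightarrow> (('v \<Rightarrow> complex) \<Rightarrow> ('v \<Rightarrow> complex)) \<Rightarrow> complex set" where
  "ac_spectrum V T = spectrum_on V (ac_subspace V T) T"

end

(*
  Let T be the Schroedinger operator, U_m the translation by a lattice vector m, and tau(B) the
  trace per unit cell of a periodic operator B. If X is multiplication by the function v . m, then
  D = [X,T] is periodic, and cyclicity of tau gives -|m|^2 tau(f(T) U_m) = tau(f'(T) D U_m) for
  polynomials f. Suppose that T has no absolutely continuous spectrum. Then the spectral measures
  of the delta functions are carried by a Lebesgue null set, so some polynomial q is close to 0
  with respect to them and close to 1 with respect to Lebesgue measure. Applying the identity to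
  an f with f' = q p' shows that tau(p(T) U_m) = 0 for every polynomial p.

  On the other hand, tau((c - T)^n U_m) is an entire function of the coupling constant t. At t = 0
  and for large c the matrix of c - T is nonnegative, so by connectedness this function is
  positive there for some n. Hence it has only finitely many zeros in [0,1].
*)

theory Submission
  imports Defs "HOL-Probability.Probability" "HOL-Complex_Analysis.Complex_Analysis"
    "HOL-Real_Asymp.Real_Asymp"
begin


section \<open>Linear functionals on polynomials\<close>

text \<open>Spectral measures are prescribed by moments only, so polynomials carry the whole
  argument: existence is a Hausdorff moment problem, spectral projections are limits of p(T) f, and
  no direct integral over quasimomenta occurs. The choice f' = q p' imitates a function with f' = p'
  off a Lebesgue null set N and f' = 0 on N. Altering f' on N does not alter f, yet N carries all
  spectral mass of a singular T. So f'(T) is nearly zero on the relevant vectors while f stays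
  uniformly near p - p(0) on the interval that contains the spectrum; this is why q must be
  controlled in two kinds of L2 norm at once. The constant p(0) contributes nothing because U_m has
  no diagonal for nonzero m. For nonreal couplings the operator is in general not symmetric; they
  serve only the identity theorem for holomorphic functions, which turns one nonzero value at t = 0
  into finiteness of the zeros. Since the spectrum on a subspace is defined by bounded
  invertibility, a nonzero absolutely continuous vector still has to be turned into approximate
  eigenvectors.\<close>

lemma additive_poly_eqI:
  fixes L M :: "'a::comm_ring_1 poly \<Rightarrow> 'b::cancel_comm_monoid_add"
  assumes "\<And>p q. L (p + q) = L p + L q" "\<And>p q. M (p + q) = M p + M q"
    and "\<And>c n. L (monom c n) = M (monom c n)"
  shows "L p = M p"
proof -
  have sum: "K (sum f I) = (\<Sum>i\<in>I. K (f i))"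
    if "finite I" "\<And>p q. K (p + q) = K p + K q"
    for K :: "'a poly \<Rightarrow> 'b" and f :: "nat \<Rightarrow> 'a poly" and I
  proof -
    have "K 0 + K 0 = K 0 + 0" using that(2)[of 0 0] by simp
    then have "K 0 = 0" by (rule add_left_imp_eq)
    with that(1) show ?thesis by (induction rule: finite_induct) (auto simp: that(2))
  qed
  have "L p = L (\<Sum>i\<le>degree p. monom (coeff p i) i)"
    by (simp add: poly_as_sum_of_monoms)
  also have "\<dots> = M (\<Sum>i\<le>degree p. monom (coeff p i) i)"
    using assms by (simp add: sum)
  finally show ?thesis by (simp add: poly_as_sum_of_monoms)
qed

text \<open>Used for the derivative \<open>q * pderiv p\<close>; fixing the value at 0 makes the
  result comparable with \<open>p\<close> up to the constant \<open>poly p 0\<close>.\<close>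

lemma antiderivative_poly:
  fixes p :: "'a::field_char_0 poly"
  obtains P where "pderiv P = p" "poly P 0 = 0"
proof
  let ?P = "\<Sum>i\<le>degree p. monom (coeff p i / of_nat (Suc i)) (Suc i)"
  have "pderiv ?P = (\<Sum>i\<le>degree p. monom (coeff p i) i)"
  proof -
    have *: "of_nat (Suc i) * (c / of_nat (Suc i)) = c" for i and c :: 'a
      using of_nat_neq_0[of i, where 'a='a] by (simp del: of_nat_Suc)
    have "pderiv (monom (coeff p i / of_nat (Suc i)) (Suc i)) = monom (coeff p i) i" for i
      by (simp only: pderiv_monom diff_Suc_1 *)
    then show ?thesis
      by (simp only: higher_pderiv_sum[of 1, simplified])
  qed
  then show "pderiv ?P = p" by (simp add: poly_as_sum_of_monoms)
  show "poly ?P 0 = 0" by (simp add: poly_sum poly_monom)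
qed

lemma borel_measurable_poly [measurable]: "poly (p :: real poly) \<in> borel_measurable borel"
  by (intro borel_measurable_continuous_onI continuous_intros)

section \<open>Compactly supported measures on the line\<close>

text \<open>The radius \<open>R\<close> is a parameter so that several measures can share one
  interval, on which a single polynomial approximates for all of them.\<close>

locale supported_measure = finite_measure \<mu> for \<mu> :: "real measure" +
  fixes R :: real
  assumes sets_eq [measurable_cong, simp]: "sets \<mu> = sets borel"
    and null_outside: "emeasure \<mu> {x. R < \<bar>x\<bar>} = 0"
begin

lemma space_eq [simp]: "space \<mu> = UNIV"
  using sets_eq_imp_space_eq[OF sets_eq] by simp

lemma AE_bounded: "AE x in \<mu>. \<bar>x\<bar> \<le> R"
  by (rule AE_I[OF _ null_outside]) auto

lemma integrable_bounded:
  fixes f :: "real \<Rightarrow> real"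
  assumes [measurable]: "f \<in> borel_measurable borel" and "\<And>x. \<bar>x\<bar> \<le> R \<Longrightarrow> \<bar>f x\<bar> \<le> B"
  shows "integrable \<mu> f"
proof (rule integrable_const_bound[where B=B])
  show "AE x in \<mu>. norm (f x) \<le> B" using AE_bounded assms(2) by auto
qed simp

lemma integral_bounded:
  fixes f :: "real \<Rightarrow> real"
  assumes [measurable]: "f \<in> borel_measurable borel" and "\<And>x. \<bar>x\<bar> \<le> R \<Longrightarrow> \<bar>f x\<bar> \<le> B"
  shows "\<bar>\<integral>x. f x \<partial>\<mu>\<bar> \<le> B * measure \<mu> UNIV"
proof -
  have i: "integrable \<mu> f" by (rule integrable_bounded[OF assms])
  have "\<bar>\<integral>x. f x \<partial>\<mu>\<bar> \<le> (\<integral>x. \<bar>f x\<bar> \<partial>\<mu>)" by simp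
  also have "\<dots> \<le> (\<integral>x. B \<partial>\<mu>)"
    using i AE_bounded assms(2) by (intro integral_mono_AE) auto
  finally show ?thesis by (simp add: mult.commute)
qed

lemma poly_bounded:
  fixes p :: "real poly"
  obtains B where "B > 0" "\<And>x. \<bar>x\<bar> \<le> R \<Longrightarrow> \<bar>poly p x\<bar> \<le> B"
proof -
  have "compact (poly p ` cball 0 R)"
    by (intro compact_continuous_image continuous_intros) auto
  then obtain B where "B > 0" "\<forall>y\<in>poly p ` cball 0 R. norm y \<le> B"
    using compact_imp_bounded bounded_pos by blast
  then show thesis using that by auto
qed

lemma integrable_poly [simp]: "integrable \<mu> (\<lambda>x. poly p x)"
  by (rule poly_bounded[of p], rule integrable_bounded) auto

lemma integrable_poly_indicator:
  assumes [measurable]: "S \<in> sets borel"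
  shows "integrable \<mu> (\<lambda>x. poly p x * indicator S x)"
proof (rule poly_bounded[of p], rule integrable_bounded)
  fix B x assume "B > 0" and B: "\<And>x. \<bar>x\<bar> \<le> R \<Longrightarrow> \<bar>poly p x\<bar> \<le> B" and "\<bar>x\<bar> \<le> R"
  then show "\<bar>poly p x * indicator S x\<bar> \<le> B"
    by (cases "x \<in> S") auto
qed simp

lemma integrable_poly_minus_indicator:
  assumes [measurable]: "S \<in> sets borel"
  shows "integrable \<mu> (\<lambda>x. (poly p x - indicator S x)\<^sup>2)"
proof (rule poly_bounded[of p], rule integrable_bounded)
  fix B x assume B: "\<And>x. \<bar>x\<bar> \<le> R \<Longrightarrow> \<bar>poly p x\<bar> \<le> B" and "\<bar>x\<bar> \<le> R"
  have "\<bar>poly p x - indicator S x\<bar> \<le> B + 1"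
    using B[OF \<open>\<bar>x\<bar> \<le> R\<close>] by (auto simp: indicator_def)
  then show "\<bar>(poly p x - indicator S x)\<^sup>2\<bar> \<le> (B + 1)\<^sup>2"
    by (metis abs_ge_zero abs_power2 power2_abs power_mono)
qed simp

lemma inner_regular_measure:
  assumes "S \<in> sets borel" "0 < e"
  obtains K where "K \<subseteq> S" "compact K" "measure \<mu> (S - K) < e"
proof -
  have "\<exists>K. K \<subseteq> S \<and> compact K \<and> measure \<mu> S < measure \<mu> K + e"
  proof (rule ccontr)
    assume "\<nexists>K. K \<subseteq> S \<and> compact K \<and> measure \<mu> S < measure \<mu> K + e"
    then have *: "measure \<mu> K \<le> measure \<mu> S - e" if "K \<subseteq> S" "compact K" for K
      using that by force
    have "emeasure \<mu> S = (SUP K \<in> {K. K \<subseteq> S \<and> compact K}. emeasure \<mu> K)"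
      by (rule inner_regular) (use assms in \<open>auto simp: emeasure_eq_measure\<close>)
    also have "\<dots> \<le> ennreal (measure \<mu> S - e)"
      by (intro SUP_least) (use * in \<open>auto simp: emeasure_eq_measure intro!: ennreal_leI\<close>)
    \<comment> \<open>The empty set gives \<open>0 \<le> measure \<mu> S - e\<close>, so
      \<open>ennreal\<close> does not truncate the right-hand side.\<close>
    finally have "measure \<mu> S \<le> measure \<mu> S - e"
      using *[of "{}"] by (simp add: emeasure_eq_measure)
    with \<open>0 < e\<close> show False by simp
  qed
  then obtain K where K: "K \<subseteq> S" "compact K" "measure \<mu> S < measure \<mu> K + e" by blast
  have "measure \<mu> (S - K) = measure \<mu> S - measure \<mu> K"
    using assms K by (intro finite_measure_Diff) (auto simp: compact_imp_closed)
  with K that show thesis by simp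
qed

end

text \<open>Inner regularity of \<open>S\<close> and of its complement yields compact sets for each
  measure. Their finite unions are closed and disjoint, so one Urysohn function serves all measures,
  and the Weierstrass theorem replaces it by a polynomial on the common interval.\<close>

lemma poly_approximates_indicator:
  fixes \<mu> :: "'i \<Rightarrow> real measure"
  assumes I: "finite I" "\<And>i. i \<in> I \<Longrightarrow> supported_measure (\<mu> i) R"
    and S [measurable]: "S \<in> sets borel" and "0 < \<epsilon>"
  obtains q :: "real poly" where "\<And>i. i \<in> I \<Longrightarrow> (\<integral>x. (poly q x - indicator S x)\<^sup>2 \<partial>\<mu> i) < \<epsilon>"
proof -
  \<comment> \<open>The final bound is \<open>2 * \<eta>\<^sup>2 * B + 4 * \<delta>\<close>; with
    this choice and that of \<open>\<eta>\<close> below both terms equal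
    \<open>\<epsilon> / 4\<close>.\<close>
  define \<delta> where "\<delta> = \<epsilon> / 16"
  have "\<delta> > 0" using \<open>0 < \<epsilon>\<close> by (simp add: \<delta>_def)
  have "\<exists>K. K \<subseteq> S \<and> compact K \<and> measure (\<mu> i) (S - K) < \<delta>" if "i \<in> I" for i
    using supported_measure.inner_regular_measure[OF I(2)[OF that] S \<open>\<delta> > 0\<close>] by metis
  then obtain K where K: "\<And>i. i \<in> I \<Longrightarrow> K i \<subseteq> S"
      "\<And>i. i \<in> I \<Longrightarrow> compact (K i)" "\<And>i. i \<in> I \<Longrightarrow> measure (\<mu> i) (S - K i) < \<delta>"
    by metis
  have S': "- S \<in> sets borel" by simp
  have "\<exists>C. C \<subseteq> - S \<and> compact C \<and> measure (\<mu> i) (- S - C) < \<delta>" if "i \<in> I" for i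
    using supported_measure.inner_regular_measure[OF I(2)[OF that] S' \<open>\<delta> > 0\<close>] by metis
  then obtain C where C: "\<And>i. i \<in> I \<Longrightarrow> C i \<subseteq> - S"
      "\<And>i. i \<in> I \<Longrightarrow> compact (C i)" "\<And>i. i \<in> I \<Longrightarrow> measure (\<mu> i) (- S - C i) < \<delta>"
    by metis
  have cl: "closed (\<Union>i\<in>I. K i)" "closed (\<Union>i\<in>I. C i)"
    using I(1) K(2) C(2) by (auto intro!: closed_UN compact_imp_closed)
  have "(\<Union>i\<in>I. K i) \<inter> (\<Union>i\<in>I. C i) = {}"
    using K(1) C(1) by blast
  then obtain h :: "real \<Rightarrow> real" where h: "continuous_on UNIV h" "\<And>x. h x \<in> closed_segment 1 0"
      "\<And>x. x \<in> (\<Union>i\<in>I. K i) \<Longrightarrow> h x = 1" "\<And>x. x \<in> (\<Union>i\<in>I. C i) \<Longrightarrow> h x = 0"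
    using Urysohn[OF cl, of 1 0] by metis
  have h01: "0 \<le> h x" "h x \<le> 1" for x
    using h(2)[of x] by (auto simp: closed_segment_eq_real_ivl split: if_splits)
  have [measurable]: "h \<in> borel_measurable borel"
    using h(1) by (rule borel_measurable_continuous_onI)
  \<comment> \<open>The summand 1 keeps \<open>B\<close> positive if \<open>I\<close> is empty or
    all the measures vanish.\<close>
  define B where "B = (\<Sum>i\<in>I. measure (\<mu> i) UNIV) + 1"
  have B: "measure (\<mu> i) UNIV \<le> B" if "i \<in> I" for i
    using member_le_sum[OF that _ I(1), of "\<lambda>i. measure (\<mu> i) UNIV"] by (simp add: B_def)
  have "B > 0" by (simp add: B_def add_nonneg_pos sum_nonneg)
  define \<eta> where "\<eta> = sqrt (\<epsilon> / (8 * B))"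
  have "\<eta> > 0" using \<open>0 < \<epsilon>\<close> \<open>B > 0\<close> by (simp add: \<eta>_def)
  have \<eta>2: "\<eta>\<^sup>2 = \<epsilon> / (8 * B)" using \<open>0 < \<epsilon>\<close> \<open>B > 0\<close> by (simp add: \<eta>_def)
  obtain g where "real_polynomial_function g" and g: "\<And>x. x \<in> cball 0 R \<Longrightarrow> \<bar>h x - g x\<bar> < \<eta>"
    using Stone_Weierstrass_real_polynomial_function[of "cball 0 R" h \<eta>] h(1) \<open>\<eta> > 0\<close>
    by (metis compact_cball continuous_on_subset subset_UNIV)
  then obtain a n where a: "g = (\<lambda>x. \<Sum>i\<le>n. a i * x^i)"
    unfolding real_polynomial_function_iff_sum by blast
  define q where "q = (\<Sum>i\<le>n. monom (a i) i)"
  have q: "poly q x = g x" for x by (simp add: q_def a poly_sum poly_monom)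
  have "(\<integral>x. (poly q x - indicator S x)\<^sup>2 \<partial>\<mu> i) < \<epsilon>" if "i \<in> I" for i
  proof -
    interpret supported_measure "\<mu> i" R by (rule I(2)[OF that])
    have [measurable]: "K i \<in> sets borel" "C i \<in> sets borel"
      using K(2) C(2) that by (auto intro: borel_compact)
    have pt: "(poly q x - indicator S x)\<^sup>2
        \<le> 2 * \<eta>\<^sup>2 + 2 * indicator (S - K i) x + 2 * indicator (- S - C i) x" if "\<bar>x\<bar> \<le> R" for x
    proof -
      have "\<bar>poly q x - h x\<bar> \<le> \<eta>" using g[of x] that by (simp add: q abs_minus_commute)
      then have 1: "(poly q x - h x)\<^sup>2 \<le> \<eta>\<^sup>2"
        by (metis abs_ge_zero power2_abs power_mono)
      have 2: "(h x - indicator S x)\<^sup>2 \<le> indicator (S - K i) x + indicator (- S - C i) x"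
      proof -
        consider "x \<in> K i" | "x \<in> C i" | "x \<notin> K i" "x \<notin> C i" by blast
        then show ?thesis
        proof cases
          case 1 with K(1) \<open>i \<in> I\<close> h(3) show ?thesis by (auto simp: indicator_def)
        next
          case 2 with C(1) \<open>i \<in> I\<close> h(4) show ?thesis by (auto simp: indicator_def)
        next
          case 3
          have "(h x)\<^sup>2 \<le> 1" "(h x - 1)\<^sup>2 \<le> 1"
            using h01[of x] by (auto simp: abs_square_le_1)
          with 3 show ?thesis by (auto simp: indicator_def)
        qed
      qed
      have "(poly q x - indicator S x)\<^sup>2 \<le> 2 * (poly q x - h x)\<^sup>2 + 2 * (h x - indicator S x)\<^sup>2"
        using sum_squares_bound[of "poly q x - h x" "h x - indicator S x"]
        by (simp add: power2_eq_square algebra_simps)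
      with 1 2 show ?thesis by linarith
    qed
    have ii: "integrable (\<mu> i) (indicator (S - K i) :: real \<Rightarrow> real)"
      "integrable (\<mu> i) (indicator (- S - C i) :: real \<Rightarrow> real)"
      by (auto intro!: integrable_real_indicator simp: emeasure_eq_measure less_top[symmetric])
    have "(\<integral>x. (poly q x - indicator S x)\<^sup>2 \<partial>\<mu> i)
        \<le> (\<integral>x. 2 * \<eta>\<^sup>2 + 2 * indicator (S - K i) x + 2 * indicator (- S - C i) x \<partial>\<mu> i)"
      using pt AE_bounded integrable_poly_minus_indicator[OF S] ii
      by (intro integral_mono_AE) auto
    also have "\<dots> = 2 * \<eta>\<^sup>2 * measure (\<mu> i) UNIV + 2 * measure (\<mu> i) (S - K i)
        + 2 * measure (\<mu> i) (- S - C i)"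
      using ii by simp
    also have "\<dots> \<le> 2 * \<eta>\<^sup>2 * B + 2 * \<delta> + 2 * \<delta>"
      using B[OF that] K(3)[OF that] C(3)[OF that]
      by (intro add_mono mult_left_mono) auto
    also have "\<dots> < \<epsilon>" using \<open>B > 0\<close> \<open>0 < \<epsilon>\<close> by (simp add: \<eta>2 \<delta>_def)
    finally show ?thesis .
  qed
  then show thesis using that by blast
qed

text \<open>Lebesgue decomposition by exhaustion. Null sets are closed under countable unions, so
  some Lebesgue null set \<open>Z'\<close> has maximal \<open>\<mu>\<close>-measure; a null set with
  mass outside \<open>Z'\<close> could be added to it. The set \<open>S\<close> is the complement of
  \<open>Z'\<close>.\<close>

lemma absolutely_continuous_part:
  fixes \<mu> :: "real measure"
  assumes "finite_measure \<mu>" and sets [measurable_cong]: "sets \<mu> = sets borel"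
  obtains S where "S \<in> sets borel" "emeasure lborel (- S) = 0"
    "absolutely_continuous lborel (density \<mu> (indicator S))"
proof -
  interpret finite_measure \<mu> by fact
  have sp: "space \<mu> = UNIV" using sets_eq_imp_space_eq[OF sets] by simp
  define N where "N = null_sets (lborel :: real measure)"
  define a where "a = (SUP Z\<in>N. measure \<mu> Z)"
  have bdd: "bdd_above (measure \<mu> ` N)"
    by (rule bdd_aboveI2[where M="measure \<mu> UNIV"]) (metis bounded_measure sp)
  have "N \<noteq> {}" by (auto simp: N_def)
  have "\<exists>Z\<in>N. a - 1 / real (Suc n) < measure \<mu> Z" for n
    using less_cSUP_iff[OF \<open>N \<noteq> {}\<close> bdd, of "a - 1 / real (Suc n)"] by (simp add: a_def)
  then obtain Z where Z: "\<And>n. Z n \<in> N" "\<And>n. a - 1 / real (Suc n) < measure \<mu> (Z n)"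
    by metis
  define Z' where "Z' = (\<Union>n. Z n)"
  have Z': "Z' \<in> N" using Z(1) by (auto simp: N_def Z'_def)
  then have Z'm [measurable]: "Z' \<in> sets borel" by (auto simp: N_def)
  have "a \<le> measure \<mu> Z' + 1 / real (Suc n)" for n
  proof -
    have "measure \<mu> (Z n) \<le> measure \<mu> Z'"
      by (rule finite_measure_mono) (auto simp: Z'_def sets Z'm[unfolded Z'_def])
    with Z(2)[of n] show ?thesis by simp
  qed
  moreover have "(\<lambda>n. measure \<mu> Z' + 1 / real (Suc n)) \<longlonglongrightarrow> measure \<mu> Z'"
    by (rule LIMSEQ_Suc[of "\<lambda>n. measure \<mu> Z' + 1 / real n"]) real_asymp
  ultimately have ge: "a \<le> measure \<mu> Z'"
    by (intro LIMSEQ_le_const) auto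
  have null: "emeasure \<mu> (E - Z') = 0" if "E \<in> N" for E
  proof -
    have [measurable]: "E \<in> sets borel" using that by (auto simp: N_def)
    have "Z' \<union> E \<in> N" using that Z' by (auto simp: N_def)
    then have "measure \<mu> (Z' \<union> E) \<le> a" unfolding a_def by (intro cSUP_upper bdd)
    moreover have "measure \<mu> (Z' \<union> E) = measure \<mu> Z' + measure \<mu> (E - Z')"
      by (rule finite_measure_Union') auto
    ultimately have "measure \<mu> (E - Z') \<le> 0" using ge by linarith
    then show ?thesis by (simp add: emeasure_eq_measure measure_le_0_iff)
  qed
  show thesis
  proof
    show "- Z' \<in> sets borel" by simp
    show "emeasure lborel (- (- Z')) = 0" using Z' by (auto simp: N_def)
    show "absolutely_continuous lborel (density \<mu> (indicator (- Z')))"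
      unfolding absolutely_continuous_def
    proof
      fix E :: "real set" assume E: "E \<in> null_sets lborel"
      then have [measurable]: "E \<in> sets borel" by auto
      have "emeasure (density \<mu> (indicator (- Z'))) E
          = (\<integral>\<^sup>+x. indicator (- Z') x * indicator E x \<partial>\<mu>)"
        by (intro emeasure_density) (auto simp: sets)
      also have "\<dots> = (\<integral>\<^sup>+x. indicator (E - Z') x \<partial>\<mu>)"
        by (intro nn_integral_cong) (auto simp: indicator_def)
      also have "\<dots> = 0" using null E by (simp add: N_def)
      finally show "E \<in> null_sets (density \<mu> (indicator (- Z')))"
        by (simp add: null_sets_def sets)
    qed
  qed
qed

section \<open>The Hausdorff moment problem\<close>

text \<open>Expand \<open>x^k * (x + (1 - x))^(n - k)\<close> by the binomial theorem. The
  coefficients are arranged so that the k-th moment becomes an average of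
  \<open>(j choose k) / (n choose k)\<close>, which is close to \<open>(j / n)^k\<close>.\<close>

lemma monom_Bernstein:
  fixes k n :: nat
  assumes "k \<le> n"
  shows "monom (1::real) k = (\<Sum>j\<le>n. smult (real (j choose k) / real (n choose k) * real (n choose j))
           ([:0, 1:] ^ j * [:1, -1:] ^ (n - j)))"
proof -
  let ?x = "[:0, 1:] :: real poly" and ?y = "[:1, -1:] :: real poly"
  have "?x + ?y = 1" by (simp add: one_pCons)
  then have "monom (1::real) k = ?x ^ k * (?x + ?y) ^ (n - k)"
    by (simp add: monom_altdef del: add_pCons)
  also have "\<dots> = (\<Sum>i\<le>n - k. ?x ^ k * (of_nat ((n - k) choose i) * ?x ^ i * ?y ^ (n - k - i)))"
    by (simp only: binomial_ring sum_distrib_left)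
  also have "\<dots> = (\<Sum>j\<in>{k..n}. smult (real (n - k choose (j - k))) (?x ^ j * ?y ^ (n - j)))"
    by (rule sum.reindex_bij_witness[of _ "\<lambda>j. j - k" "\<lambda>i. i + k"])
       (use assms in \<open>auto simp: power_add of_nat_poly algebra_simps\<close>)
  also have "\<dots> = (\<Sum>j\<in>{k..n}. smult (real (j choose k) / real (n choose k) * real (n choose j))
           (?x ^ j * ?y ^ (n - j)))"
  proof (intro sum.cong refl arg_cong2[where f=smult])
    fix j assume "j \<in> {k..n}"
    then have "real (n choose j) * real (j choose k) = real (n choose k) * real (n - k choose (j - k))"
      by (metis atLeastAtMost_iff choose_mult of_nat_mult)
    moreover have "real (n choose k) \<noteq> 0" using assms by simp
    ultimately show "real (n - k choose (j - k)) = real (j choose k) / real (n choose k) * real (n choose j)"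
      by (simp add: field_simps)
  qed
  \<comment> \<open>The added terms with \<open>j < k\<close> vanish because
    \<open>j choose k\<close> is 0.\<close>
  also have "\<dots> = (\<Sum>j\<le>n. smult (real (j choose k) / real (n choose k) * real (n choose j))
           (?x ^ j * ?y ^ (n - j)))"
    by (rule sum.mono_neutral_left) (auto simp: not_le)
  finally show ?thesis .
qed

text \<open>Both quantities are products of \<open>k\<close> factors of absolute value at most 1, so
  their difference is at most the sum of the differences of the factors.\<close>

lemma binomial_ratio_approx:
  fixes j k n :: nat
  assumes "j \<le> n" "2 * k \<le> n" "0 < n"
  shows "\<bar>real (j choose k) / real (n choose k) - (real j / real n) ^ k\<bar> \<le> real k * (real k / (real n - real k))"
proof (cases "k = 0")
  case False
  have prod: "real (m choose k) = (\<Prod>i<k. real m - real i) / fact k" for m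
    by (simp add: binomial_gbinomial gbinomial_prod_rev atLeast0LessThan)
  have *: "real (j choose k) / real (n choose k) = (\<Prod>i<k. (real j - real i) / (real n - real i))"
    by (simp add: prod prod_dividef)
  \<comment> \<open>The factor \<open>(j - i) / (n - i)\<close> may be negative;
    \<open>2 * k \<le> n\<close> ensures that its absolute value is still at most 1.\<close>
  have "norm ((\<Prod>i<k. (real j - real i) / (real n - real i)) - (\<Prod>i<k. real j / real n))
      \<le> (\<Sum>i<k. norm ((real j - real i) / (real n - real i) - real j / real n))"
    by (rule norm_prod_diff) (use assms in auto)
  also have "\<dots> \<le> (\<Sum>i<k. real k / (real n - real k))"
  proof (rule sum_mono)
    fix i assume "i \<in> {..<k}"
    then have i: "i < k" by simp
    have "(real j - real i) / (real n - real i) - real j / real n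
        = - (real i * (real n - real j) / (real n * (real n - real i)))"
      using i assms by (simp add: field_simps)
    also have "norm \<dots> = real i * ((real n - real j) / real n) / (real n - real i)"
      using i assms by simp
    also have "\<dots> \<le> real k * 1 / (real n - real k)"
      using i assms by (intro frac_le mult_mono) auto
    finally show "norm ((real j - real i) / (real n - real i) - real j / real n) \<le> real k / (real n - real k)"
      by simp
  qed
  finally show ?thesis by (simp add: *)
qed simp

text \<open>By positivity the numbers \<open>w n j\<close> are masses at the points
  \<open>j / n\<close> with total mass \<open>L 1\<close>. Their k-th moments converge to
  \<open>L (monom 1 k)\<close>, and a weak limit of the normalized measures, scaled back by
  \<open>L 1\<close>, represents \<open>L\<close>.\<close>

theorem Hausdorff_moments:
  fixes L :: "real poly \<Rightarrow> real"
  assumes add: "\<And>p q. L (p + q) = L p + L q" and smult: "\<And>c p. L (smult c p) = c * L p"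
    and pos: "\<And>i j. 0 \<le> L ([:0, 1:] ^ i * [:1, -1:] ^ j)"
  obtains \<mu> where "finite_measure \<mu>" "sets \<mu> = sets borel" "emeasure \<mu> (- {0..1}) = 0"
    "\<And>p. L p = (\<integral>x. poly p x \<partial>\<mu>)"
proof -
  define w where "w n j = real (n choose j) * L ([:0, 1:] ^ j * [:1, -1:] ^ (n - j))" for n j
  have w0: "w n j \<ge> 0" for n j using pos by (simp add: w_def)
  have L0: "L 0 = 0" using smult[of 0 0] by simp
  have Lsum: "L (sum f I) = (\<Sum>i\<in>I. L (f i))" if "finite I" for f :: "nat \<Rightarrow> real poly" and I
    using that by (induction I rule: finite_induct) (auto simp: add L0)
  have Lk: "L (monom 1 k) = (\<Sum>j\<le>n. real (j choose k) / real (n choose k) * w n j)" if "k \<le> n" for k n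
    by (subst monom_Bernstein[OF that]) (simp add: Lsum smult w_def mult_ac)
  have L1: "L 1 = (\<Sum>j\<le>n. w n j)" for n
    using Lk[of 0 n] by simp
  \<comment> \<open>Only monomials need checking, since both sides are linear; the bounded support
    makes all polynomials integrable.\<close>
  have Lext: "L p = (\<integral>x. poly p x \<partial>\<mu>)"
    if "finite_measure \<mu>" and [measurable_cong]: "sets \<mu> = sets borel" and "emeasure \<mu> (- {0..1}) = 0"
      and mom: "\<And>k. L (monom 1 k) = (\<integral>x. x ^ k \<partial>\<mu>)" for \<mu> p
  proof -
    interpret supported_measure \<mu> 1
    proof (intro supported_measure.intro supported_measure_axioms.intro that(1,2))
      show "emeasure \<mu> {x. 1 < \<bar>x\<bar>} = 0"
        by (rule emeasure_eq_0[OF _ that(3)]) (auto simp: that(2))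
    qed
    show ?thesis
    proof (rule additive_poly_eqI)
      show "L (monom c n) = (\<integral>x. poly (monom c n) x \<partial>\<mu>)" for c n
        using smult[of c "monom 1 n"] mom[of n] by (simp add: poly_monom smult_monom)
      show "(\<integral>x. poly (p + q) x \<partial>\<mu>) = (\<integral>x. poly p x \<partial>\<mu>) + (\<integral>x. poly q x \<partial>\<mu>)" for p q
        by simp
    qed (rule add)
  qed
  show thesis
  \<comment> \<open>Normalizing to probability measures divides by \<open>L 1\<close>; if it is 0,
    all weights and hence all moments vanish.\<close>
  proof (cases "L 1 = 0")
    case True
    then have "w n j = 0" if "j \<le> n" for n j
      using L1[of n] that w0 by (simp add: sum_nonneg_eq_0_iff)
    then have "L (monom 1 k) = 0" for k
      using Lk[of k k] by simp
    moreover have "finite_measure (null_measure borel :: real measure)"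
      by (intro finite_measureI) simp
    ultimately show thesis
      by (intro that[of "null_measure borel"] Lext) auto
  next
    case False
    then have "L 1 > 0" using L1[of 0] w0[of 0 0] by simp
    define P where "P n = embed_pmf (\<lambda>j. if j \<le> n then w n j / L 1 else 0)" for n
    have P: "pmf (P n) j = (if j \<le> n then w n j / L 1 else 0)" for n j
      unfolding P_def
    proof (rule pmf_embed_pmf)
      have "(\<integral>\<^sup>+ x. ennreal (if x \<le> n then w n x / L 1 else 0) \<partial>count_space UNIV)
          = (\<Sum>j\<le>n. ennreal (if j \<le> n then w n j / L 1 else 0))"
        by (rule nn_integral_count_space') (auto simp: w0)
      also have "\<dots> = ennreal (\<Sum>j\<le>n. w n j / L 1)"
        using \<open>L 1 > 0\<close> by (simp add: w0)
      also have "(\<Sum>j\<le>n. w n j / L 1) = 1"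
        using \<open>L 1 > 0\<close> L1[of n] by (simp add: sum_divide_distrib[symmetric])
      finally show "(\<integral>\<^sup>+ x. ennreal (if x \<le> n then w n x / L 1 else 0) \<partial>count_space UNIV) = 1"
        by simp
    qed (use \<open>L 1 > 0\<close> w0 in auto)
    \<comment> \<open>The index \<open>Suc n\<close> avoids division by zero in the grid
      points.\<close>
    define D where "D n = distr (measure_pmf (P (Suc n))) borel (\<lambda>j. real j / real (Suc n))" for n
    have D: "(\<integral>x. f x \<partial>D n) = (\<Sum>j\<le>Suc n. w (Suc n) j / L 1 * f (real j / real (Suc n)))"
      if [measurable]: "f \<in> borel_measurable borel" for f :: "real \<Rightarrow> real" and n
    proof -
      have "(\<integral>x. f x \<partial>D n) = (\<integral>j. f (real j / real (Suc n)) \<partial>measure_pmf (P (Suc n)))"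
        unfolding D_def by (rule integral_distr) auto
      also have "\<dots> = (\<Sum>j\<le>Suc n. pmf (P (Suc n)) j *\<^sub>R f (real j / real (Suc n)))"
        by (rule integral_measure_pmf) (auto simp: set_pmf_iff P split: if_splits)
      finally show ?thesis by (simp add: P)
    qed
    have rd: "real_distribution (D n)" for n
      unfolding D_def real_distribution_def real_distribution_axioms_def
      by (auto intro!: prob_space.prob_space_distr measure_pmf.prob_space_axioms)
    \<comment> \<open>Tightness is stated with half-open intervals, so the left end is moved to -1
      in order to include the grid point 0.\<close>
    have D01: "measure (D n) {-1<..1} = 1" for n
    proof -
      have "measure (D n) {-1<..1} = (\<integral>x. indicator {-1<..1} x \<partial>D n)"
        using rd[of n] by (simp add: real_distribution_def real_distribution_axioms_def)
      also have "\<dots> = (\<Sum>j\<le>Suc n. w (Suc n) j / L 1 * indicator {-1<..1} (real j / real (Suc n)))"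
        by (rule D) auto
      also have "\<dots> = (\<Sum>j\<le>Suc n. w (Suc n) j / L 1)"
        by (intro sum.cong refl) (auto simp: indicator_def field_simps)
      finally show ?thesis
        using \<open>L 1 > 0\<close> L1[of "Suc n"] by (simp add: sum_divide_distrib[symmetric] del: sum.atMost_Suc)
    qed
    have "tight D"
      unfolding tight_def
    proof (intro conjI allI impI)
      fix e :: real assume "0 < e"
      then have "(-1::real) < 1 \<and> (\<forall>n. 1 - e < measure (D n) {-1<..1})" by (simp add: D01)
      then show "\<exists>a b. a < b \<and> (\<forall>n. 1 - e < measure (D n) {a<..b})" by blast
    qed (rule rd)
    from tight_imp_convergent_subsubsequence[OF this strict_mono_id]
    obtain r M where r: "strict_mono r" and M: "real_distribution M" and wc: "weak_conv_m (D \<circ> r) M"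
      by auto
    interpret M: real_distribution M by (rule M)
    have lim: "(\<lambda>n. \<integral>x. f x \<partial>D (r n)) \<longlonglongrightarrow> (\<integral>x. f x \<partial>M)"
      if "\<And>x. isCont f x" "\<And>x. \<bar>f x\<bar> \<le> B" for f :: "real \<Rightarrow> real" and B
      using weak_conv_imp_integral_bdd_continuous_conv[of "D \<circ> r" M f B] rd M wc that by auto
    \<comment> \<open>Clamping to \<open>{0..1}\<close> makes powers bounded and continuous on the
      whole line, as weak convergence requires, and changes nothing at the grid points.\<close>
    define cl :: "real \<Rightarrow> real" where "cl x = max 0 (min 1 x)" for x
    have cl: "isCont cl x" "0 \<le> cl x" "cl x \<le> 1" for x
      unfolding cl_def by (auto intro!: continuous_intros)
    have contm: "f \<in> borel_measurable borel" if "\<And>x. isCont f x" for f :: "real \<Rightarrow> real"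
      using that by (intro borel_measurable_continuous_onI continuous_at_imp_continuous_on) auto
    have [measurable]: "cl \<in> borel_measurable borel" using contm cl by blast
    have cl_id: "cl (real j / real (Suc n)) = real j / real (Suc n)" if "j \<le> Suc n" for j n
      using that by (simp add: cl_def)
    have moments: "(\<integral>x. cl x ^ k \<partial>M) = L (monom 1 k) / L 1" for k
    proof (rule LIMSEQ_unique)
      show "(\<lambda>n. \<integral>x. cl x ^ k \<partial>D (r n)) \<longlonglongrightarrow> (\<integral>x. cl x ^ k \<partial>M)"
        by (rule lim[of _ 1]) (auto intro!: continuous_intros cl simp: power_le_one cl)
      have "(\<lambda>n. (\<integral>x. cl x ^ k \<partial>D n) - L (monom 1 k) / L 1) \<longlonglongrightarrow> 0"
      proof (rule tendsto_0_le)
        show "(\<lambda>n. real k * (real k / (real (Suc n) - real k))) \<longlonglongrightarrow> 0" by real_asymp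
        show "\<forall>\<^sub>F n in sequentially. norm ((\<integral>x. cl x ^ k \<partial>D n) - L (monom 1 k) / L 1)
            \<le> norm (real k * (real k / (real (Suc n) - real k))) * 1"
          using eventually_ge_at_top[of "2 * k"]
        proof eventually_elim
          case (elim n)
          let ?c = "\<lambda>j. real (j choose k) / real (Suc n choose k)"
          have 1: "(\<integral>x. cl x ^ k \<partial>D n) = (\<Sum>j\<le>Suc n. w (Suc n) j / L 1 * (real j / real (Suc n)) ^ k)"
            by (subst D) (auto simp: cl_id simp del: sum.atMost_Suc of_nat_Suc intro!: sum.cong)
          have 2: "L (monom 1 k) / L 1 = (\<Sum>j\<le>Suc n. w (Suc n) j / L 1 * ?c j)"
            using elim by (subst Lk[of k "Suc n"]) (auto simp: sum_divide_distrib mult_ac simp del: sum.atMost_Suc)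
          have "\<bar>(\<integral>x. cl x ^ k \<partial>D n) - L (monom 1 k) / L 1\<bar>
              = \<bar>\<Sum>j\<le>Suc n. w (Suc n) j / L 1 * ((real j / real (Suc n)) ^ k - ?c j)\<bar>"
            unfolding 1 2 by (simp add: sum_subtractf[symmetric] right_diff_distrib del: sum.atMost_Suc of_nat_Suc)
          also have "\<dots> \<le> (\<Sum>j\<le>Suc n. w (Suc n) j / L 1 * (real k * (real k / (real (Suc n) - real k))))"
          proof (rule order_trans[OF sum_abs], rule sum_mono)
            fix j assume "j \<in> {..Suc n}"
            then have "\<bar>?c j - (real j / real (Suc n)) ^ k\<bar> \<le> real k * (real k / (real (Suc n) - real k))"
              using elim by (intro binomial_ratio_approx) auto
            then show "\<bar>w (Suc n) j / L 1 * ((real j / real (Suc n)) ^ k - ?c j)\<bar>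
                \<le> w (Suc n) j / L 1 * (real k * (real k / (real (Suc n) - real k)))"
              using w0 \<open>L 1 > 0\<close> unfolding abs_mult abs_minus_commute[of "(real j / real (Suc n)) ^ k"]
              by (intro mult_mono) auto
          qed
          also have "\<dots> = real k * (real k / (real (Suc n) - real k))"
            using \<open>L 1 > 0\<close> L1[of "Suc n"]
            by (simp add: sum_distrib_right[symmetric] sum_divide_distrib[symmetric] del: sum.atMost_Suc)
          finally show ?case
            unfolding real_norm_def mult_1_right by (rule order_trans[OF _ abs_ge_self])
        qed
      qed
      then have "(\<lambda>n. \<integral>x. cl x ^ k \<partial>D n) \<longlonglongrightarrow> L (monom 1 k) / L 1"
        by (simp add: LIM_zero_iff)
      from LIMSEQ_subseq_LIMSEQ[OF this r]
      show "(\<lambda>n. \<integral>x. cl x ^ k \<partial>D (r n)) \<longlonglongrightarrow> L (monom 1 k) / L 1"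
        by (simp add: o_def)
    qed
    \<comment> \<open>The distance to \<open>{0..1}\<close>, cut off at 1, is a bounded continuous
      test function with integral 0 for every \<open>D n\<close>, hence also for the limit.\<close>
    have AE01: "AE x in M. x \<in> {0..1}"
    proof -
      define f where "f x = min 1 \<bar>x - cl x\<bar>" for x
      have fc: "isCont f x" for x unfolding f_def by (intro continuous_intros cl)
      have [measurable]: "f \<in> borel_measurable borel" using contm fc by blast
      have "(\<integral>x. f x \<partial>D n) = 0" for n
        by (subst D) (auto simp: f_def cl_id simp del: sum.atMost_Suc of_nat_Suc intro!: sum.neutral)
      then have "(\<integral>x. f x \<partial>M) = 0"
        using lim[of f 1, OF fc] LIMSEQ_const_iff[of 0 "\<integral>x. f x \<partial>M"] by (simp add: f_def)
      moreover have "integrable M f"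
        by (rule M.integrable_const_bound[where B=1]) (auto simp: f_def)
      ultimately have "AE x in M. f x = 0"
        by (subst (asm) integral_nonneg_eq_0_iff_AE) (auto simp: f_def)
      then show ?thesis
        by eventually_elim (auto simp: f_def cl_def min_def max_def split: if_splits)
    qed
    \<comment> \<open>This restores the total mass \<open>L 1\<close> removed by the
      normalization.\<close>
    define \<mu> where "\<mu> = density M (\<lambda>x. ennreal (L 1))"
    have sets\<mu>: "sets \<mu> = sets borel" by (simp add: \<mu>_def)
    have fin: "finite_measure \<mu>"
      by (intro finite_measureI) (simp add: \<mu>_def emeasure_density_const ennreal_mult_eq_top_iff M.emeasure_eq_measure)
    have "emeasure M (- {0..1}) = 0"
      using AE01 by (subst (asm) AE_iff_measurable[of "- {0..1}"]) auto
    then have out: "emeasure \<mu> (- {0..1}) = 0"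
      by (simp add: \<mu>_def emeasure_density_const)
    have mom: "L (monom 1 k) = (\<integral>x. x ^ k \<partial>\<mu>)" for k
    proof -
      have "(\<integral>x. x ^ k \<partial>\<mu>) = (\<integral>x. L 1 * x ^ k \<partial>M)"
        unfolding \<mu>_def using \<open>L 1 > 0\<close> by (subst integral_density) auto
      also have "\<dots> = L 1 * (\<integral>x. x ^ k \<partial>M)" by simp
      also have "(\<integral>x. x ^ k \<partial>M) = (\<integral>x. cl x ^ k \<partial>M)"
        using AE01 by (intro integral_cong_AE) (auto simp: cl_def)
      finally show ?thesis using \<open>L 1 > 0\<close> by (simp add: moments)
    qed
    show thesis by (rule that[OF fin sets\<mu> out Lext[OF fin sets\<mu> out mom]])
  qed
qed


section \<open>The Hilbert space of square-summable functions\<close>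

lemma ell2_zero_outside: "f \<in> ell2 V \<Longrightarrow> v \<notin> V \<Longrightarrow> f v = 0"
  by (simp add: ell2_def)

lemma ell2_norm_nonneg [simp]: "0 \<le> ell2_norm V f"
  by (simp add: ell2_norm_def infsum_nonneg)

lemma ell2_norm_square: "(ell2_norm V f)\<^sup>2 = (\<Sum>\<^sub>\<infinity>v\<in>V. (cmod (f v))\<^sup>2)"
  by (simp add: ell2_norm_def infsum_nonneg)

lemma L2_set_le_ell2_norm:
  assumes "f \<in> ell2 V" "finite F" "F \<subseteq> V"
  shows "L2_set (\<lambda>v. cmod (f v)) F \<le> ell2_norm V f"
  unfolding L2_set_def ell2_norm_def
  using assms by (intro real_sqrt_le_mono finite_sum_le_infsum) (auto simp: ell2_def)

lemma cmod_le_ell2_norm: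
  assumes "f \<in> ell2 V"
  shows "cmod (f v) \<le> ell2_norm V f"
proof (cases "v \<in> V")
  case True
  then show ?thesis using L2_set_le_ell2_norm[OF assms, of "{v}"] by (simp add: L2_set_def)
next
  case False
  then show ?thesis using ell2_zero_outside[OF assms] by simp
qed

text \<open>Reduces membership and norm bounds to finite sets of vertices, where the inequalities
  for \<open>L2_set\<close> apply.\<close>

lemma ell2_boundedI:
  assumes "\<And>v. v \<notin> V \<Longrightarrow> f v = 0"
    and le: "\<And>F. finite F \<Longrightarrow> F \<subseteq> V \<Longrightarrow> L2_set (\<lambda>v. cmod (f v)) F \<le> B"
  shows "f \<in> ell2 V" "ell2_norm V f \<le> B"
proof -
  have "0 \<le> B" using le[of "{}"] by simp
  have *: "(\<Sum>v\<in>F. (cmod (f v))\<^sup>2) \<le> B\<^sup>2" if "finite F" "F \<subseteq> V" for F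
    using le[OF that] \<open>0 \<le> B\<close> by (simp add: L2_set_def sqrt_le_D)
  have "(\<lambda>v. (cmod (f v))\<^sup>2) summable_on V"
    by (rule nonneg_bdd_above_summable_on) (auto intro!: bdd_aboveI2[where M="B\<^sup>2"] *)
  then show "f \<in> ell2 V" using assms(1) by (simp add: ell2_def)
  have "(\<Sum>\<^sub>\<infinity>v\<in>V. (cmod (f v))\<^sup>2) \<le> B\<^sup>2"
    by (rule infsum_le_finite_sums[OF \<open>(\<lambda>v. (cmod (f v))\<^sup>2) summable_on V\<close> *])
  then show "ell2_norm V f \<le> B"
    using \<open>0 \<le> B\<close> by (simp add: ell2_norm_def real_le_lsqrt infsum_nonneg)
qed

lemma ell2_zero [simp]: "(\<lambda>_. 0) \<in> ell2 V" "ell2_norm V (\<lambda>_. 0) = 0"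
  by (simp_all add: ell2_def ell2_norm_def)

lemma ell2_norm_eq_0_iff:
  assumes "f \<in> ell2 V"
  shows "ell2_norm V f = 0 \<longleftrightarrow> f = (\<lambda>_. 0)"
proof
  assume "ell2_norm V f = 0"
  then show "f = (\<lambda>_. 0)" using cmod_le_ell2_norm[OF assms] by auto
qed simp

lemma ell2_add:
  assumes "f \<in> ell2 V" "g \<in> ell2 V"
  shows "(\<lambda>v. f v + g v) \<in> ell2 V" "ell2_norm V (\<lambda>v. f v + g v) \<le> ell2_norm V f + ell2_norm V g"
proof -
  have "L2_set (\<lambda>v. cmod (f v + g v)) F \<le> ell2_norm V f + ell2_norm V g" if "finite F" "F \<subseteq> V" for F
  proof -
    have "L2_set (\<lambda>v. cmod (f v + g v)) F \<le> L2_set (\<lambda>v. cmod (f v) + cmod (g v)) F"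
      by (rule L2_set_mono) (auto intro: norm_triangle_ineq)
    also have "\<dots> \<le> L2_set (\<lambda>v. cmod (f v)) F + L2_set (\<lambda>v. cmod (g v)) F"
      by (rule L2_set_triangle_ineq)
    finally show ?thesis
      using L2_set_le_ell2_norm[OF assms(1) that] L2_set_le_ell2_norm[OF assms(2) that] by linarith
  qed
  moreover have "f v + g v = 0" if "v \<notin> V" for v
    using assms[THEN ell2_zero_outside, OF that] by simp
  ultimately show "(\<lambda>v. f v + g v) \<in> ell2 V"
      "ell2_norm V (\<lambda>v. f v + g v) \<le> ell2_norm V f + ell2_norm V g"
    by (intro ell2_boundedI; blast)+
qed

lemma ell2_scale:
  assumes "f \<in> ell2 V"
  shows "(\<lambda>v. c * f v) \<in> ell2 V" "ell2_norm V (\<lambda>v. c * f v) = cmod c * ell2_norm V f"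
proof -
  have *: "(cmod (c * f v))\<^sup>2 = (cmod c)\<^sup>2 * (cmod (f v))\<^sup>2" for v
    by (simp add: norm_mult power_mult_distrib)
  show "(\<lambda>v. c * f v) \<in> ell2 V"
    using assms by (auto simp: ell2_def * intro!: summable_on_cmult_right)
  show "ell2_norm V (\<lambda>v. c * f v) = cmod c * ell2_norm V f"
    by (simp add: ell2_norm_def * infsum_cmult_right' real_sqrt_mult)
qed

lemma ell2_diff:
  assumes "f \<in> ell2 V" "g \<in> ell2 V"
  shows "(\<lambda>v. f v - g v) \<in> ell2 V"
  using ell2_add(1)[OF assms(1) ell2_scale(1)[OF assms(2), of "-1"]] by simp

lemma ell2_finite_support:
  assumes "finite {v. f v \<noteq> 0}" "{v. f v \<noteq> 0} \<subseteq> V"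
  shows "f \<in> ell2 V"
proof -
  have "(\<lambda>v. (cmod (f v))\<^sup>2) summable_on V"
    by (rule finite_nonzero_values_imp_summable_on) (rule finite_subset[OF _ assms(1)], auto)
  then show ?thesis using assms(2) by (auto simp: ell2_def)
qed

lemma ell2_inner_summable:
  assumes "f \<in> ell2 V" "g \<in> ell2 V"
  shows "(\<lambda>v. cmod (cnj (f v) * g v)) summable_on V"
    and "(\<Sum>\<^sub>\<infinity>v\<in>V. cmod (cnj (f v) * g v)) \<le> ell2_norm V f * ell2_norm V g"
proof -
  have *: "(\<Sum>v\<in>F. cmod (cnj (f v) * g v)) \<le> ell2_norm V f * ell2_norm V g"
    if "finite F" "F \<subseteq> V" for F
  proof -
    have "(\<Sum>v\<in>F. cmod (cnj (f v) * g v)) = (\<Sum>v\<in>F. \<bar>cmod (f v)\<bar> * \<bar>cmod (g v)\<bar>)"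
      by (simp add: norm_mult)
    also have "\<dots> \<le> L2_set (\<lambda>v. cmod (f v)) F * L2_set (\<lambda>v. cmod (g v)) F"
      by (rule L2_set_mult_ineq)
    also have "\<dots> \<le> ell2_norm V f * ell2_norm V g"
      using assms that by (intro mult_mono L2_set_le_ell2_norm) auto
    finally show ?thesis .
  qed
  show s: "(\<lambda>v. cmod (cnj (f v) * g v)) summable_on V"
    by (rule nonneg_bdd_above_summable_on)
       (auto intro!: bdd_aboveI2[where M="ell2_norm V f * ell2_norm V g"] * simp del: norm_mult)
  show "(\<Sum>\<^sub>\<infinity>v\<in>V. cmod (cnj (f v) * g v)) \<le> ell2_norm V f * ell2_norm V g"
    by (rule infsum_le_finite_sums[OF s *])
qed

lemma ell2_inner_summable_on:
  assumes "f \<in> ell2 V" "g \<in> ell2 V"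
  shows "(\<lambda>v. cnj (f v) * g v) summable_on V"
  by (rule abs_summable_summable[OF ell2_inner_summable(1)[OF assms]])

lemma ell2_Cauchy_Schwarz:
  assumes "f \<in> ell2 V" "g \<in> ell2 V"
  shows "cmod (ell2_inner V f g) \<le> ell2_norm V f * ell2_norm V g"
  unfolding ell2_inner_def
  using norm_infsum_bound[OF ell2_inner_summable(1)[OF assms]] ell2_inner_summable(2)[OF assms]
  by linarith

lemma ell2_inner_add_right:
  assumes "f \<in> ell2 V" "g \<in> ell2 V" "h \<in> ell2 V"
  shows "ell2_inner V f (\<lambda>v. g v + h v) = ell2_inner V f g + ell2_inner V f h"
  unfolding ell2_inner_def distrib_left
  by (rule infsum_add) (use assms in \<open>auto intro: ell2_inner_summable_on\<close>)

lemma ell2_inner_scale_right: "ell2_inner V f (\<lambda>v. c * g v) = c * ell2_inner V f g"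
  unfolding ell2_inner_def by (subst infsum_cmult_right'[symmetric]) (simp add: mult_ac)

lemma ell2_inner_commute: "ell2_inner V g f = cnj (ell2_inner V f g)"
  unfolding ell2_inner_def infsum_cnj[symmetric] by (simp add: mult.commute)

lemma ell2_inner_add_left:
  assumes "f \<in> ell2 V" "g \<in> ell2 V" "h \<in> ell2 V"
  shows "ell2_inner V (\<lambda>v. f v + g v) h = ell2_inner V f h + ell2_inner V g h"
  using ell2_inner_add_right[OF assms(3,1,2)]
  by (metis complex_cnj_add ell2_inner_commute)

lemma ell2_inner_scale_left: "ell2_inner V (\<lambda>v. c * f v) g = cnj c * ell2_inner V f g"
  by (metis complex_cnj_mult ell2_inner_commute ell2_inner_scale_right)

lemma ell2_inner_diff_right:
  assumes "f \<in> ell2 V" "g \<in> ell2 V" "h \<in> ell2 V"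
  shows "ell2_inner V f (\<lambda>v. g v - h v) = ell2_inner V f g - ell2_inner V f h"
  using ell2_inner_add_right[OF assms(1,2) ell2_scale(1)[OF assms(3), of "-1"]]
    ell2_inner_scale_right[of V f "-1" h] by simp

lemma ell2_inner_diff_left:
  assumes "f \<in> ell2 V" "g \<in> ell2 V" "h \<in> ell2 V"
  shows "ell2_inner V (\<lambda>v. f v - g v) h = ell2_inner V f h - ell2_inner V g h"
  using ell2_inner_diff_right[OF assms(3,1,2)]
  by (metis complex_cnj_diff ell2_inner_commute)

lemma ell2_inner_self:
  assumes "f \<in> ell2 V"
  shows "ell2_inner V f f = complex_of_real ((ell2_norm V f)\<^sup>2)"
proof -
  have "((\<lambda>v. complex_of_real ((cmod (f v))\<^sup>2)) has_sum complex_of_real ((ell2_norm V f)\<^sup>2)) V"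
    using assms by (intro has_sum_of_real) (simp add: ell2_norm_square ell2_def)
  moreover have "complex_of_real ((cmod (f v))\<^sup>2) = cnj (f v) * f v" for v
    by (simp only: complex_norm_square mult.commute)
  ultimately show ?thesis by (simp add: ell2_inner_def infsumI del: of_real_power)
qed

text \<open>The limit is taken pointwise; completeness is what later produces spectral projections
  as limits of polynomials of the operator.\<close>

lemma ell2_complete:
  assumes f: "\<And>n::nat. f n \<in> ell2 V"
    and Cauchy: "\<And>e. 0 < e \<Longrightarrow> \<exists>N. \<forall>m\<ge>N. \<forall>n\<ge>N. ell2_norm V (\<lambda>v. f m v - f n v) \<le> e"
  obtains g where "g \<in> ell2 V" "(\<lambda>n. ell2_norm V (\<lambda>v. f n v - g v)) \<longlonglongrightarrow> 0"
proof -
  have "Cauchy (\<lambda>n. f n v)" for v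
  proof (rule metric_CauchyI)
    fix e :: real assume "0 < e"
    then obtain N where N: "\<forall>m\<ge>N. \<forall>n\<ge>N. ell2_norm V (\<lambda>v. f m v - f n v) \<le> e / 2"
      using Cauchy[of "e / 2"] by auto
    have "dist (f m v) (f n v) < e" if "N \<le> m" "N \<le> n" for m n
    proof -
      have "cmod (f m v - f n v) \<le> ell2_norm V (\<lambda>v. f m v - f n v)"
        by (rule cmod_le_ell2_norm[OF ell2_diff[OF f f]])
      with N that \<open>0 < e\<close> show ?thesis by (force simp: dist_norm)
    qed
    then show "\<exists>N. \<forall>m\<ge>N. \<forall>n\<ge>N. dist (f m v) (f n v) < e" by blast
  qed
  then have "\<exists>l. (\<lambda>n. f n v) \<longlonglongrightarrow> l" for v
    using Cauchy_convergent convergent_def by blast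
  then obtain g where g: "\<And>v. (\<lambda>n. f n v) \<longlonglongrightarrow> g v" by metis
  have g0: "g v = 0" if "v \<notin> V" for v
    using g[of v] ell2_zero_outside[OF f that] by (simp add: LIMSEQ_const_iff)
  have *: "\<exists>N. \<forall>n\<ge>N. (\<lambda>v. f n v - g v) \<in> ell2 V \<and> ell2_norm V (\<lambda>v. f n v - g v) \<le> e" if "0 < e" for e
  proof -
    obtain N where N: "\<forall>m\<ge>N. \<forall>n\<ge>N. ell2_norm V (\<lambda>v. f m v - f n v) \<le> e"
      using Cauchy[OF \<open>0 < e\<close>] by auto
    \<comment> \<open>A sum over a finite set involves finitely many coordinates, so the Cauchy
      bound survives the limit in \<open>m\<close>.\<close>
    have le: "L2_set (\<lambda>v. cmod (f n v - g v)) F \<le> e" if "N \<le> n" "finite F" "F \<subseteq> V" for n F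
    proof (rule tendsto_upperbound)
      show "(\<lambda>m. L2_set (\<lambda>v. cmod (f n v - f m v)) F) \<longlonglongrightarrow> L2_set (\<lambda>v. cmod (f n v - g v)) F"
        unfolding L2_set_def by (intro tendsto_intros g)
      show "\<forall>\<^sub>F m in sequentially. L2_set (\<lambda>v. cmod (f n v - f m v)) F \<le> e"
        using eventually_ge_at_top[of N]
      proof eventually_elim
        case (elim m)
        then show ?case
          using N that L2_set_le_ell2_norm[OF ell2_diff[OF f f] that(2,3), of n m] by fastforce
      qed
    qed simp
    have outside: "f n v - g v = 0" if "v \<notin> V" for n v
      using ell2_zero_outside[OF f that] g0[OF that] by simp
    show ?thesis
    proof (intro exI[of _ N] allI impI)
      fix n assume "N \<le> n"
      then show "(\<lambda>v. f n v - g v) \<in> ell2 V \<and> ell2_norm V (\<lambda>v. f n v - g v) \<le> e"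
        by (intro conjI ell2_boundedI[OF outside le[OF \<open>N \<le> n\<close>]])
    qed
  qed
  obtain N where "(\<lambda>v. f N v - g v) \<in> ell2 V" using *[of 1] by auto
  from ell2_diff[OF f[of N] this] have "g \<in> ell2 V" by simp
  moreover have "(\<lambda>n. ell2_norm V (\<lambda>v. f n v - g v)) \<longlonglongrightarrow> 0"
  proof (rule LIMSEQ_I)
    fix e :: real assume "0 < e"
    then show "\<exists>N. \<forall>n\<ge>N. norm (ell2_norm V (\<lambda>v. f n v - g v) - 0) < e"
      using *[of "e / 2"] by fastforce
  qed
  ultimately show thesis by (rule that)
qed

section \<open>Polynomials of a linear operator\<close>

text \<open>Horner evaluation of p(T). The coefficients are real, so that p(T) is symmetric whenever
  \<open>T\<close> is.\<close>

definition op_poly :: "(('v \<Rightarrow> complex) \<Rightarrow> ('v \<Rightarrow> complex)) \<Rightarrow> real poly \<Rightarrow> ('v \<Rightarrow> complex) \<Rightarrow> ('v \<Rightarrow> complex)" where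
  "op_poly T p f = fold_coeffs (\<lambda>a g v. complex_of_real a * f v + T g v) p (\<lambda>_. 0)"

text \<open>Linearity is asked on all functions rather than on \<open>ell2\<close>: the graph
  operators are finite sums at every vertex, and commutators will involve multiplication by an
  unbounded linear function.\<close>

locale function_operator =
  fixes T :: "('v \<Rightarrow> complex) \<Rightarrow> ('v \<Rightarrow> complex)"
  assumes op_add: "T (\<lambda>v. f v + g v) = (\<lambda>v. T f v + T g v)"
    and op_scale: "T (\<lambda>v. c * f v) = (\<lambda>v. c * T f v)"
begin

lemma op_zero [simp]: "T (\<lambda>_. 0) = (\<lambda>_. 0)"
proof -
  have "T (\<lambda>v. 0 * 0) = (\<lambda>v. 0 * T (\<lambda>_. 0) v)" by (rule op_scale)
  then show ?thesis by simp
qed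

lemma op_minus: "T (\<lambda>v. - f v) = (\<lambda>v. - T f v)"
proof -
  have "T (\<lambda>v. -1 * f v) = (\<lambda>v. -1 * T f v)" by (rule op_scale)
  then show ?thesis by simp
qed

lemma op_diff: "T (\<lambda>v. f v - g v) = (\<lambda>v. T f v - T g v)"
proof -
  have "T (\<lambda>v. f v + -1 * g v) = (\<lambda>v. T f v + -1 * T g v)"
    by (simp only: op_add op_scale)
  then show ?thesis by simp
qed

lemma op_sum: "T (\<lambda>v. \<Sum>i\<in>I. f i v) = (\<lambda>v. \<Sum>i\<in>I. T (f i) v)"
  by (induction I rule: infinite_finite_induct) (simp_all add: op_add)

lemma op_poly_0 [simp]: "op_poly T 0 f = (\<lambda>_. 0)"
  by (simp add: op_poly_def)

lemma op_poly_pCons: "op_poly T (pCons a p) f = (\<lambda>v. complex_of_real a * f v + T (op_poly T p f) v)"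
  by (cases "a = 0 \<and> p = 0") (auto simp: op_poly_def)

lemma op_poly_1 [simp]: "op_poly T 1 f = f"
  by (simp add: one_pCons op_poly_pCons)

lemma op_poly_add: "op_poly T (p + q) f = (\<lambda>v. op_poly T p f v + op_poly T q f v)"
  by (induction p q rule: poly_induct2) (simp_all add: op_poly_pCons op_add algebra_simps)

lemma op_poly_smult: "op_poly T (smult c p) f = (\<lambda>v. complex_of_real c * op_poly T p f v)"
  by (induction p) (simp_all add: op_poly_pCons op_scale algebra_simps)

lemma op_poly_diff: "op_poly T (p - q) f = (\<lambda>v. op_poly T p f v - op_poly T q f v)"
proof -
  have "op_poly T p f = (\<lambda>v. op_poly T (p - q) f v + op_poly T q f v)"
    using op_poly_add[of "p - q" q f] by simp
  then show ?thesis by (simp add: fun_eq_iff)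
qed

lemma op_poly_mult: "op_poly T (p * q) f = op_poly T p (op_poly T q f)"
  by (induction p) (simp_all add: op_poly_pCons op_poly_add op_poly_smult)

lemma op_poly_commute: "T (op_poly T p f) = op_poly T p (T f)"
  by (induction p) (simp_all add: op_poly_pCons op_add op_scale)

lemma op_poly_monom: "op_poly T (monom c n) f = (\<lambda>v. complex_of_real c * (T ^^ n) f v)"
  by (induction n) (simp_all add: monom_0 monom_Suc op_poly_pCons op_scale)

end

text \<open>The number \<open>R\<close> is both a norm bound and the radius of an interval that
  supports the spectral measures; its positivity allows rescaling that interval to
  \<open>{0..1}\<close>.\<close>

locale bounded_selfadjoint = function_operator T for T :: "('v \<Rightarrow> complex) \<Rightarrow> ('v \<Rightarrow> complex)" +
  fixes V :: "'v set" and R :: real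
  assumes op_ell2: "f \<in> ell2 V \<Longrightarrow> T f \<in> ell2 V"
    and op_bounded: "f \<in> ell2 V \<Longrightarrow> ell2_norm V (T f) \<le> R * ell2_norm V f"
    and op_symmetric: "f \<in> ell2 V \<Longrightarrow> g \<in> ell2 V \<Longrightarrow> ell2_inner V f (T g) = ell2_inner V (T f) g"
    and R_pos: "0 < R"
begin

lemma op_poly_ell2: "f \<in> ell2 V \<Longrightarrow> op_poly T p f \<in> ell2 V"
  by (induction p) (auto simp: op_poly_pCons intro!: ell2_add ell2_scale op_ell2)

lemma op_power_ell2: "f \<in> ell2 V \<Longrightarrow> (T ^^ n) f \<in> ell2 V"
  by (induction n) (auto simp: op_ell2)

lemma op_power_bounded: "f \<in> ell2 V \<Longrightarrow> ell2_norm V ((T ^^ n) f) \<le> R ^ n * ell2_norm V f"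
proof (induction n)
  case (Suc n)
  have "ell2_norm V ((T ^^ Suc n) f) \<le> R * ell2_norm V ((T ^^ n) f)"
    using op_bounded[OF op_power_ell2[OF Suc.prems]] by simp
  also have "\<dots> \<le> R * (R ^ n * ell2_norm V f)"
    using Suc R_pos by (intro mult_left_mono) auto
  finally show ?case by (simp add: mult_ac)
qed simp

lemma op_power_diff: "(T ^^ n) (\<lambda>v. f v - g v) = (\<lambda>v. (T ^^ n) f v - (T ^^ n) g v)"
  by (induction n) (simp_all add: op_diff)

lemma op_poly_symmetric:
  assumes "f \<in> ell2 V" "g \<in> ell2 V"
  shows "ell2_inner V f (op_poly T p g) = ell2_inner V (op_poly T p f) g"
  using assms
proof (induction p arbitrary: f)
  case 0
  then show ?case by (simp add: ell2_inner_def)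
next
  case (pCons a p)
  note ell2 = op_poly_ell2 op_ell2 ell2_scale(1) pCons.prems
  have comm: "T (op_poly T p f) = op_poly T p (T f)"
    by (rule op_poly_commute)
  have "ell2_inner V f (op_poly T (pCons a p) g)
      = complex_of_real a * ell2_inner V f g + ell2_inner V f (T (op_poly T p g))"
    by (simp add: op_poly_pCons ell2_inner_add_right ell2_inner_scale_right ell2)
  also have "ell2_inner V f (T (op_poly T p g)) = ell2_inner V (T f) (op_poly T p g)"
    by (intro op_symmetric ell2)
  also have "\<dots> = ell2_inner V (op_poly T p (T f)) g"
    by (intro pCons.IH ell2)
  also have "complex_of_real a * ell2_inner V f g + \<dots> = ell2_inner V (op_poly T (pCons a p) f) g"
    by (simp add: op_poly_pCons ell2_inner_add_left ell2_inner_scale_left ell2 comm[symmetric])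
  finally show ?case .
qed

end


section \<open>Spectral measures\<close>

lemma supported_measure_density:
  assumes "supported_measure \<mu> R" and S: "S \<in> sets borel"
  shows "supported_measure (density \<mu> (indicator S)) R"
proof -
  interpret supported_measure \<mu> R by fact
  have "finite_measure (density \<mu> (indicator S))"
    by (rule finite_measure_restricted) (use S in simp)
  moreover have "emeasure (density \<mu> (indicator S)) {x. R < \<bar>x\<bar>} = 0"
  proof -
    have "{x. R < \<bar>x\<bar>} \<in> null_sets \<mu>" using null_outside by (simp add: null_sets_def)
    moreover have "absolutely_continuous \<mu> (density \<mu> (indicator S))"
      by (rule absolutely_continuousI_density) (use S in simp)
    ultimately show ?thesis by (auto simp: absolutely_continuous_def)
  qed
  ultimately show ?thesis
    by (intro supported_measure.intro supported_measure_axioms.intro) auto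
qed

lemma (in supported_measure) integral_density_indicator:
  fixes f :: "real \<Rightarrow> real"
  assumes "S \<in> sets borel" "f \<in> borel_measurable borel"
  shows "(\<integral>x. f x \<partial>density \<mu> (indicator S)) = (\<integral>x. indicator S x * f x \<partial>\<mu>)"
proof -
  have "(indicator S :: real \<Rightarrow> ennreal) = (\<lambda>x. ennreal (indicator S x))"
    by (auto simp: indicator_def)
  then show ?thesis using assms by (simp add: integral_density)
qed

lemma spectral_measure_supportedE:
  assumes "spectral_measure V T f \<mu>"
  obtains R where "supported_measure \<mu> R"
  using assms by (auto simp: spectral_measure_def supported_measure_def supported_measure_axioms_def)

section \<open>Existence of spectral measures and the L2 isometry\<close>

context bounded_selfadjoint
begin

lemma spectral_measure_poly:
  assumes "spectral_measure V T f \<mu>" "f \<in> ell2 V"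
  shows "ell2_inner V f (op_poly T p f) = complex_of_real (\<integral>x. poly p x \<partial>\<mu>)"
proof -
  obtain r where "supported_measure \<mu> r" by (rule spectral_measure_supportedE[OF assms(1)])
  then interpret supported_measure \<mu> r .
  show ?thesis
  proof (rule additive_poly_eqI)
    fix c :: real and n
    show "ell2_inner V f (op_poly T (monom c n) f) = complex_of_real (\<integral>x. poly (monom c n) x \<partial>\<mu>)"
      using assms(1) by (simp add: op_poly_monom poly_monom ell2_inner_scale_right spectral_measure_def)
  next
    fix p q
    show "ell2_inner V f (op_poly T (p + q) f)
        = ell2_inner V f (op_poly T p f) + ell2_inner V f (op_poly T q f)"
      using assms(2) by (simp add: op_poly_add ell2_inner_add_right op_poly_ell2)
  qed simp
qed

text \<open>Symmetry moves one factor p(T) across the inner product. Thus p(T) f depends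
  isometrically on p in L2 of the spectral measure, which takes the place of a functional
  calculus.\<close>

lemma norm_op_poly:
  assumes "spectral_measure V T f \<mu>" "f \<in> ell2 V"
  shows "(ell2_norm V (op_poly T p f))\<^sup>2 = (\<integral>x. (poly p x)\<^sup>2 \<partial>\<mu>)"
proof -
  have "complex_of_real ((ell2_norm V (op_poly T p f))\<^sup>2) = ell2_inner V (op_poly T p f) (op_poly T p f)"
    by (rule ell2_inner_self[symmetric]) (rule op_poly_ell2[OF assms(2)])
  also have "\<dots> = ell2_inner V f (op_poly T (p * p) f)"
    by (simp add: op_poly_mult op_poly_symmetric[symmetric] op_poly_ell2 assms(2))
  also have "\<dots> = complex_of_real (\<integral>x. poly (p * p) x \<partial>\<mu>)"
    by (rule spectral_measure_poly[OF assms])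
  finally show ?thesis by (simp add: power2_eq_square flip: of_real_mult)
qed

lemma norm_eq_measure:
  assumes "spectral_measure V T f \<mu>" "f \<in> ell2 V"
  shows "(ell2_norm V f)\<^sup>2 = measure \<mu> UNIV"
proof -
  obtain r where "supported_measure \<mu> r" by (rule spectral_measure_supportedE[OF assms(1)])
  then interpret supported_measure \<mu> r .
  show ?thesis using norm_op_poly[OF assms, of 1] by simp
qed

lemma inner_op_poly_real:
  assumes "f \<in> ell2 V"
  shows "ell2_inner V f (op_poly T p f) = complex_of_real (Re (ell2_inner V f (op_poly T p f)))"
proof -
  have "cnj (ell2_inner V f (op_poly T p f)) = ell2_inner V f (op_poly T p f)"
    using assms by (metis ell2_inner_commute op_poly_symmetric)
  then show ?thesis by (simp add: complex_eq_iff)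
qed

text \<open>
  Up to a square, a product of powers of \<open>R + x\<close> and \<open>R - x\<close> is one of \<open>1\<close>, \<open>R + x\<close>, \<open>R - x\<close>, \<open>R\<^sup>2 - x\<^sup>2\<close>.
\<close>

lemma inner_op_poly_product_nonneg:
  assumes f: "f \<in> ell2 V"
  shows "0 \<le> Re (ell2_inner V f (op_poly T ([:R, 1:] ^ i * [:R, -1:] ^ j) f))"
proof -
  \<comment> \<open>The linear cases follow from Cauchy-Schwarz and the norm bound; the quadratic
    one says that the norm of \<open>T g\<close> is at most \<open>R\<close> times that of
    \<open>g\<close>.\<close>
  have base: "0 \<le> Re (ell2_inner V g (op_poly T ([:R, 1:] ^ a * [:R, -1:] ^ b) g))"
    if g: "g \<in> ell2 V" and "a \<in> {0, 1}" "b \<in> {0, 1}" for g and a b :: nat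
  proof -
    have Tg: "T g \<in> ell2 V" by (rule op_ell2[OF g])
    have "\<bar>Re (ell2_inner V g (T g))\<bar> \<le> ell2_norm V g * ell2_norm V (T g)"
      using ell2_Cauchy_Schwarz[OF g Tg] abs_Re_le_cmod order_trans by blast
    also have "\<dots> \<le> ell2_norm V g * (R * ell2_norm V g)"
      by (intro mult_left_mono op_bounded g) simp
    finally have 1: "\<bar>Re (ell2_inner V g (T g))\<bar> \<le> R * (ell2_norm V g)\<^sup>2"
      by (simp add: power2_eq_square mult_ac)
    have "(ell2_norm V (T g))\<^sup>2 \<le> (R * ell2_norm V g)\<^sup>2"
      by (intro power_mono op_bounded g) simp
    then have 2: "(ell2_norm V (T g))\<^sup>2 \<le> R * (R * (ell2_norm V g)\<^sup>2)"
      by (simp add: power2_eq_square mult_ac)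
    have 3: "ell2_inner V g (T (T g)) = complex_of_real ((ell2_norm V (T g))\<^sup>2)"
      using g Tg by (simp add: op_symmetric ell2_inner_self)
    consider "a = 0" "b = 0" | "a = 0" "b = 1" | "a = 1" "b = 0" | "a = 1" "b = 1"
      using \<open>a \<in> {0, 1}\<close> \<open>b \<in> {0, 1}\<close> by auto
    then show ?thesis
    proof cases
      case 1
      then show ?thesis using g by (simp add: ell2_inner_self)
    next
      case 2
      have "op_poly T [:R, -1:] g = (\<lambda>v. complex_of_real R * g v + -1 * T g v)"
        by (simp add: op_poly_pCons op_scale op_minus)
      then have "ell2_inner V g (op_poly T [:R, -1:] g) = R * ell2_inner V g g + -1 * ell2_inner V g (T g)"
        using g Tg by (simp only: ell2_inner_add_right ell2_inner_scale_right ell2_scale)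
      then show ?thesis using \<open>a = 0\<close> \<open>b = 1\<close> 1 g by (simp add: ell2_inner_self)
    next
      case 3
      have "op_poly T [:R, 1:] g = (\<lambda>v. complex_of_real R * g v + T g v)"
        by (simp add: op_poly_pCons op_scale op_minus)
      then have "ell2_inner V g (op_poly T [:R, 1:] g) = R * ell2_inner V g g + ell2_inner V g (T g)"
        using g Tg by (simp only: ell2_inner_add_right ell2_inner_scale_right ell2_scale)
      then show ?thesis using \<open>a = 1\<close> \<open>b = 0\<close> 1 g by (simp add: ell2_inner_self)
    next
      case 4
      have "[:R, 1:] * [:R, -1:] = [:R * R, 0, -1:]" by simp
      moreover have "op_poly T [:R * R, 0, -1:] g = (\<lambda>v. complex_of_real (R * R) * g v + -1 * T (T g) v)"
        by (simp add: op_poly_pCons op_scale op_minus)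
      moreover have "ell2_inner V g (\<lambda>v. complex_of_real (R * R) * g v + -1 * T (T g) v)
          = (R * R) * ell2_inner V g g + -1 * ell2_inner V g (T (T g))"
        using g op_ell2[OF Tg] by (simp only: ell2_inner_add_right ell2_inner_scale_right ell2_scale)
      ultimately show ?thesis
        using \<open>a = 1\<close> \<open>b = 1\<close> 2 g by (simp add: ell2_inner_self 3 flip: of_real_mult)
    qed
  qed
  \<comment> \<open>The product equals \<open>s * r * s\<close>; symmetry moves one copy of
    \<open>s\<close> to the other side, leaving a base case at the vector
    \<open>op_poly T s f\<close>.\<close>
  define s where "s = [:R, 1:] ^ (i div 2) * [:R, -1:] ^ (j div 2)"
  define r where "r = [:R, 1:] ^ (i mod 2) * [:R, -1:] ^ (j mod 2)"
  have half: "p ^ k = p ^ (k div 2) * p ^ (k div 2) * p ^ (k mod 2)" for p :: "real poly" and k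
  proof -
    have "k div 2 + k div 2 + k mod 2 = k" by presburger
    then show ?thesis unfolding power_add[symmetric] by (simp only:)
  qed
  have "[:R, 1:] ^ i * [:R, -1:] ^ j = s * (r * s)"
    unfolding half[of "[:R, 1:]" i] half[of "[:R, -1:]" j] by (simp only: s_def r_def mult_ac)
  then have "ell2_inner V f (op_poly T ([:R, 1:] ^ i * [:R, -1:] ^ j) f)
      = ell2_inner V (op_poly T s f) (op_poly T r (op_poly T s f))"
    using f by (simp only: op_poly_mult op_poly_symmetric op_poly_ell2)
  moreover have "0 \<le> Re (ell2_inner V (op_poly T s f) (op_poly T r (op_poly T s f)))"
    unfolding r_def by (rule base) (use f in \<open>auto simp: op_poly_ell2 mod2_eq_if\<close>)
  ultimately show ?thesis by simp
qed

text \<open>An affine change of variable sends \<open>{-R..R}\<close> to \<open>{0..1}\<close>.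
  There the positivity required by \<open>Hausdorff_moments\<close> is
  \<open>inner_op_poly_product_nonneg\<close> up to a positive factor, and the measure obtained is
  pushed back.\<close>

lemma spectral_measure_exists:
  assumes f: "f \<in> ell2 V"
  obtains \<mu> where "spectral_measure V T f \<mu>" "supported_measure \<mu> R"
proof -
  define \<Lambda> where "\<Lambda> p = Re (ell2_inner V f (op_poly T p f))" for p
  have \<Lambda>_add: "\<Lambda> (p + q) = \<Lambda> p + \<Lambda> q" for p q
    using f by (simp add: \<Lambda>_def op_poly_add ell2_inner_add_right op_poly_ell2)
  have \<Lambda>_smult: "\<Lambda> (smult c p) = c * \<Lambda> p" for c p
    using f by (simp add: \<Lambda>_def op_poly_smult ell2_inner_scale_right)
  \<comment> \<open>This is \<open>(R + x) / (2 * R)\<close>, so \<open>x\<close> and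
    \<open>1 - x\<close> turn into multiples of \<open>R + x\<close> and \<open>R - x\<close>. Its
    inverse is \<open>y \<mapsto> R * (2 * y - 1)\<close>.\<close>
  define u where "u = [:1/2, 1/(2 * R):]"
  define L where "L p = \<Lambda> (pcompose p u)" for p

  have L_add: "L (p + q) = L p + L q" for p q by (simp add: L_def pcompose_add \<Lambda>_add)
  have L_smult: "L (smult c p) = c * L p" for c p by (simp add: L_def pcompose_smult \<Lambda>_smult)
  have L_pos: "0 \<le> L ([:0, 1:] ^ i * [:1, -1:] ^ j)" for i j
  proof -
    have pcompose_power: "pcompose (p ^ k) u = pcompose p u ^ k" for p :: "real poly" and k
      by (induction k) (simp_all add: pcompose_mult pcompose_1)
    have "pcompose [:0, 1:] u = smult (1 / (2 * R)) [:R, 1:]"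
      "pcompose [:1, -1:] u = smult (1 / (2 * R)) [:R, -1:]"
      using R_pos by (simp_all add: u_def pcompose_pCons)
    then have "pcompose ([:0, 1:] ^ i * [:1, -1:] ^ j) u
        = smult ((1 / (2 * R)) ^ (i + j)) ([:R, 1:] ^ i * [:R, -1:] ^ j)"
      by (simp only: pcompose_mult pcompose_power smult_power mult_smult_left mult_smult_right
          smult_smult power_add mult.commute)
    then show ?thesis
      using inner_op_poly_product_nonneg[OF f, of i j] R_pos
      by (simp only: L_def \<Lambda>_smult) (simp add: \<Lambda>_def)
  qed
  obtain \<nu> where \<nu>: "finite_measure \<nu>" "sets \<nu> = sets borel" "emeasure \<nu> (- {0..1}) = 0"
    and L: "\<And>p. L p = (\<integral>x. poly p x \<partial>\<nu>)"
    using Hausdorff_moments[OF L_add L_smult L_pos] by metis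
  define \<mu> where "\<mu> = distr \<nu> borel (\<lambda>y. R * (2 * y - 1))"
  have [measurable_cong]: "sets \<nu> = sets borel" by (rule \<nu>)
  have sp: "space \<nu> = UNIV" using sets_eq_imp_space_eq[OF \<nu>(2)] by simp
  have "finite_measure \<mu>"
    unfolding \<mu>_def by (rule finite_measure.finite_measure_distr[OF \<nu>(1)]) simp
  moreover have "emeasure \<mu> {x. R < \<bar>x\<bar>} = 0"
  proof -
    have "emeasure \<mu> {x. R < \<bar>x\<bar>} = emeasure \<nu> ((\<lambda>y. R * (2 * y - 1)) -` {x. R < \<bar>x\<bar>} \<inter> space \<nu>)"
      unfolding \<mu>_def by (rule emeasure_distr) auto
    also have "\<dots> = 0"
    proof (rule emeasure_eq_0[OF _ \<nu>(3)])
      show "(\<lambda>y. R * (2 * y - 1)) -` {x. R < \<bar>x\<bar>} \<inter> space \<nu> \<subseteq> - {0..1}"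
      proof
        fix y assume "y \<in> (\<lambda>y. R * (2 * y - 1)) -` {x. R < \<bar>x\<bar>} \<inter> space \<nu>"
        then have "R * 1 < R * \<bar>2 * y - 1\<bar>" using R_pos by (simp add: abs_mult)
        then have "1 < \<bar>2 * y - 1\<bar>" using R_pos by (simp only: mult_less_cancel_left_pos)
        then show "y \<in> - {0..1}" by auto
      qed
    qed (simp add: \<nu>(2))
    finally show ?thesis .
  qed
  ultimately have supp: "supported_measure \<mu> R"
    by (intro supported_measure.intro supported_measure_axioms.intro) (auto simp: \<mu>_def)
  have \<Lambda>: "\<Lambda> p = (\<integral>x. poly p x \<partial>\<mu>)" for p
  proof -
    have "pcompose [:-R, 2 * R:] u = [:0, 1:]"
      using R_pos by (simp add: u_def pcompose_pCons)
    then have "L (pcompose p [:-R, 2 * R:]) = \<Lambda> p"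
      by (simp only: L_def pcompose_assoc[symmetric] pcompose_idR)
    then have "\<Lambda> p = (\<integral>y. poly p (R * (2 * y - 1)) \<partial>\<nu>)"
      by (simp add: L poly_pcompose algebra_simps)
    also have "\<dots> = (\<integral>x. poly p x \<partial>\<mu>)"
      unfolding \<mu>_def by (rule integral_distr[symmetric]) auto
    finally show ?thesis .
  qed
  have "ell2_inner V f ((T ^^ n) f) = complex_of_real (\<integral>x. x ^ n \<partial>\<mu>)" for n
  proof -
    have "ell2_inner V f (op_poly T (monom 1 n) f) = complex_of_real (\<Lambda> (monom 1 n))"
      unfolding \<Lambda>_def by (rule inner_op_poly_real[OF f])
    then show ?thesis by (simp add: \<Lambda> op_poly_monom poly_monom)
  qed
  with supp have "spectral_measure V T f \<mu>"
    by (auto simp: spectral_measure_def supported_measure_def supported_measure_axioms_def)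
  then show thesis using supp by (rule that)
qed

end


section \<open>Spectral projections and points of the absolutely continuous spectrum\<close>

context bounded_selfadjoint
begin

text \<open>The vector \<open>g\<close> plays the role of the spectral projection of
  \<open>f\<close> to \<open>S\<close>. Polynomials approaching the indicator in L2 of
  \<open>\<mu>\<close> give a Cauchy sequence by \<open>norm_op_poly\<close>, and its limit is
  identified through its moments.\<close>

lemma spectral_projection:
  assumes f: "f \<in> ell2 V" and sm: "spectral_measure V T f \<mu>" and S [measurable]: "S \<in> sets borel"
  obtains g where "g \<in> ell2 V" "spectral_measure V T g (density \<mu> (indicator S))"
proof -
  obtain r where r: "supported_measure \<mu> r" by (rule spectral_measure_supportedE[OF sm])
  then interpret supported_measure \<mu> r .
  define \<delta> where "\<delta> j = 1 / real (Suc j)" for j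
  have \<delta>: "\<delta> j > 0" "\<delta> \<longlonglongrightarrow> 0" for j
    unfolding \<delta>_def by (simp, rule LIMSEQ_Suc[OF lim_1_over_n])
  have "\<exists>q. (\<integral>x. (poly q x - indicator S x)\<^sup>2 \<partial>\<mu>) < (\<delta> j)\<^sup>2" for j
    using poly_approximates_indicator[of "{()}" "\<lambda>_. \<mu>" r S "(\<delta> j)\<^sup>2"] r \<delta>(1)[of j] by auto
  then obtain q where q: "\<And>j. (\<integral>x. (poly (q j) x - indicator S x)\<^sup>2 \<partial>\<mu>) < (\<delta> j)\<^sup>2" by metis
  define h where "h j = op_poly T (q j) f" for j
  have h: "h j \<in> ell2 V" for j by (simp add: h_def op_poly_ell2 f)
  have int: "integrable \<mu> (\<lambda>x. (poly p x - indicator S x)\<^sup>2)" for p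
    by (rule integrable_poly_minus_indicator[OF S])
  have dist: "(ell2_norm V (\<lambda>v. h i v - h j v))\<^sup>2 \<le> 2 * (\<delta> i)\<^sup>2 + 2 * (\<delta> j)\<^sup>2" for i j
  proof -
    have "(ell2_norm V (\<lambda>v. h i v - h j v))\<^sup>2 = (\<integral>x. (poly (q i - q j) x)\<^sup>2 \<partial>\<mu>)"
      by (simp only: h_def op_poly_diff[symmetric] norm_op_poly[OF sm f])
    also have "\<dots> \<le> (\<integral>x. 2 * (poly (q i) x - indicator S x)\<^sup>2 + 2 * (poly (q j) x - indicator S x)\<^sup>2 \<partial>\<mu>)"
    proof (rule integral_mono)
      show "integrable \<mu> (\<lambda>x. (poly (q i - q j) x)\<^sup>2)"
        using integrable_poly[of "(q i - q j)\<^sup>2"] by (simp only: poly_power)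
      fix x
      show "(poly (q i - q j) x)\<^sup>2 \<le> 2 * (poly (q i) x - indicator S x)\<^sup>2 + 2 * (poly (q j) x - indicator S x)\<^sup>2"
        using sum_squares_ge_zero[of "poly (q i) x - indicator S x + (poly (q j) x - indicator S x)" 0]
        by (simp add: power2_eq_square algebra_simps)
    qed (simp add: int)
    also have "\<dots> = 2 * (\<integral>x. (poly (q i) x - indicator S x)\<^sup>2 \<partial>\<mu>) + 2 * (\<integral>x. (poly (q j) x - indicator S x)\<^sup>2 \<partial>\<mu>)"
      by (simp add: int)
    also have "\<dots> \<le> 2 * (\<delta> i)\<^sup>2 + 2 * (\<delta> j)\<^sup>2" using q[of i] q[of j] by linarith
    finally show ?thesis .
  qed
  have "\<exists>N. \<forall>m\<ge>N. \<forall>n\<ge>N. ell2_norm V (\<lambda>v. h m v - h n v) \<le> e" if "0 < e" for e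
  proof -
    have "\<exists>N. \<forall>n\<ge>N. \<delta> n < e / 2"
      using order_tendstoD(2)[OF \<delta>(2), of "e / 2"] that by (simp add: eventually_sequentially)
    then obtain N where N: "\<And>n. N \<le> n \<Longrightarrow> \<delta> n < e / 2" by blast
    have "ell2_norm V (\<lambda>v. h m v - h n v) \<le> e" if "N \<le> m" "N \<le> n" for m n
    proof -
      have "(\<delta> m)\<^sup>2 \<le> (e / 2)\<^sup>2" "(\<delta> n)\<^sup>2 \<le> (e / 2)\<^sup>2"
        using N[OF that(1)] N[OF that(2)] \<delta>(1)[of m] \<delta>(1)[of n] by (auto intro!: power_mono)
      then have "(ell2_norm V (\<lambda>v. h m v - h n v))\<^sup>2 \<le> e\<^sup>2"
        using dist[of m n] by (simp add: power_divide)
      then show ?thesis using \<open>0 < e\<close> by (simp add: power2_le_iff_abs_le)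
    qed
    then show ?thesis by blast
  qed
  from ell2_complete[OF h this] obtain g
    where g: "g \<in> ell2 V" and lim: "(\<lambda>n. ell2_norm V (\<lambda>v. h n v - g v)) \<longlonglongrightarrow> 0" by blast
  \<comment> \<open>One sequence, two limits: the quadratic form is continuous in norm, and the
    squares of the polynomials converge to the indicator in L1 of \<open>\<mu>\<close>.\<close>
  have mom: "ell2_inner V g ((T ^^ n) g) = complex_of_real (\<integral>x. indicator S x * x ^ n \<partial>\<mu>)" for n
  proof (rule LIMSEQ_unique)
    let ?d = "\<lambda>j. ell2_norm V (\<lambda>v. h j v - g v)" and ?P = "T ^^ n"
    have "(\<lambda>j. ell2_inner V (h j) (?P (h j)) - ell2_inner V g (?P g)) \<longlonglongrightarrow> 0"
    proof (rule tendsto_0_le)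
      show "(\<lambda>j. ?d j * (R ^ n * (2 * ell2_norm V g + ?d j))) \<longlonglongrightarrow> 0"
        by (rule tendsto_eq_intros lim refl | simp)+
      show "\<forall>\<^sub>F j in sequentially. cmod (ell2_inner V (h j) (?P (h j)) - ell2_inner V g (?P g))
          \<le> norm (?d j * (R ^ n * (2 * ell2_norm V g + ?d j))) * 1"
      proof (rule always_eventually, rule allI)
        fix j
        have d: "(\<lambda>v. h j v - g v) \<in> ell2 V" by (rule ell2_diff[OF h g])
        have "ell2_inner V (h j) (?P (h j)) - ell2_inner V g (?P g)
            = ell2_inner V (\<lambda>v. h j v - g v) (?P (h j)) + ell2_inner V g (?P (\<lambda>v. h j v - g v))"
          using g h by (simp add: op_power_diff ell2_inner_diff_left ell2_inner_diff_right op_power_ell2)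
        also have "cmod \<dots> \<le> ?d j * (R ^ n * ell2_norm V (h j)) + ell2_norm V g * (R ^ n * ?d j)"
        proof (rule order_trans[OF norm_triangle_ineq], rule add_mono)
          show "cmod (ell2_inner V (\<lambda>v. h j v - g v) (?P (h j))) \<le> ?d j * (R ^ n * ell2_norm V (h j))"
            by (rule order_trans[OF ell2_Cauchy_Schwarz[OF d op_power_ell2[OF h]]])
               (simp add: mult_left_mono op_power_bounded h)
          show "cmod (ell2_inner V g (?P (\<lambda>v. h j v - g v))) \<le> ell2_norm V g * (R ^ n * ?d j)"
            by (rule order_trans[OF ell2_Cauchy_Schwarz[OF g op_power_ell2[OF d]]])
               (simp only: mult_left_mono op_power_bounded d ell2_norm_nonneg)
        qed
        also have "\<dots> = ?d j * (R ^ n * (ell2_norm V (h j) + ell2_norm V g))"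
          by (simp add: algebra_simps)
        also have "\<dots> \<le> ?d j * (R ^ n * (2 * ell2_norm V g + ?d j))"
        proof (intro mult_left_mono)
          show "ell2_norm V (h j) + ell2_norm V g \<le> 2 * ell2_norm V g + ?d j"
            using ell2_add(2)[OF d g] by simp
        qed (use R_pos in auto)
        finally show "cmod (ell2_inner V (h j) (?P (h j)) - ell2_inner V g (?P g))
            \<le> norm (?d j * (R ^ n * (2 * ell2_norm V g + ?d j))) * 1"
          by simp
      qed
    qed
    then show "(\<lambda>j. ell2_inner V (h j) (?P (h j))) \<longlonglongrightarrow> ell2_inner V g (?P g)"
      by (simp add: LIM_zero_iff)
    obtain B where B: "B > 0" "\<And>x. \<bar>x\<bar> \<le> r \<Longrightarrow> \<bar>x ^ n\<bar> \<le> B"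
      using poly_bounded[of "monom 1 n"] by (metis mult_1 poly_monom)
    have eq: "ell2_inner V (h j) (?P (h j)) = complex_of_real (\<integral>x. (poly (q j) x)\<^sup>2 * x ^ n \<partial>\<mu>)" for j
    proof -
      have "?P (h j) = op_poly T (monom 1 n) (h j)" by (simp add: op_poly_monom)
      then have "ell2_inner V (h j) (?P (h j)) = ell2_inner V f (op_poly T (q j * (monom 1 n * q j)) f)"
        by (simp only: op_poly_mult h_def op_poly_symmetric op_poly_ell2 f)
      also have "\<dots> = complex_of_real (\<integral>x. poly (q j * (monom 1 n * q j)) x \<partial>\<mu>)"
        by (rule spectral_measure_poly[OF sm f])
      finally show ?thesis by (simp add: poly_monom power2_eq_square mult_ac)
    qed
    have "(\<lambda>j. (\<integral>x. (poly (q j) x)\<^sup>2 * x ^ n \<partial>\<mu>) - (\<integral>x. indicator S x * x ^ n \<partial>\<mu>)) \<longlonglongrightarrow> 0"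
    proof (rule tendsto_0_le)
      show "(\<lambda>j. B * ((\<delta> j)\<^sup>2 + \<delta> j * measure \<mu> UNIV + \<delta> j)) \<longlonglongrightarrow> 0"
        by (rule tendsto_eq_intros \<delta>(2) refl | simp)+
      show "\<forall>\<^sub>F j in sequentially. norm ((\<integral>x. (poly (q j) x)\<^sup>2 * x ^ n \<partial>\<mu>) - (\<integral>x. indicator S x * x ^ n \<partial>\<mu>))
          \<le> norm (B * ((\<delta> j)\<^sup>2 + \<delta> j * measure \<mu> UNIV + \<delta> j)) * 1"
      proof (rule always_eventually, rule allI)
        fix j
        let ?s = "\<lambda>x. indicator S x :: real" and ?q = "poly (q j)"
        have i1: "integrable \<mu> (\<lambda>x. (?q x)\<^sup>2 * x ^ n)"
          using integrable_poly[of "(q j)\<^sup>2 * monom 1 n"] by (simp add: poly_monom)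
        have i2: "integrable \<mu> (\<lambda>x. ?s x * x ^ n)"
          using integrable_poly_indicator[OF S, of "monom 1 n"] by (simp add: poly_monom mult.commute)
        have i3: "integrable \<mu> (\<lambda>x. B * ((?q x - ?s x)\<^sup>2 + (\<delta> j + (?q x - ?s x)\<^sup>2 / \<delta> j)))"
          using int[of "q j"] by simp
        have "\<bar>(\<integral>x. (?q x)\<^sup>2 * x ^ n \<partial>\<mu>) - (\<integral>x. ?s x * x ^ n \<partial>\<mu>)\<bar> = \<bar>\<integral>x. (?q x)\<^sup>2 * x ^ n - ?s x * x ^ n \<partial>\<mu>\<bar>"
          using i1 i2 by simp
        also have "\<dots> \<le> (\<integral>x. \<bar>(?q x)\<^sup>2 * x ^ n - ?s x * x ^ n\<bar> \<partial>\<mu>)" by (rule integral_abs_bound)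
        also have "\<dots> \<le> (\<integral>x. B * ((?q x - ?s x)\<^sup>2 + (\<delta> j + (?q x - ?s x)\<^sup>2 / \<delta> j)) \<partial>\<mu>)"
        proof (rule integral_mono_AE)
          show "integrable \<mu> (\<lambda>x. \<bar>(?q x)\<^sup>2 * x ^ n - ?s x * x ^ n\<bar>)" using i1 i2 by simp
          show "AE x in \<mu>. \<bar>(?q x)\<^sup>2 * x ^ n - ?s x * x ^ n\<bar> \<le> B * ((?q x - ?s x)\<^sup>2 + (\<delta> j + (?q x - ?s x)\<^sup>2 / \<delta> j))"
            using AE_bounded
          proof eventually_elim
            case (elim x)
            define y where "y = ?q x - ?s x"
            \<comment> \<open>The weighted arithmetic-geometric inequality trades the linear term
              for a square; as the integral of \<open>y\<^sup>2\<close> is below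
              \<open>(\<delta> j)\<^sup>2\<close>, the right side still integrates to order
              \<open>\<delta> j\<close>.\<close>
            have "2 * \<bar>y\<bar> \<le> \<delta> j + y\<^sup>2 / \<delta> j"
              using \<delta>(1)[of j] sum_squares_bound[of "\<delta> j" "\<bar>y\<bar>"]
              by (simp add: field_simps power2_eq_square)
            moreover have "\<bar>(?q x)\<^sup>2 - ?s x\<bar> \<le> y\<^sup>2 + 2 * \<bar>y\<bar>"
            proof -
              have "(?q x)\<^sup>2 - ?s x = y\<^sup>2 + 2 * y * ?s x"
                by (cases "x \<in> S") (simp_all add: y_def power2_eq_square algebra_simps)
              moreover have "\<bar>2 * y * ?s x\<bar> \<le> 2 * \<bar>y\<bar>" by (cases "x \<in> S") auto
              ultimately show ?thesis using zero_le_power2[of y] by linarith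
            qed
            ultimately have 1: "\<bar>(?q x)\<^sup>2 - ?s x\<bar> \<le> y\<^sup>2 + (\<delta> j + y\<^sup>2 / \<delta> j)" by linarith
            have "\<bar>(?q x)\<^sup>2 * x ^ n - ?s x * x ^ n\<bar> = \<bar>x ^ n\<bar> * \<bar>(?q x)\<^sup>2 - ?s x\<bar>"
              by (simp only: abs_mult[symmetric] right_diff_distrib mult.commute)
            also have "\<dots> \<le> B * (y\<^sup>2 + (\<delta> j + y\<^sup>2 / \<delta> j))"
              using B(1) B(2)[OF elim] 1 by (intro mult_mono) auto
            finally show ?case by (simp add: y_def)
          qed
        qed (rule i3)
        also have "\<dots> = B * ((\<integral>x. (?q x - ?s x)\<^sup>2 \<partial>\<mu>) + (\<delta> j * measure \<mu> UNIV + (\<integral>x. (?q x - ?s x)\<^sup>2 \<partial>\<mu>) / \<delta> j))"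
          using int[of "q j"] by simp
        also have "\<dots> \<le> B * ((\<delta> j)\<^sup>2 + (\<delta> j * measure \<mu> UNIV + (\<delta> j)\<^sup>2 / \<delta> j))"
          using q[of j] \<delta>(1)[of j] B(1) by (intro mult_left_mono add_mono divide_right_mono) auto
        also have "\<dots> = B * ((\<delta> j)\<^sup>2 + \<delta> j * measure \<mu> UNIV + \<delta> j)"
          using \<delta>(1)[of j] by (simp add: power2_eq_square)
        finally show "norm ((\<integral>x. (?q x)\<^sup>2 * x ^ n \<partial>\<mu>) - (\<integral>x. ?s x * x ^ n \<partial>\<mu>))
            \<le> norm (B * ((\<delta> j)\<^sup>2 + \<delta> j * measure \<mu> UNIV + \<delta> j)) * 1"
          unfolding real_norm_def mult_1_right by (rule order_trans[OF _ abs_ge_self])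
      qed
    qed
    then show "(\<lambda>j. ell2_inner V (h j) (?P (h j))) \<longlonglongrightarrow> complex_of_real (\<integral>x. indicator S x * x ^ n \<partial>\<mu>)"
      unfolding eq by (intro tendsto_of_real) (simp add: LIM_zero_iff)
  qed
  have "spectral_measure V T g (density \<mu> (indicator S))"
    using supported_measure_density[OF r S] mom
    by (auto simp: spectral_measure_def supported_measure_def supported_measure_axioms_def
        integral_density_indicator[OF S])
  with g show thesis by (rule that)
qed

text \<open>
  For a point \<open>z\<close> of the support of the spectral measure of \<open>f\<close>, the spectral projections of \<open>f\<close>
  to small balls around \<open>z\<close> are approximate eigenvectors.
\<close>

lemma ac_spectrum_nonempty:
  assumes f: "f \<in> ac_subspace V T" and "f \<noteq> (\<lambda>_. 0)"
  shows "ac_spectrum V T \<noteq> {}"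
proof -
  obtain \<mu> where fl: "f \<in> ell2 V" and sm: "spectral_measure V T f \<mu>" and ac: "absolutely_continuous lborel \<mu>"
    using f by (auto simp: ac_subspace_def)
  obtain r where r: "supported_measure \<mu> r" by (rule spectral_measure_supportedE[OF sm])
  then interpret supported_measure \<mu> r .
  have pos: "measure \<mu> UNIV > 0"
    unfolding norm_eq_measure[OF sm fl, symmetric] using ell2_norm_eq_0_iff[OF fl] \<open>f \<noteq> _\<close> by simp
  \<comment> \<open>Otherwise every point has a ball of measure zero, finitely many of them cover
    the supporting interval, and \<open>\<mu>\<close> vanishes.\<close>
  have "\<exists>z. \<forall>e>0. measure \<mu> (ball z e) > 0"
  proof (rule ccontr)
    assume "\<nexists>z. \<forall>e>0. measure \<mu> (ball z e) > 0"
    then have "\<forall>z. \<exists>e>0. measure \<mu> (ball z e) = 0"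
      by (simp add: zero_less_measure_iff)
    then obtain e where e: "\<And>z. e z > 0" "\<And>z. measure \<mu> (ball z (e z)) = 0" by metis
    have "cball 0 r \<subseteq> (\<Union>z\<in>UNIV. ball z (e z))" using e(1) by (auto intro!: exI centre_in_ball[THEN iffD2])
    then obtain C where C: "finite C" "cball 0 r \<subseteq> (\<Union>z\<in>C. ball z (e z))"
      by (rule compactE_image[OF compact_cball, of UNIV "\<lambda>z. ball z (e z)", rotated]) auto
    have "ball z (e z) \<in> null_sets \<mu>" for z
      by (intro null_setsI) (simp_all add: emeasure_eq_measure e(2))
    then have "AE x in \<mu>. \<forall>z\<in>C. x \<notin> ball z (e z)"
      by (intro AE_finite_allI[OF C(1)] AE_not_in)
    with AE_bounded have "AE x in \<mu>. False"
      by eventually_elim (use C(2) in force)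
    then show False using pos by (simp add: AE_iff_measurable[OF _ refl] emeasure_eq_measure)
  qed
  then obtain z where z: "\<And>e. e > 0 \<Longrightarrow> measure \<mu> (ball z e) > 0" by blast
  have "complex_of_real z \<in> ac_spectrum V T"
    unfolding ac_spectrum_def spectrum_on_def
  proof (safe)
    fix C assume C: "\<forall>g\<in>ac_subspace V T. ell2_norm V g \<le> C * ell2_norm V (\<lambda>v. T g v - complex_of_real z * g v)"
    \<comment> \<open>The radius is chosen so that \<open>\<bar>C\<bar> * e < 1\<close>, which
      contradicts the assumed bound on the inverse.\<close>
    define e where "e = 1 / (\<bar>C\<bar> + 1)"
    have "e > 0" "\<bar>C\<bar> * e < 1" by (auto simp: e_def field_simps)
    let ?B = "ball z e"
    have B: "?B \<in> sets borel" by simp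
    obtain g where g: "g \<in> ell2 V" and smg: "spectral_measure V T g (density \<mu> (indicator ?B))"
      by (rule spectral_projection[OF fl sm B])
    \<comment> \<open>Restricting the measure to a ball keeps it absolutely continuous, so the
      approximate eigenvector stays in the subspace on which the spectrum is taken.\<close>
    have "absolutely_continuous \<mu> (density \<mu> (indicator ?B))"
      by (intro absolutely_continuousI_density borel_measurable_indicator) simp
    with ac have "absolutely_continuous lborel (density \<mu> (indicator ?B))"
      by (auto simp: absolutely_continuous_def)
    with g smg have gK: "g \<in> ac_subspace V T" by (auto simp: ac_subspace_def)
    have "(ell2_norm V g)\<^sup>2 = (\<integral>x. 1 \<partial>density \<mu> (indicator ?B))"
      using norm_op_poly[OF smg g, of 1] by simp
    also have "\<dots> = measure \<mu> ?B"
      by (subst integral_density_indicator) auto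
    finally have ng: "(ell2_norm V g)\<^sup>2 = measure \<mu> ?B" .
    have "(\<lambda>v. T g v - complex_of_real z * g v) = op_poly T [:-z, 1:] g"
      by (simp add: op_poly_pCons)
    then have "(ell2_norm V (\<lambda>v. T g v - complex_of_real z * g v))\<^sup>2
        = (\<integral>x. (x - z)\<^sup>2 \<partial>density \<mu> (indicator ?B))"
      using norm_op_poly[OF smg g, of "[:-z, 1:]"] by simp
    also have "\<dots> = (\<integral>x. indicator ?B x * (x - z)\<^sup>2 \<partial>\<mu>)"
      by (rule integral_density_indicator) auto
    also have "\<dots> \<le> (\<integral>x. e\<^sup>2 * indicator ?B x \<partial>\<mu>)"
    proof (rule integral_mono)
      show "integrable \<mu> (\<lambda>x. indicator ?B x * (x - z)\<^sup>2)"
        using integrable_poly_indicator[OF B, of "[:-z, 1:]\<^sup>2"] by (simp add: mult.commute)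
      show "indicator ?B x * (x - z)\<^sup>2 \<le> e\<^sup>2 * indicator ?B x" for x
      proof (cases "x \<in> ?B")
        case True
        then have "\<bar>x - z\<bar> \<le> e" by (simp add: dist_real_def)
        then show ?thesis using True by (simp add: abs_le_square_iff[symmetric] \<open>e > 0\<close> less_imp_le)
      qed simp
    qed (simp add: emeasure_eq_measure)
    also have "\<dots> = (e * ell2_norm V g)\<^sup>2" by (simp add: ng power_mult_distrib)
    finally have "ell2_norm V (\<lambda>v. T g v - complex_of_real z * g v) \<le> e * ell2_norm V g"
      by (rule power2_le_imp_le) (use \<open>e > 0\<close> in simp)
    then have "\<bar>C\<bar> * ell2_norm V (\<lambda>v. T g v - complex_of_real z * g v) \<le> \<bar>C\<bar> * (e * ell2_norm V g)"
      by (intro mult_left_mono) auto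
    moreover have "ell2_norm V g \<le> \<bar>C\<bar> * ell2_norm V (\<lambda>v. T g v - complex_of_real z * g v)"
      using C gK by (meson abs_ge_self ell2_norm_nonneg mult_right_mono order_trans)
    ultimately have "ell2_norm V g \<le> (\<bar>C\<bar> * e) * ell2_norm V g" by simp
    moreover have "ell2_norm V g > 0"
      using ng z[OF \<open>e > 0\<close>] ell2_norm_nonneg[of V g] by (metis order_le_less zero_less_power2)
    ultimately show False using \<open>\<bar>C\<bar> * e < 1\<close>
      by (metis mult_less_cancel_right2 not_le)
  qed
  then show ?thesis by blast
qed

end


section \<open>Periodic operators and the trace per unit cell\<close>

definition delta :: "'v \<Rightarrow> 'v \<Rightarrow> complex" where
  "delta u = (\<lambda>v. if v = u then 1 else 0)"

definition finitely_supported :: "'v set \<Rightarrow> ('v \<Rightarrow> complex) \<Rightarrow> bool" where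
  "finitely_supported V f \<longleftrightarrow> finite {v. f v \<noteq> 0} \<and> {v. f v \<noteq> 0} \<subseteq> V"

definition translate :: "'v::group_add \<Rightarrow> ('v \<Rightarrow> complex) \<Rightarrow> ('v \<Rightarrow> complex)" where
  "translate a f = (\<lambda>v. f (v - a))"

lemma finitely_supported_delta [simp]: "u \<in> V \<Longrightarrow> finitely_supported V (delta u)"
  by (auto simp: finitely_supported_def delta_def)

lemma finitely_supported_ell2: "finitely_supported V f \<Longrightarrow> f \<in> ell2 V"
  by (auto simp: finitely_supported_def intro: ell2_finite_support)

lemma finitely_supported_add:
  assumes "finitely_supported V f" "finitely_supported V g"
  shows "finitely_supported V (\<lambda>v. f v + g v)"
proof -
  have "{v. f v + g v \<noteq> 0} \<subseteq> {v. f v \<noteq> 0} \<union> {v. g v \<noteq> 0}" by auto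
  then show ?thesis
    using assms finite_subset[of _ "{v. f v \<noteq> 0} \<union> {v. g v \<noteq> 0}"]
    unfolding finitely_supported_def by blast
qed

lemma finitely_supported_mult:
  "finitely_supported V f \<Longrightarrow> finitely_supported V (\<lambda>v. c v * f v)"
  unfolding finitely_supported_def
  by (auto intro!: finite_subset[of "{v. c v \<noteq> 0 \<and> f v \<noteq> 0}" "{v. f v \<noteq> 0}"])

lemma translate_delta: "translate a (delta u) = delta (u + a)"
  by (auto simp: translate_def delta_def fun_eq_iff algebra_simps)

lemma delta_inner: "v \<in> V \<Longrightarrow> ell2_inner V (delta v) f = f v"
proof -
  assume v: "v \<in> V"
  have "ell2_inner V (delta v) f = (\<Sum>\<^sub>\<infinity>u\<in>{v}. cnj (delta v u) * f u)"
    unfolding ell2_inner_def by (rule infsum_cong_neutral) (use v in \<open>auto simp: delta_def\<close>)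
  then show ?thesis by (simp add: delta_def)
qed

lemma delta_norm: "v \<in> V \<Longrightarrow> ell2_norm V (delta v) = 1"
proof -
  assume v: "v \<in> V"
  have "(\<Sum>\<^sub>\<infinity>u\<in>V. (cmod (delta v u))\<^sup>2) = (\<Sum>\<^sub>\<infinity>u\<in>{v}. (cmod (delta v u))\<^sup>2)"
    by (rule infsum_cong_neutral) (use v in \<open>auto simp: delta_def\<close>)
  then show ?thesis by (simp add: ell2_norm_def delta_def)
qed

text \<open>No edges occur here: the trace calculus uses only a translation group that acts on the
  vertices with finitely many orbits.\<close>

locale periodic_vertices =
  fixes \<Gamma> V :: "'a::real_inner set"
  assumes zero_in: "0 \<in> \<Gamma>" and add_in: "a \<in> \<Gamma> \<Longrightarrow> b \<in> \<Gamma> \<Longrightarrow> a + b \<in> \<Gamma>"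
    and uminus_in: "a \<in> \<Gamma> \<Longrightarrow> - a \<in> \<Gamma>"
    and shift_in_V: "v \<in> V \<Longrightarrow> a \<in> \<Gamma> \<Longrightarrow> v + a \<in> V"
    and finite_orbits: "finite ((\<lambda>v. (\<lambda>a. v + a) ` \<Gamma>) ` V)"
begin

lemma shift_in_V_iff: "a \<in> \<Gamma> \<Longrightarrow> v + a \<in> V \<longleftrightarrow> v \<in> V"
  using shift_in_V[of v a] shift_in_V[of "v + a" "- a"] uminus_in by auto

text \<open>The choice is made from the orbit as a set, so that all vertices of an orbit receive the
  same representative.\<close>

definition cell_rep :: "'a \<Rightarrow> 'a" where
  "cell_rep v = (SOME u. u \<in> (\<lambda>a. v + a) ` \<Gamma>)"

definition cell :: "'a set" where
  "cell = cell_rep ` V"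

lemma finite_cell: "finite cell"
proof -
  have "cell = (\<lambda>X. SOME u. u \<in> X) ` (\<lambda>v. (\<lambda>a. v + a) ` \<Gamma>) ` V"
    by (simp add: cell_def cell_rep_def image_image)
  then show ?thesis using finite_orbits by simp
qed

lemma orbit_eq:
  assumes "u \<in> (\<lambda>a. v + a) ` \<Gamma>"
  shows "(\<lambda>a. u + a) ` \<Gamma> = (\<lambda>a. v + a) ` \<Gamma>"
proof -
  obtain b where b: "b \<in> \<Gamma>" "u = v + b" using assms by auto
  show ?thesis
  proof (intro equalityI subsetI)
    fix x assume "x \<in> (\<lambda>a. u + a) ` \<Gamma>"
    then obtain a where "a \<in> \<Gamma>" "x = v + (b + a)" using b by (auto simp: add.assoc)
    then show "x \<in> (\<lambda>a. v + a) ` \<Gamma>" using add_in b by auto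
  next
    fix x assume "x \<in> (\<lambda>a. v + a) ` \<Gamma>"
    then obtain a where a: "a \<in> \<Gamma>" "x = u + (- b + a)" using b by auto
    show "x \<in> (\<lambda>a. u + a) ` \<Gamma>"
      unfolding a(2) by (intro imageI add_in uminus_in a b)
  qed
qed

lemma cell_rep_in_orbit: "cell_rep v \<in> (\<lambda>a. v + a) ` \<Gamma>"
  unfolding cell_rep_def by (rule someI[of _ "v + 0"]) (rule imageI[OF zero_in])

lemma cell_subset:
  assumes "u \<in> cell"
  shows "u \<in> V"
proof -
  obtain v where "v \<in> V" "u = cell_rep v" using assms by (auto simp: cell_def)
  with cell_rep_in_orbit[of v] show ?thesis by (auto simp: shift_in_V)
qed

lemma cell_decomposition: "V = (\<Union>u\<in>cell. (\<lambda>a. u + a) ` \<Gamma>)"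
proof
  show "V \<subseteq> (\<Union>u\<in>cell. (\<lambda>a. u + a) ` \<Gamma>)"
  proof
    fix v assume "v \<in> V"
    then have "cell_rep v \<in> cell" by (simp add: cell_def)
    moreover have "v + 0 \<in> (\<lambda>a. cell_rep v + a) ` \<Gamma>"
      unfolding orbit_eq[OF cell_rep_in_orbit[of v]] by (rule imageI[OF zero_in])
    ultimately show "v \<in> (\<Union>u\<in>cell. (\<lambda>a. u + a) ` \<Gamma>)" by auto
  qed
  show "(\<Union>u\<in>cell. (\<lambda>a. u + a) ` \<Gamma>) \<subseteq> V"
    by (auto intro: shift_in_V cell_subset)
qed

lemma cell_disjoint:
  assumes "u \<in> cell" "w \<in> cell" "u \<noteq> w"
  shows "(\<lambda>a. u + a) ` \<Gamma> \<inter> (\<lambda>a. w + a) ` \<Gamma> = {}"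
proof (rule ccontr)
  assume "(\<lambda>a. u + a) ` \<Gamma> \<inter> (\<lambda>a. w + a) ` \<Gamma> \<noteq> {}"
  then obtain x where "x \<in> (\<lambda>a. u + a) ` \<Gamma>" "x \<in> (\<lambda>a. w + a) ` \<Gamma>" by auto
  from this[THEN orbit_eq] have eq: "(\<lambda>a. u + a) ` \<Gamma> = (\<lambda>a. w + a) ` \<Gamma>" by simp
  have rep: "cell_rep x = x" if "x \<in> cell" for x
  proof -
    from that obtain v where v: "x = cell_rep v" by (auto simp: cell_def)
    show ?thesis unfolding v by (simp add: cell_rep_def[of "cell_rep v"] orbit_eq[OF cell_rep_in_orbit] cell_rep_def[of v, symmetric])
  qed
  have "cell_rep u = cell_rep w" by (simp only: cell_rep_def eq)
  with assms show False by (simp add: rep)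
qed

lemma infsum_cell:
  fixes h :: "'a \<Rightarrow> complex"
  assumes "finite {v \<in> V. h v \<noteq> 0}"
  shows "infsum h V = (\<Sum>u\<in>cell. \<Sum>\<^sub>\<infinity>a\<in>\<Gamma>. h (u + a))"
proof -
  have "(\<Sum>u\<in>cell. infsum h ((\<lambda>a. u + a) ` \<Gamma>)) = infsum h (\<Union>u\<in>cell. (\<lambda>a. u + a) ` \<Gamma>)"
  proof (rule sum_infsum[OF finite_cell])
    fix u assume "u \<in> cell"
    then have "(\<lambda>a. u + a) ` \<Gamma> \<subseteq> V" using cell_decomposition by blast
    with assms show "h summable_on (\<lambda>a. u + a) ` \<Gamma>"
      by (intro finite_nonzero_values_imp_summable_on) (rule finite_subset[rotated], auto)
  qed (rule cell_disjoint)
  moreover have "infsum h ((\<lambda>a. u + a) ` \<Gamma>) = (\<Sum>\<^sub>\<infinity>a\<in>\<Gamma>. h (u + a))" for u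
    by (subst infsum_reindex) (auto simp: o_def)
  ultimately show ?thesis using cell_decomposition by simp
qed

text \<open>The mass sent out of a cell equals the mass received by it. Splitting \<open>V\<close>
  into orbits, invariance moves the translation from one argument to the other and turns
  \<open>a\<close> into \<open>- a\<close>.\<close>

lemma mass_transport:
  fixes g :: "'a \<Rightarrow> 'a \<Rightarrow> complex"
  assumes inv: "\<And>v u a. a \<in> \<Gamma> \<Longrightarrow> g (v + a) (u + a) = g v u"
    and "\<And>v. v \<in> V \<Longrightarrow> finite {u \<in> V. g v u \<noteq> 0}" "\<And>u. u \<in> V \<Longrightarrow> finite {v \<in> V. g v u \<noteq> 0}"
  shows "(\<Sum>v\<in>cell. \<Sum>\<^sub>\<infinity>u\<in>V. g v u) = (\<Sum>u\<in>cell. \<Sum>\<^sub>\<infinity>v\<in>V. g v u)"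
proof -
  have "(\<Sum>\<^sub>\<infinity>a\<in>\<Gamma>. g v (u + a)) = (\<Sum>\<^sub>\<infinity>a\<in>\<Gamma>. g (v + a) u)" for v u
  proof -
    have "(\<Sum>\<^sub>\<infinity>a\<in>\<Gamma>. g v (u + a)) = (\<Sum>\<^sub>\<infinity>a\<in>\<Gamma>. g v (u + - a))"
      by (rule infsum_reindex_bij_witness[of _ uminus uminus]) (auto simp: uminus_in)
    also have "\<dots> = (\<Sum>\<^sub>\<infinity>a\<in>\<Gamma>. g (v + a) u)"
    proof (rule infsum_cong)
      fix a assume "a \<in> \<Gamma>"
      then show "g v (u + - a) = g (v + a) u" using inv[of a v "u + - a"] by simp
    qed
    finally show ?thesis .
  qed
  then have "(\<Sum>v\<in>cell. \<Sum>u\<in>cell. \<Sum>\<^sub>\<infinity>a\<in>\<Gamma>. g v (u + a)) = (\<Sum>u\<in>cell. \<Sum>v\<in>cell. \<Sum>\<^sub>\<infinity>a\<in>\<Gamma>. g (v + a) u)"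
    by (subst sum.swap) simp
  then show ?thesis
    using assms(2,3) cell_subset by (simp add: infsum_cell)
qed

text \<open>Preservation of finite support stands for finite range: the kernel
  \<open>B (delta u) v\<close> is finite in each column, and composition raises no convergence
  question.\<close>

definition periodic_op :: "(('a \<Rightarrow> complex) \<Rightarrow> ('a \<Rightarrow> complex)) \<Rightarrow> bool" where
  "periodic_op B \<longleftrightarrow> function_operator B \<and>
     (\<forall>a\<in>\<Gamma>. \<forall>f. B (translate a f) = translate a (B f)) \<and>
     (\<forall>f. finitely_supported V f \<longrightarrow> finitely_supported V (B f))"

definition cell_trace :: "(('a \<Rightarrow> complex) \<Rightarrow> ('a \<Rightarrow> complex)) \<Rightarrow> complex" where
  "cell_trace B = (\<Sum>v\<in>cell. B (delta v) v)"

lemma periodic_op_comp: "periodic_op B \<Longrightarrow> periodic_op C \<Longrightarrow> periodic_op (\<lambda>f. B (C f))"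
  by (auto simp: periodic_op_def function_operator_def)

lemma periodic_op_power: "periodic_op B \<Longrightarrow> periodic_op (B ^^ n)"
proof (induction n)
  case 0
  then show ?case by (simp add: periodic_op_def function_operator_def)
next
  case (Suc n)
  then show ?case using periodic_op_comp[of B "B ^^ n"] by (simp add: o_def)
qed

lemma periodic_op_translate: "a \<in> \<Gamma> \<Longrightarrow> periodic_op (translate a)"
  unfolding periodic_op_def function_operator_def
proof (intro conjI allI ballI impI)
  fix f assume a: "a \<in> \<Gamma>" and f: "finitely_supported V f"
  have "{v. translate a f v \<noteq> 0} = (\<lambda>v. v + a) ` {v. f v \<noteq> 0}"
    by (force simp: translate_def image_iff intro: exI[of _ "_ - a"])
  then show "finitely_supported V (translate a f)"
    using f shift_in_V[OF _ a] by (auto simp: finitely_supported_def)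
qed (auto simp: translate_def algebra_simps)

text \<open>Finite support lets linearity act termwise; the sum is written over all of
  \<open>V\<close> to have the shape that \<open>mass_transport\<close> expects.\<close>

lemma periodic_op_expand:
  assumes B: "periodic_op B" and f: "finitely_supported V f"
  shows "B f v = (\<Sum>\<^sub>\<infinity>u\<in>V. f u * B (delta u) v)"
proof -
  interpret B: function_operator B using B by (simp add: periodic_op_def)
  let ?S = "{v. f v \<noteq> 0}"
  have fin: "finite ?S" "?S \<subseteq> V" using f by (auto simp: finitely_supported_def)
  have "f = (\<lambda>v. \<Sum>u\<in>?S. f u * delta u v)"
  proof
    fix v
    have "(\<Sum>u\<in>?S. f u * delta u v) = (\<Sum>u\<in>?S. if u = v then f u else 0)"
      by (intro sum.cong) (auto simp: delta_def)
    then show "f v = (\<Sum>u\<in>?S. f u * delta u v)" using fin(1) by (simp add: sum.delta)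
  qed
  then have "B f v = B (\<lambda>v. \<Sum>u\<in>?S. f u * delta u v) v" by simp
  also have "\<dots> = (\<Sum>u\<in>?S. f u * B (delta u) v)"
    by (simp only: B.op_sum B.op_scale)
  also have "\<dots> = (\<Sum>\<^sub>\<infinity>u\<in>?S. f u * B (delta u) v)" using fin(1) by simp
  also have "\<dots> = (\<Sum>\<^sub>\<infinity>u\<in>V. f u * B (delta u) v)"
    by (rule infsum_cong_neutral) (use fin(2) in auto)
  finally show ?thesis .
qed

lemma periodic_op_kernel_shift:
  assumes "periodic_op B" "a \<in> \<Gamma>"
  shows "B (delta (u + a)) (v + a) = B (delta u) v"
proof -
  have "B (delta (u + a)) = translate a (B (delta u))"
    using assms by (simp add: periodic_op_def translate_delta[symmetric])
  then show ?thesis by (simp add: translate_def)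
qed

text \<open>The product of the two kernels, from \<open>v\<close> to \<open>u\<close> and back, is
  invariant under simultaneous translation, so \<open>mass_transport\<close> exchanges the roles of
  the two vertices.\<close>

lemma cell_trace_commute:
  assumes B: "periodic_op B" and C: "periodic_op C"
  shows "cell_trace (\<lambda>f. B (C f)) = cell_trace (\<lambda>f. C (B f))"
proof -
  define g where "g v u = C (delta v) u * B (delta u) v" for v u
  have supp: "finitely_supported V (K (delta v))" if "periodic_op K" "v \<in> V" for K v
    using that by (simp add: periodic_op_def)
  have fin: "finite {u. K (delta v) u \<noteq> 0}" if "periodic_op K" "v \<in> V" for K v
    using supp[OF that] by (simp add: finitely_supported_def)
  have "cell_trace (\<lambda>f. B (C f)) = (\<Sum>v\<in>cell. \<Sum>\<^sub>\<infinity>u\<in>V. g v u)"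
    unfolding cell_trace_def g_def
    by (intro sum.cong refl periodic_op_expand[OF B] supp[OF C] cell_subset)
  also have "\<dots> = (\<Sum>u\<in>cell. \<Sum>\<^sub>\<infinity>v\<in>V. g v u)"
  proof (rule mass_transport)
    show "g (v + a) (u + a) = g v u" if "a \<in> \<Gamma>" for v u a
      using that by (simp add: g_def periodic_op_kernel_shift B C)
    show "finite {u \<in> V. g v u \<noteq> 0}" if "v \<in> V" for v
      by (rule finite_subset[OF _ fin[OF C that]]) (auto simp: g_def)
    show "finite {v \<in> V. g v u \<noteq> 0}" if "u \<in> V" for u
      by (rule finite_subset[OF _ fin[OF B that]]) (auto simp: g_def)
  qed
  also have "\<dots> = cell_trace (\<lambda>f. C (B f))"
    unfolding cell_trace_def g_def
    by (subst mult.commute) (intro sum.cong refl periodic_op_expand[OF C, symmetric] supp[OF B] cell_subset)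
  finally show ?thesis .
qed

text \<open>
  The commutator of an operator with multiplication by the linear function \<open>v \<bullet> m\<close>; in terms of
  the Floquet fibres this is a derivative with respect to the quasimomentum.
\<close>

definition commutator :: "'a \<Rightarrow> (('a \<Rightarrow> complex) \<Rightarrow> ('a \<Rightarrow> complex)) \<Rightarrow> ('a \<Rightarrow> complex) \<Rightarrow> ('a \<Rightarrow> complex)" where
  "commutator m B f = (\<lambda>v. complex_of_real (v \<bullet> m) * B f v - B (\<lambda>u. complex_of_real (u \<bullet> m) * f u) v)"

text \<open>Multiplication by \<open>v \<bullet> m\<close> is not periodic, but translating by
  \<open>a\<close> changes it only by the constant \<open>a \<bullet> m\<close>, which commutes with
  \<open>B\<close> and cancels.\<close>

lemma periodic_op_commutator:
  assumes B: "periodic_op B"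
  shows "periodic_op (commutator m B)"
proof -
  interpret B: function_operator B using B by (simp add: periodic_op_def)
  show ?thesis
    unfolding periodic_op_def function_operator_def
  proof (intro conjI allI ballI impI)
    show "commutator m B (\<lambda>v. f v + g v) = (\<lambda>v. commutator m B f v + commutator m B g v)" for f g
      by (simp add: commutator_def distrib_left B.op_add algebra_simps)
    show "commutator m B (\<lambda>v. c * f v) = (\<lambda>v. c * commutator m B f v)" for c f
    proof -
      have "(\<lambda>u. complex_of_real (u \<bullet> m) * (c * f u)) = (\<lambda>u. c * (complex_of_real (u \<bullet> m) * f u))"
        by (simp add: mult_ac)
      then show ?thesis
        by (simp only: commutator_def B.op_scale) (simp add: algebra_simps)
    qed
    fix f
    show "finitely_supported V (commutator m B f)" if f: "finitely_supported V f"
    proof -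
      have "finitely_supported V (B f)" "finitely_supported V (B (\<lambda>u. complex_of_real (u \<bullet> m) * f u))"
        using f B by (simp_all add: periodic_op_def finitely_supported_mult)
      then have "finitely_supported V (\<lambda>v. complex_of_real (v \<bullet> m) * B f v
          + (-1) * B (\<lambda>u. complex_of_real (u \<bullet> m) * f u) v)"
        by (intro finitely_supported_add finitely_supported_mult)
      then show ?thesis by (simp add: commutator_def)
    qed
    fix a assume a: "a \<in> \<Gamma>"
    let ?X = "\<lambda>f u. complex_of_real (u \<bullet> m) * f u"
    have tr: "B (translate a h) = translate a (B h)" for h using B a by (simp add: periodic_op_def)
    have "?X (translate a f) = (\<lambda>v. translate a (?X f) v + complex_of_real (a \<bullet> m) * translate a f v)"
      by (auto simp: translate_def inner_diff_left algebra_simps)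
    then have "B (?X (translate a f)) = (\<lambda>v. translate a (B (?X f)) v + complex_of_real (a \<bullet> m) * translate a (B f) v)"
      by (simp only: B.op_add B.op_scale tr)
    then show "commutator m B (translate a f) = translate a (commutator m B f)"
      by (auto simp: commutator_def tr fun_eq_iff) (auto simp: translate_def inner_diff_left algebra_simps)
  qed
qed

text \<open>The Leibniz rule for the derivation \<open>commutator m\<close>.\<close>

lemma commutator_power:
  assumes "function_operator B"
  shows "commutator m (B ^^ n) f = (\<lambda>v. \<Sum>j<n. (B ^^ j) (commutator m B ((B ^^ (n - 1 - j)) f)) v)"
proof (induction n)
  case 0
  then show ?case by (simp add: commutator_def)
next
  case (Suc n)
  interpret B: function_operator B by fact
  define G where "G j = (B ^^ j) (commutator m B ((B ^^ (Suc n - 1 - j)) f))" for j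
  have "commutator m (B ^^ Suc n) f = (\<lambda>v. commutator m B ((B ^^ n) f) v + B (commutator m (B ^^ n) f) v)"
    by (simp add: commutator_def B.op_diff)
  also have "\<dots> = (\<lambda>v. G 0 v + (\<Sum>j<n. G (Suc j) v))"
    by (simp add: Suc B.op_sum G_def)
  also have "\<dots> = (\<lambda>v. \<Sum>j<Suc n. G j v)"
    by (simp only: sum.lessThan_Suc_shift)
  finally show ?case by (simp only: G_def)
qed

text \<open>The \<open>m\<close>-th Fourier coefficient of the trace of the Floquet fibres.\<close>

definition shifted_trace :: "'a \<Rightarrow> (('a \<Rightarrow> complex) \<Rightarrow> ('a \<Rightarrow> complex)) \<Rightarrow> complex" where
  "shifted_trace m B = (\<Sum>v\<in>cell. B (delta (v + m)) v)"

lemma shifted_trace_eq: "shifted_trace m B = cell_trace (\<lambda>f. B (translate m f))"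
  by (simp add: shifted_trace_def cell_trace_def translate_delta)

text \<open>The kernel of the commutator between \<open>v + m\<close> and \<open>v\<close> is that
  of \<open>B\<close> times \<open>v \<bullet> m - (v + m) \<bullet> m\<close>. Using the same
  \<open>m\<close> for the multiplication and the translation makes this factor nonzero whenever
  \<open>m\<close> is.\<close>

lemma shifted_trace_commutator:
  assumes "function_operator B"
  shows "shifted_trace m (commutator m B) = - complex_of_real (m \<bullet> m) * shifted_trace m B"
proof -
  interpret B: function_operator B by fact
  have "commutator m B (delta (v + m)) v = - complex_of_real (m \<bullet> m) * B (delta (v + m)) v" for v
  proof -
    have "(\<lambda>u. complex_of_real (u \<bullet> m) * delta (v + m) u) = (\<lambda>u. complex_of_real ((v + m) \<bullet> m) * delta (v + m) u)"
      by (auto simp: delta_def)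
    then have "commutator m B (delta (v + m)) v
        = complex_of_real (v \<bullet> m) * B (delta (v + m)) v - complex_of_real ((v + m) \<bullet> m) * B (delta (v + m)) v"
      by (simp only: commutator_def B.op_scale)
    then show ?thesis by (simp add: inner_add_left algebra_simps)
  qed
  then show ?thesis by (simp add: shifted_trace_def sum_distrib_left)
qed

text \<open>Under the trace all \<open>n\<close> terms of the Leibniz rule coincide, by cyclicity
  and because translation by \<open>m\<close> commutes with periodic operators; the noncommutative
  derivative becomes an ordinary one.\<close>

lemma shifted_trace_power_commutator:
  assumes T: "periodic_op T" and m: "m \<in> \<Gamma>"
  shows "- complex_of_real (m \<bullet> m) * shifted_trace m (T ^^ n)
    = of_nat n * shifted_trace m (\<lambda>f. (T ^^ (n - 1)) (commutator m T f))"
proof -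
  have U: "periodic_op (translate m)" by (rule periodic_op_translate[OF m])
  note Tn = periodic_op_power[OF T] and D = periodic_op_commutator[OF T, of m]
  have op: "function_operator (T ^^ n)" "function_operator T" using Tn T by (simp_all add: periodic_op_def)
  have comm: "B (translate m f) = translate m (B f)" if "periodic_op B" for B f
    using that m by (simp add: periodic_op_def)
  have each: "shifted_trace m (\<lambda>f. (T ^^ j) (commutator m T ((T ^^ (n - 1 - j)) f)))
      = shifted_trace m (\<lambda>f. (T ^^ (n - 1)) (commutator m T f))" if "j < n" for j
  proof -
    let ?k = "n - 1 - j"
    have "shifted_trace m (\<lambda>f. (T ^^ j) (commutator m T ((T ^^ ?k) f)))
        = cell_trace (\<lambda>f. (\<lambda>f. (T ^^ j) (commutator m T f)) ((\<lambda>f. (T ^^ ?k) (translate m f)) f))"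
      by (simp add: shifted_trace_eq)
    also have "\<dots> = cell_trace (\<lambda>f. (T ^^ ?k) (translate m ((T ^^ j) (commutator m T f))))"
      by (rule cell_trace_commute[OF periodic_op_comp[OF Tn D] periodic_op_comp[OF Tn U]])
    also have "\<dots> = cell_trace (\<lambda>f. (T ^^ ?k) ((T ^^ j) (commutator m T (translate m f))))"
      by (simp only: comm[OF Tn] comm[OF D])
    also have "\<dots> = cell_trace (\<lambda>f. (T ^^ (n - 1)) (commutator m T (translate m f)))"
    proof -
      have "(T ^^ ?k) ((T ^^ j) h) = (T ^^ (n - 1)) h" for h
        using that funpow_add[of ?k j T] by (simp add: fun_eq_iff)
      then show ?thesis by simp
    qed
    finally show ?thesis by (simp add: shifted_trace_eq)
  qed
  have "- complex_of_real (m \<bullet> m) * shifted_trace m (T ^^ n) = shifted_trace m (commutator m (T ^^ n))"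
    by (rule shifted_trace_commutator[OF op(1), symmetric])
  also have "\<dots> = (\<Sum>j<n. shifted_trace m (\<lambda>f. (T ^^ j) (commutator m T ((T ^^ (n - 1 - j)) f))))"
    unfolding shifted_trace_def commutator_power[OF op(2)] by (rule sum.swap)
  also have "\<dots> = of_nat n * shifted_trace m (\<lambda>f. (T ^^ (n - 1)) (commutator m T f))"
    by (subst sum.cong[OF refl each]) simp_all
  finally show ?thesis .
qed

lemma shifted_trace_op_poly_commutator:
  assumes T: "periodic_op T" and m: "m \<in> \<Gamma>"
  shows "- complex_of_real (m \<bullet> m) * shifted_trace m (op_poly T p)
    = shifted_trace m (\<lambda>f. op_poly T (pderiv p) (commutator m T f))"
proof -
  interpret T: function_operator T using T by (simp add: periodic_op_def)
  show ?thesis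
  proof (rule additive_poly_eqI[where L="\<lambda>p. - complex_of_real (m \<bullet> m) * shifted_trace m (op_poly T p)"])
    fix p q
    show "- complex_of_real (m \<bullet> m) * shifted_trace m (op_poly T (p + q))
        = - complex_of_real (m \<bullet> m) * shifted_trace m (op_poly T p) + - complex_of_real (m \<bullet> m) * shifted_trace m (op_poly T q)"
      by (simp add: shifted_trace_def T.op_poly_add sum.distrib distrib_left)
    show "shifted_trace m (\<lambda>f. op_poly T (pderiv (p + q)) (commutator m T f))
        = shifted_trace m (\<lambda>f. op_poly T (pderiv p) (commutator m T f))
        + shifted_trace m (\<lambda>f. op_poly T (pderiv q) (commutator m T f))"
      by (simp add: shifted_trace_def T.op_poly_add pderiv_add sum.distrib)
  next
    fix c :: real and n
    have "- complex_of_real (m \<bullet> m) * shifted_trace m (op_poly T (monom c n))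
        = complex_of_real c * (- complex_of_real (m \<bullet> m) * shifted_trace m (T ^^ n))"
      by (simp add: shifted_trace_def T.op_poly_monom sum_distrib_left mult_ac)
    also have "\<dots> = shifted_trace m (\<lambda>f. op_poly T (pderiv (monom c n)) (commutator m T f))"
      unfolding shifted_trace_power_commutator[OF T m]
      by (simp add: shifted_trace_def pderiv_monom T.op_poly_monom sum_distrib_left mult_ac)
    finally show "- complex_of_real (m \<bullet> m) * shifted_trace m (op_poly T (monom c n))
        = shifted_trace m (\<lambda>f. op_poly T (pderiv (monom c n)) (commutator m T f))" .
  qed
qed

end


section \<open>Singular spectrum makes the shifted traces vanish\<close>

lemma (in supported_measure) integral_indicator_null:
  assumes S: "S \<in> sets borel" and "measure \<mu> S = 0"
  shows "(\<integral>x. (poly q x - indicator S x)\<^sup>2 \<partial>\<mu>) = (\<integral>x. (poly q x)\<^sup>2 \<partial>\<mu>)"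
proof (rule integral_cong_AE)
  have "S \<in> null_sets \<mu>" using assms by (intro null_setsI) (simp_all add: emeasure_eq_measure)
  then show "AE x in \<mu>. (poly q x - indicator S x)\<^sup>2 = (poly q x)\<^sup>2"
    by (rule AE_not_in[THEN AE_mp]) auto
qed (use S in auto)

text \<open>Turns an L1 bound on the derivative into a uniform bound on the polynomial, by the
  fundamental theorem of calculus.\<close>

lemma poly_increment_bound:
  fixes E :: "real poly"
  assumes "- R \<le> a" "a \<le> b" "b \<le> R"
  shows "\<bar>poly E b - poly E a\<bar> \<le> (\<integral>x. indicator {-R..R} x * \<bar>poly (pderiv E) x\<bar> \<partial>lborel)"
proof -
  have int: "integrable lborel (\<lambda>x. indicator {c..d} x * f x)"
    if "continuous_on {c..d} f" for c d and f :: "real \<Rightarrow> real"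
    using borel_integrable_compact[of "{c..d}" f] that by (simp add: mult.commute cong: indicator_simps)
  have "poly E b - poly E a = (\<integral>x. poly (pderiv E) x * indicator {a..b} x \<partial>lborel)"
    by (rule integral_FTC_Icc_real[symmetric]) (use assms in \<open>auto intro!: poly_DERIV continuous_intros\<close>)
  also have "\<bar>\<dots>\<bar> \<le> (\<integral>x. \<bar>poly (pderiv E) x * indicator {a..b} x\<bar> \<partial>lborel)" by (rule integral_abs_bound)
  also have "\<dots> \<le> (\<integral>x. indicator {-R..R} x * \<bar>poly (pderiv E) x\<bar> \<partial>lborel)"
  proof (rule integral_mono)
    have "integrable lborel (\<lambda>x. indicator {a..b} x * \<bar>poly (pderiv E) x\<bar>)"
      by (rule int) (intro continuous_intros)
    then show "integrable lborel (\<lambda>x. \<bar>poly (pderiv E) x * indicator {a..b} x\<bar>)"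
      by (simp add: abs_mult mult.commute)
    show "integrable lborel (\<lambda>x. indicator {-R..R} x * \<bar>poly (pderiv E) x\<bar>)"
      by (rule int) (intro continuous_intros)
  qed (use assms in \<open>auto simp: indicator_def\<close>)
  finally show ?thesis .
qed

text \<open>Cut down to \<open>{-R..R}\<close>, Lebesgue measure becomes a
  \<open>supported_measure\<close> and can be approximated together with the spectral
  measures.\<close>

definition lebesgue_interval :: "real \<Rightarrow> real measure" where
  "lebesgue_interval R = density lborel (indicator {-R..R})"

lemma lebesgue_interval_integral:
  fixes f :: "real \<Rightarrow> real"
  assumes "f \<in> borel_measurable borel"
  shows "(\<integral>x. f x \<partial>lebesgue_interval R) = (\<integral>x. indicator {-R..R} x * f x \<partial>lborel)"
proof -
  have "(indicator {-R..R} :: real \<Rightarrow> ennreal) = (\<lambda>x. ennreal (indicator {-R..R} x))"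
    by (auto simp: indicator_def)
  then show ?thesis using assms by (simp add: lebesgue_interval_def integral_density)
qed

lemma supported_interval_measure: "supported_measure (lebesgue_interval R) R"
proof (intro supported_measure.intro supported_measure_axioms.intro finite_measureI)
  have e: "emeasure (lebesgue_interval R) X = emeasure lborel ({-R..R} \<inter> X)" if "X \<in> sets borel" for X
  proof -
    have "(\<lambda>x. indicator {-R..R} x * indicator X x) = (indicator ({-R..R} \<inter> X) :: real \<Rightarrow> ennreal)"
      by (auto simp: indicator_def)
    then show ?thesis using that by (simp add: lebesgue_interval_def emeasure_density)
  qed
  show "emeasure (lebesgue_interval R) (space (lebesgue_interval R)) \<noteq> \<infinity>"
    by (subst e) (auto simp: lebesgue_interval_def emeasure_lborel_Icc_eq)
  have "{-R..R} \<inter> {x. R < \<bar>x\<bar>} = {}" by auto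
  then show "emeasure (lebesgue_interval R) {x. R < \<bar>x\<bar>} = 0"
    by (subst e) auto
qed (simp add: lebesgue_interval_def)

text \<open>
  If all spectral measures are singular, they are concentrated on a Lebesgue null set, and
  some polynomial \<open>q\<close> is close to \<open>0\<close> in the spectral \<open>L\<^sup>2\<close> norms and to \<open>1\<close> in the Lebesgue one.
  For the antiderivative \<open>\<Phi>\<close> of \<open>q p'\<close>, the trace of \<open>\<Phi>(T)\<close> is small by the commutator identity,
  while \<open>\<Phi>\<close> is uniformly close to \<open>p - p(0)\<close>.
\<close>

lemma (in periodic_vertices) shifted_trace_vanishes:
  assumes "bounded_selfadjoint T V R" and T: "periodic_op T"
    and ac: "ac_subspace V T \<subseteq> {\<lambda>_. 0}" and m: "m \<in> \<Gamma>" "m \<noteq> 0"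
  shows "shifted_trace m (op_poly T p) = 0"
proof -
  interpret bounded_selfadjoint T V R by fact
  have del: "delta v \<in> ell2 V" if "v \<in> V" for v
    using that by (intro finitely_supported_ell2) simp
  have "\<forall>v\<in>V. \<exists>\<mu>. spectral_measure V T (delta v) \<mu> \<and> supported_measure \<mu> R"
    using spectral_measure_exists[OF del] by metis
  then obtain \<mu> where sm: "\<And>v. v \<in> V \<Longrightarrow> spectral_measure V T (delta v) (\<mu> v)"
    and supp: "\<And>v. v \<in> V \<Longrightarrow> supported_measure (\<mu> v) R" by metis
  \<comment> \<open>The projection of \<open>delta v\<close> to the set carrying the absolutely
    continuous part lies in the trivial \<open>ac_subspace\<close>; hence it is 0 and that set has
    no mass.\<close>
  have "\<forall>v\<in>V. \<exists>S. S \<in> sets borel \<and> emeasure lborel (- S) = 0 \<and> measure (\<mu> v) S = 0"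
  proof
    fix v assume v: "v \<in> V"
    interpret \<mu>: supported_measure "\<mu> v" R by (rule supp[OF v])
    obtain S where S: "S \<in> sets borel" "emeasure lborel (- S) = 0"
        "absolutely_continuous lborel (density (\<mu> v) (indicator S))"
      by (rule absolutely_continuous_part[OF \<mu>.finite_measure_axioms \<mu>.sets_eq])
    obtain g where g: "g \<in> ell2 V" "spectral_measure V T g (density (\<mu> v) (indicator S))"
      by (rule spectral_projection[OF del[OF v] sm[OF v] S(1)])
    have "g = (\<lambda>_. 0)" using ac g S(3) by (auto simp: ac_subspace_def)
    then have "0 = (ell2_norm V (op_poly T 1 g))\<^sup>2" by simp
    also have "\<dots> = (\<integral>x. (poly 1 x)\<^sup>2 \<partial>density (\<mu> v) (indicator S))" by (rule norm_op_poly[OF g(2,1)])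
    also have "\<dots> = measure (\<mu> v) S"
      using S(1) by (subst \<mu>.integral_density_indicator) auto
    finally show "\<exists>S. S \<in> sets borel \<and> emeasure lborel (- S) = 0 \<and> measure (\<mu> v) S = 0"
      using S by auto
  qed
  then obtain S' where S': "\<And>v. v \<in> V \<Longrightarrow> S' v \<in> sets borel"
      "\<And>v. v \<in> V \<Longrightarrow> emeasure lborel (- S' v) = 0" "\<And>v. v \<in> V \<Longrightarrow> measure (\<mu> v) (S' v) = 0" by metis
  \<comment> \<open>One set for all vertices of the cell; finiteness of the cell keeps its
    complement a null set.\<close>
  define S where "S = (\<Inter>v\<in>cell. S' v)"
  have S: "S \<in> sets borel"
    unfolding S_def using finite_cell S'(1) cell_subset by (intro sets.countable_INT'') (auto intro: countable_finite)
  have "- S' v \<in> null_sets lborel" if "v \<in> cell" for v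
    using S'(1,2)[OF cell_subset[OF that]] by (intro null_setsI) auto
  then have "(\<Union>v\<in>cell. - S' v) \<in> null_sets lborel"
    using finite_cell by (intro null_sets.finite_UN) auto
  then have Snull: "- S \<in> null_sets lborel" by (simp add: S_def)
  have S0: "measure (\<mu> v) S = 0" if "v \<in> cell" for v
  proof -
    interpret \<mu>: supported_measure "\<mu> v" R by (rule supp[OF cell_subset[OF that]])
    have "measure (\<mu> v) S \<le> measure (\<mu> v) (S' v)"
      using S'(1)[OF cell_subset[OF that]] that by (intro \<mu>.finite_measure_mono) (auto simp: S_def)
    then show ?thesis using S'(3)[OF cell_subset[OF that]] by (simp add: measure_le_0_iff)
  qed
  let ?leb = "lebesgue_interval R"
  interpret leb: supported_measure ?leb R by (rule supported_interval_measure)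
  define L where "L = measure ?leb UNIV"
  obtain P where P: "P > 0" "\<And>x. \<bar>x\<bar> \<le> R \<Longrightarrow> \<bar>poly (pderiv p) x\<bar> \<le> P"
    using leb.poly_bounded[of "pderiv p"] by blast
  \<comment> \<open>These vectors, and so the constant \<open>K\<close> below, do not depend on the
    polynomial \<open>q\<close> that will be chosen for each \<open>\<delta>\<close>.\<close>
  define y where "y v = op_poly T (pderiv p) (commutator m T (delta (v + m)))" for v
  have shifted: "v + m \<in> V" if "v \<in> cell" for v
    using shift_in_V[OF cell_subset[OF that] m(1)] .
  have y: "y v \<in> ell2 V" if "v \<in> cell" for v
    unfolding y_def using shifted[OF that] periodic_op_commutator[OF T]
    by (intro op_poly_ell2 finitely_supported_ell2) (simp add: periodic_op_def)
  define K where "K = (\<Sum>v\<in>cell. ell2_norm V (y v))"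
  have bound: "(m \<bullet> m) * cmod (shifted_trace m (op_poly T p))
      \<le> \<delta> * (K + (m \<bullet> m) * (real (card cell) * (P * (L + 1))))" if "\<delta> > 0" for \<delta>
  proof -
    \<comment> \<open>Indexing by an option type puts Lebesgue measure and the spectral measures
      into one family, so that a single \<open>q\<close> works for all.\<close>
    define M where "M i = (case i of None \<Rightarrow> ?leb | Some v \<Rightarrow> \<mu> v)" for i
    have "supported_measure (M i) R" if "i \<in> insert None (Some ` cell)" for i
      using that leb.supported_measure_axioms supp cell_subset by (auto simp: M_def)
    moreover have "finite (insert None (Some ` cell))" using finite_cell by simp
    moreover have "0 < \<delta>\<^sup>2" using \<open>\<delta> > 0\<close> by simp
    ultimately obtain q where q: "\<And>i. i \<in> insert None (Some ` cell)
        \<Longrightarrow> (\<integral>x. (poly q x - indicator S x)\<^sup>2 \<partial>M i) < \<delta>\<^sup>2"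
      using poly_approximates_indicator[OF _ _ S] by metis
    have q\<mu>: "ell2_norm V (op_poly T q (delta v)) \<le> \<delta>" if "v \<in> cell" for v
    proof (rule power2_le_imp_le)
      interpret \<mu>: supported_measure "\<mu> v" R by (rule supp[OF cell_subset[OF that]])
      have "(ell2_norm V (op_poly T q (delta v)))\<^sup>2 = (\<integral>x. (poly q x - indicator S x)\<^sup>2 \<partial>\<mu> v)"
        using norm_op_poly[OF sm del] cell_subset[OF that] \<mu>.integral_indicator_null[OF S S0[OF that]] by simp
      also have "\<dots> < \<delta>\<^sup>2" using q[of "Some v"] that by (simp add: M_def)
      finally show "(ell2_norm V (op_poly T q (delta v)))\<^sup>2 \<le> \<delta>\<^sup>2" by simp
    qed (use \<open>\<delta> > 0\<close> in simp)
    have qleb: "(\<integral>x. (poly q x - 1)\<^sup>2 \<partial>?leb) \<le> \<delta>\<^sup>2"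
    proof -
      have "- S \<in> null_sets ?leb"
        using absolutely_continuousI_density[of "indicator {-R..R}" lborel] Snull
        by (auto simp: lebesgue_interval_def absolutely_continuous_def)
      then have "AE x in ?leb. (poly q x - 1)\<^sup>2 = (poly q x - indicator S x)\<^sup>2"
        by (rule AE_not_in[THEN AE_mp]) auto
      then have "(\<integral>x. (poly q x - 1)\<^sup>2 \<partial>?leb) = (\<integral>x. (poly q x - indicator S x)\<^sup>2 \<partial>?leb)"
        using S by (intro integral_cong_AE) auto
      then show ?thesis using q[of None] by (simp add: M_def)
    qed
    obtain \<Phi> where \<Phi>: "pderiv \<Phi> = q * pderiv p" "poly \<Phi> 0 = 0" by (rule antiderivative_poly)
    define c where "c = poly p 0"
    \<comment> \<open>The error between \<open>\<Phi>\<close> and \<open>p - p(0)\<close>: it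
      vanishes at 0, and its derivative contains the factor \<open>q - 1\<close>, which is small for
      Lebesgue measure.\<close>
    define E where "E = \<Phi> - p + [:c:]"
    have E0: "poly E 0 = 0" and dE: "pderiv E = (q - 1) * pderiv p"
      using \<Phi> by (simp_all add: E_def c_def pderiv_add pderiv_diff pderiv_pCons algebra_simps)
    have abs: "(\<integral>x. \<bar>poly (pderiv E) x\<bar> \<partial>?leb) \<le> P * (L + 1) * \<delta>"
    proof -
      have i: "integrable ?leb (\<lambda>x. P * (\<delta> + (poly q x - 1)\<^sup>2 / \<delta>))"
        using leb.integrable_poly[of "(q - 1)\<^sup>2"] by (simp add: poly_power)
      have "(\<integral>x. \<bar>poly (pderiv E) x\<bar> \<partial>?leb) \<le> (\<integral>x. P * (\<delta> + (poly q x - 1)\<^sup>2 / \<delta>) \<partial>?leb)"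
      proof (rule integral_mono_AE)
        show "integrable ?leb (\<lambda>x. \<bar>poly (pderiv E) x\<bar>)" by (rule integrable_abs) simp
        show "AE x in ?leb. \<bar>poly (pderiv E) x\<bar> \<le> P * (\<delta> + (poly q x - 1)\<^sup>2 / \<delta>)"
          using leb.AE_bounded
        proof eventually_elim
          case (elim x)
          define z where "z = \<bar>poly q x - 1\<bar>"
          have "2 * z \<le> \<delta> + z\<^sup>2 / \<delta>"
            using \<open>\<delta> > 0\<close> sum_squares_bound[of \<delta> z] by (simp add: field_simps power2_eq_square)
          moreover have "0 \<le> z" by (simp add: z_def)
          ultimately have "z \<le> \<delta> + z\<^sup>2 / \<delta>" by linarith
          then have "\<bar>poly (pderiv p) x\<bar> * z \<le> P * (\<delta> + z\<^sup>2 / \<delta>)"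
            using P(1) P(2)[OF elim] by (intro mult_mono) (auto simp: z_def)
          then show ?case by (simp add: dE abs_mult z_def mult.commute)
        qed
      qed (rule i)
      also have "\<dots> = P * (\<delta> * L + (\<integral>x. (poly q x - 1)\<^sup>2 \<partial>?leb) / \<delta>)"
        using leb.integrable_poly[of "(q - 1)\<^sup>2"] by (simp add: poly_power L_def)
      also have "\<dots> \<le> P * (\<delta> * L + \<delta>\<^sup>2 / \<delta>)"
        using P(1) qleb \<open>\<delta> > 0\<close> by (intro mult_left_mono add_left_mono divide_right_mono) auto
      also have "\<dots> = P * (L + 1) * \<delta>" using \<open>\<delta> > 0\<close> by (simp add: power2_eq_square algebra_simps)
      finally show ?thesis .
    qed
    define \<epsilon> where "\<epsilon> = P * (L + 1) * \<delta>"
    have L0: "L \<ge> 0" by (simp add: L_def)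
    have "\<epsilon> \<ge> 0" using P(1) L0 \<open>\<delta> > 0\<close> by (simp add: \<epsilon>_def)
    have Ebound: "\<bar>poly E x\<bar> \<le> \<epsilon>" if "\<bar>x\<bar> \<le> R" for x
    proof -
      have "\<bar>poly E x\<bar> \<le> (\<integral>x. indicator {-R..R} x * \<bar>poly (pderiv E) x\<bar> \<partial>lborel)"
        using poly_increment_bound[of R 0 x E] poly_increment_bound[of R x 0 E] that R_pos
        by (cases "0 \<le> x") (auto simp: E0 abs_le_iff)
      also have "\<dots> = (\<integral>x. \<bar>poly (pderiv E) x\<bar> \<partial>?leb)"
        by (rule lebesgue_interval_integral[symmetric]) simp
      finally show ?thesis using abs by (simp add: \<epsilon>_def)
    qed
    \<comment> \<open>Moved onto \<open>delta v\<close>, the operator E(T) has norm bounded by the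
      supremum of \<open>E\<close>, since the spectral measure of \<open>delta v\<close> has mass
      1.\<close>
    have trE: "cmod (shifted_trace m (op_poly T E)) \<le> real (card cell) * \<epsilon>"
      unfolding shifted_trace_def
    proof (rule order_trans[OF norm_sum], rule sum_bounded_above)
      fix v assume v: "v \<in> cell"
      note v' = cell_subset[OF v]
      interpret \<mu>: supported_measure "\<mu> v" R by (rule supp[OF v'])
      have "(ell2_norm V (op_poly T E (delta v)))\<^sup>2 = (\<integral>x. (poly E x)\<^sup>2 \<partial>\<mu> v)"
        by (rule norm_op_poly[OF sm[OF v'] del[OF v']])
      also have "\<dots> \<le> \<epsilon>\<^sup>2 * measure (\<mu> v) UNIV"
      proof -
        have "\<bar>(poly E x)\<^sup>2\<bar> \<le> \<epsilon>\<^sup>2" if "\<bar>x\<bar> \<le> R" for x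
          using Ebound[OF that] \<open>\<epsilon> \<ge> 0\<close> by (simp add: abs_le_square_iff[symmetric])
        then have "\<bar>\<integral>x. (poly E x)\<^sup>2 \<partial>\<mu> v\<bar> \<le> \<epsilon>\<^sup>2 * measure (\<mu> v) UNIV"
          by (intro \<mu>.integral_bounded) auto
        then show ?thesis by linarith
      qed
      also have "measure (\<mu> v) UNIV = 1"
        using norm_eq_measure[OF sm[OF v'] del[OF v']] v' by (simp add: delta_norm)
      finally have "ell2_norm V (op_poly T E (delta v)) \<le> \<epsilon>"
        using \<open>\<epsilon> \<ge> 0\<close> by (auto intro: power2_le_imp_le)
      moreover have "cmod (op_poly T E (delta (v + m)) v) \<le> ell2_norm V (op_poly T E (delta v)) * ell2_norm V (delta (v + m))"
        unfolding delta_inner[OF v', of "op_poly T E (delta (v + m))", symmetric]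
          op_poly_symmetric[OF del[OF v'] del[OF shifted[OF v]]]
        by (rule ell2_Cauchy_Schwarz[OF op_poly_ell2[OF del[OF v']] del[OF shifted[OF v]]])
      ultimately show "cmod (op_poly T E (delta (v + m)) v) \<le> \<epsilon>"
        by (simp add: delta_norm shifted v)
    qed
    \<comment> \<open>Symmetry moves q(T) onto \<open>delta v\<close> with \<open>v\<close> in the
      cell, exactly the vectors for which \<open>q\<close> was chosen small.\<close>
    have tr\<Phi>: "(m \<bullet> m) * cmod (shifted_trace m (op_poly T \<Phi>)) \<le> \<delta> * K"
    proof -
      have "(m \<bullet> m) * cmod (shifted_trace m (op_poly T \<Phi>))
          = cmod (- complex_of_real (m \<bullet> m) * shifted_trace m (op_poly T \<Phi>))"
        by (simp add: norm_mult)
      also have "\<dots> = cmod (\<Sum>v\<in>cell. op_poly T q (y v) v)"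
        unfolding shifted_trace_op_poly_commutator[OF T m(1)] \<Phi>(1) op_poly_mult
        by (simp only: shifted_trace_def y_def)
      also have "\<dots> \<le> (\<Sum>v\<in>cell. \<delta> * ell2_norm V (y v))"
      proof (rule order_trans[OF norm_sum], rule sum_mono)
        fix v assume v: "v \<in> cell"
        note v' = cell_subset[OF v]
        have "cmod (op_poly T q (y v) v) \<le> ell2_norm V (op_poly T q (delta v)) * ell2_norm V (y v)"
          unfolding delta_inner[OF v', of "op_poly T q (y v)", symmetric]
            op_poly_symmetric[OF del[OF v'] y[OF v]]
          by (rule ell2_Cauchy_Schwarz[OF op_poly_ell2[OF del[OF v']] y[OF v]])
        also have "\<dots> \<le> \<delta> * ell2_norm V (y v)" by (intro mult_right_mono q\<mu> v) simp
        finally show "cmod (op_poly T q (y v) v) \<le> \<delta> * ell2_norm V (y v)" .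
      qed
      finally show ?thesis by (simp add: K_def sum_distrib_left)
    qed
    \<comment> \<open>Here \<open>m \<noteq> 0\<close> matters: \<open>delta (v + m)\<close>
      vanishes at \<open>v\<close>.\<close>
    have const: "shifted_trace m (op_poly T [:c:]) = 0"
      using m(2) by (simp add: shifted_trace_def op_poly_pCons delta_def)
    have "p = \<Phi> - E + [:c:]" by (simp add: E_def)
    then have "shifted_trace m (op_poly T p) = shifted_trace m (op_poly T (\<Phi> - E + [:c:]))" by (rule arg_cong)
    also have "\<dots> = shifted_trace m (op_poly T \<Phi>) - shifted_trace m (op_poly T E) + shifted_trace m (op_poly T [:c:])"
      by (simp add: shifted_trace_def op_poly_add op_poly_diff sum.distrib sum_subtractf)
    finally have "shifted_trace m (op_poly T p) = shifted_trace m (op_poly T \<Phi>) - shifted_trace m (op_poly T E)"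
      by (simp add: const)
    then have "cmod (shifted_trace m (op_poly T p))
        = cmod (shifted_trace m (op_poly T \<Phi>) - shifted_trace m (op_poly T E))" by (rule arg_cong)
    then have "cmod (shifted_trace m (op_poly T p))
        \<le> cmod (shifted_trace m (op_poly T \<Phi>)) + real (card cell) * \<epsilon>"
      using trE norm_triangle_ineq4[of "shifted_trace m (op_poly T \<Phi>)" "shifted_trace m (op_poly T E)"] by linarith
    then have "(m \<bullet> m) * cmod (shifted_trace m (op_poly T p))
        \<le> (m \<bullet> m) * (cmod (shifted_trace m (op_poly T \<Phi>)) + real (card cell) * \<epsilon>)"
      by (intro mult_left_mono) auto
    then show ?thesis using tr\<Phi> by (simp add: \<epsilon>_def algebra_simps)
  qed
  \<comment> \<open>The bound is linear in \<open>\<delta>\<close> with a fixed constant, so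
    \<open>\<delta>\<close> may tend to 0.\<close>
  have "(m \<bullet> m) * cmod (shifted_trace m (op_poly T p)) \<le> 0"
  proof (rule tendsto_lowerbound)
    let ?c = "K + (m \<bullet> m) * (real (card cell) * (P * (L + 1)))"
    show "((\<lambda>\<delta>. \<delta> * ?c) \<longlongrightarrow> 0) (at_right 0)"
      by (rule tendsto_eq_intros refl | simp)+
    show "\<forall>\<^sub>F \<delta> in at_right 0. (m \<bullet> m) * cmod (shifted_trace m (op_poly T p)) \<le> \<delta> * ?c"
      using bound by (auto simp: eventually_at_right_less[of 0] intro: eventually_mono[OF eventually_at_right_less[of 0]])
  qed simp
  moreover have "m \<bullet> m > 0" using m(2) by simp
  ultimately show ?thesis by (simp add: mult_le_0_iff)
qed


section \<open>Magnetic Schroedinger operators on periodic graphs\<close>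

lemma lattice_generated_by_group:
  shows "0 \<in> lattice_generated_by a"
    and "x \<in> lattice_generated_by a \<Longrightarrow> y \<in> lattice_generated_by a \<Longrightarrow> x + y \<in> lattice_generated_by a"
    and "x \<in> lattice_generated_by a \<Longrightarrow> - x \<in> lattice_generated_by a"
    and "a j \<in> lattice_generated_by a"
proof -
  have I: "(\<Sum>i\<in>UNIV. of_int (n i) *\<^sub>R a i) \<in> lattice_generated_by a" for n
    unfolding lattice_generated_by_def by blast
  show "0 \<in> lattice_generated_by a" using I[of "\<lambda>_. 0"] by simp
  show "- x \<in> lattice_generated_by a" if "x \<in> lattice_generated_by a"
  proof -
    from that obtain n where "x = (\<Sum>i\<in>UNIV. of_int (n i) *\<^sub>R a i)"
      unfolding lattice_generated_by_def by blast
    then show ?thesis using I[of "\<lambda>i. - n i"] by (simp add: sum_negf)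
  qed
  show "x + y \<in> lattice_generated_by a" if "x \<in> lattice_generated_by a" "y \<in> lattice_generated_by a"
  proof -
    from that obtain n k where "x = (\<Sum>i\<in>UNIV. of_int (n i) *\<^sub>R a i)" "y = (\<Sum>i\<in>UNIV. of_int (k i) *\<^sub>R a i)"
      unfolding lattice_generated_by_def by blast
    then show ?thesis using I[of "\<lambda>i. n i + k i"] by (simp add: scaleR_left_distrib sum.distrib)
  qed
  have "(\<Sum>i\<in>UNIV. of_int (if i = j then 1 else 0) *\<^sub>R a i) = (\<Sum>i\<in>UNIV. if i = j then a i else 0)"
    by (intro sum.cong) auto
  then show "a j \<in> lattice_generated_by a"
    using I[of "\<lambda>i. if i = j then 1 else 0"] by (simp add: sum.delta)
qed

section \<open>Translations, bounded degrees and hopping operators\<close>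

context periodic_graph
begin

lemma lattice_group:
  shows "0 \<in> \<Gamma>" "a \<in> \<Gamma> \<Longrightarrow> b \<in> \<Gamma> \<Longrightarrow> a + b \<in> \<Gamma>" "a \<in> \<Gamma> \<Longrightarrow> - a \<in> \<Gamma>"
  using lattice lattice_generated_by_group unfolding full_rank_lattice_def by metis+

lemma lattice_nontrivial: obtains m where "m \<in> \<Gamma>" "m \<noteq> 0"
proof -
  obtain a where a: "independent (range a)" "\<Gamma> = lattice_generated_by a"
    using lattice unfolding full_rank_lattice_def by blast
  have "a undefined \<noteq> 0" using a(1) dependent_zero by (metis rangeI)
  moreover have "a undefined \<in> \<Gamma>" using a(2) lattice_generated_by_group(4)[of a undefined] by simp
  ultimately show thesis by (rule that[rotated])
qed

sublocale periodic_vertices \<Gamma> V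
  by unfold_locales (use lattice_group vertex_shift finite_vertex_orbits in auto)

abbreviation out_edges :: "real^'d \<Rightarrow> 'e set" where
  "out_edges v \<equiv> {e \<in> A. src e = v}"

lemma finite_out_edges: "finite (out_edges v)"
proof (cases "v \<in> V")
  case False
  then have "out_edges v = {}" using src_in by auto
  then show ?thesis by (simp only: finite.emptyI)
qed (rule locally_finite)

lemma shift_uminus:
  assumes "e \<in> A" "a \<in> \<Gamma>"
  shows "shift (- a) (shift a e) = e" "shift a (shift (- a) e) = e"
proof -
  note a = assms(2) lattice_group(3)[OF assms(2)]
  have "shift (- a) (shift a e) = shift (- a + a) e" "shift a (shift (- a) e) = shift (a + - a) e"
    by (rule shift_add[symmetric], (rule assms(1) a)+)+
  then show "shift (- a) (shift a e) = e" "shift a (shift (- a) e) = e"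
    by (simp_all add: shift_zero[OF assms(1)])
qed

lemma bij_betw_shift:
  assumes "a \<in> \<Gamma>"
  shows "bij_betw (shift a) (out_edges v) (out_edges (v + a))"
proof (rule bij_betw_byWitness[where f'="shift (- a)"])
  show "shift a ` out_edges v \<subseteq> out_edges (v + a)"
    using assms by (auto simp: shift_in src_shift)
  show "shift (- a) ` out_edges (v + a) \<subseteq> out_edges v"
    using lattice_group(3)[OF assms] by (auto simp: shift_in src_shift)
  show "\<forall>e\<in>out_edges v. shift (- a) (shift a e) = e" "\<forall>e\<in>out_edges (v + a). shift a (shift (- a) e) = e"
    using shift_uminus[OF _ assms] by blast+
qed

lemma bounded_of_periodic:
  assumes "\<And>v a. v \<in> V \<Longrightarrow> a \<in> \<Gamma> \<Longrightarrow> g (v + a) = g v"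
  obtains B :: real where "0 \<le> B" "\<And>v. v \<in> V \<Longrightarrow> \<bar>g v\<bar> \<le> B"
proof
  show "0 \<le> (\<Sum>u\<in>cell. \<bar>g u\<bar>)" by (simp add: sum_nonneg)
  fix v assume "v \<in> V"
  then obtain u a where "u \<in> cell" "a \<in> \<Gamma>" "v = u + a" using cell_decomposition by blast
  then show "\<bar>g v\<bar> \<le> (\<Sum>u\<in>cell. \<bar>g u\<bar>)"
    using assms[OF cell_subset] member_le_sum[OF \<open>u \<in> cell\<close> _ finite_cell, of "\<lambda>u. \<bar>g u\<bar>"] by simp
qed

lemma degree_periodic: "a \<in> \<Gamma> \<Longrightarrow> card (out_edges (v + a)) = card (out_edges v)"
  by (rule bij_betw_same_card[OF bij_betw_shift, symmetric])

lemma degree_bounded: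
  obtains D :: nat where "\<And>v. card (out_edges v) \<le> D"
proof -
  obtain B where B: "\<And>v. v \<in> V \<Longrightarrow> \<bar>real (card (out_edges v))\<bar> \<le> B"
    by (rule bounded_of_periodic[of "\<lambda>v. real (card (out_edges v))"]) (auto simp only: degree_periodic)
  have "card (out_edges v) \<le> nat \<lceil>B\<rceil>" for v
  proof (cases "v \<in> V")
    case True
    then show ?thesis using B[OF True] by linarith
  next
    case False
    then have "out_edges v = {}" using src_in by auto
    then show ?thesis by (simp only: card.empty le0)
  qed
  then show thesis by (rule that)
qed

text \<open>Some uniform bound on the degrees, not necessarily the least.\<close>

definition max_degree :: nat where
  "max_degree = (SOME D. \<forall>v. card (out_edges v) \<le> D)"

lemma degree_le: "card (out_edges v) \<le> max_degree"
proof -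
  have "\<exists>D. \<forall>v. card (out_edges v) \<le> D" using degree_bounded by metis
  from someI_ex[OF this] show ?thesis by (simp add: max_degree_def)
qed

lemma flip_image: "flip ` A = A"
  using flip_in flip_flip by force

lemma inj_on_flip: "inj_on flip A"
  by (metis flip_flip inj_onI)

lemma sum_src_le:
  assumes f: "f \<in> ell2 V" and E: "finite E" "E \<subseteq> A"
  shows "(\<Sum>e\<in>E. (cmod (f (src e)))\<^sup>2) \<le> real max_degree * (ell2_norm V f)\<^sup>2"
proof -
  have "(\<Sum>e\<in>E. (cmod (f (src e)))\<^sup>2) = (\<Sum>v\<in>src ` E. \<Sum>e\<in>{e \<in> E. src e = v}. (cmod (f (src e)))\<^sup>2)"
    by (rule sum.image_gen[OF E(1)])
  also have "\<dots> \<le> (\<Sum>v\<in>src ` E. real max_degree * (cmod (f v))\<^sup>2)"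
  proof (rule sum_mono)
    fix v
    have "card {e \<in> E. src e = v} \<le> card (out_edges v)"
      using E(2) by (intro card_mono finite_out_edges) auto
    then have "real (card {e \<in> E. src e = v}) \<le> real max_degree"
      using degree_le[of v] by linarith
    then show "(\<Sum>e\<in>{e \<in> E. src e = v}. (cmod (f (src e)))\<^sup>2) \<le> real max_degree * (cmod (f v))\<^sup>2"
      by (simp add: mult_right_mono)
  qed
  also have "\<dots> = real max_degree * (\<Sum>v\<in>src ` E. (cmod (f v))\<^sup>2)" by (simp add: sum_distrib_left)
  also have "\<dots> \<le> real max_degree * (\<Sum>\<^sub>\<infinity>v\<in>V. (cmod (f v))\<^sup>2)"
  proof (intro mult_left_mono finite_sum_le_infsum)
    show "src ` E \<subseteq> V" using E(2) src_in by blast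
  qed (use f E(1) in \<open>auto simp: ell2_def\<close>)
  finally show ?thesis by (simp only: ell2_norm_square)
qed

lemma sum_tgt_le:
  assumes f: "f \<in> ell2 V" and E: "finite E" "E \<subseteq> A"
  shows "(\<Sum>e\<in>E. (cmod (f (tgt e)))\<^sup>2) \<le> real max_degree * (ell2_norm V f)\<^sup>2"
proof -
  have "(\<Sum>e\<in>flip ` E. (cmod (f (src e)))\<^sup>2) = (\<Sum>e\<in>E. (cmod (f (src (flip e))))\<^sup>2)"
    by (rule sum.reindex_cong[OF inj_on_subset[OF inj_on_flip E(2)]]) auto
  also have "\<dots> = (\<Sum>e\<in>E. (cmod (f (tgt e)))\<^sup>2)"
    using E(2) src_flip by (intro sum.cong) auto
  finally show ?thesis
    using sum_src_le[OF f, of "flip ` E"] E flip_in by (metis finite_imageI flip_image image_mono)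
qed

definition hop :: "('e \<Rightarrow> complex) \<Rightarrow> (real^'d \<Rightarrow> complex) \<Rightarrow> (real^'d \<Rightarrow> complex)" where
  "hop w f v = (\<Sum>e\<in>out_edges v. w e * f (tgt e))"

lemma hop_outside: "v \<notin> V \<Longrightarrow> hop w f v = 0"
proof -
  assume "v \<notin> V"
  then have "out_edges v = {}" using src_in by auto
  then show ?thesis by (simp only: hop_def sum.empty)
qed

text \<open>A Schur-type estimate: Cauchy-Schwarz at each vertex costs one factor
  \<open>max_degree\<close> in the squared norm, and counting each vertex as a target costs a second
  one.\<close>

lemma hop_bounded:
  assumes f: "f \<in> ell2 V" and w: "\<And>e. e \<in> A \<Longrightarrow> cmod (w e) \<le> 1"
  shows "hop w f \<in> ell2 V" "ell2_norm V (hop w f) \<le> real max_degree * ell2_norm V f"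
proof -
  have "L2_set (\<lambda>v. cmod (hop w f v)) F \<le> real max_degree * ell2_norm V f" if F: "finite F" "F \<subseteq> V" for F
  proof -
    have pt: "(cmod (hop w f v))\<^sup>2 \<le> real max_degree * (\<Sum>e\<in>out_edges v. (cmod (f (tgt e)))\<^sup>2)" for v
    proof -
      have "cmod (hop w f v) \<le> (\<Sum>e\<in>out_edges v. \<bar>1\<bar> * \<bar>cmod (f (tgt e))\<bar>)"
        unfolding hop_def using w
        by (intro order_trans[OF norm_sum] sum_mono) (auto simp: norm_mult intro: mult_left_le_one_le)
      also have "\<dots> \<le> L2_set (\<lambda>_. 1) (out_edges v) * L2_set (\<lambda>e. cmod (f (tgt e))) (out_edges v)"
        by (rule L2_set_mult_ineq)
      finally have "(cmod (hop w f v))\<^sup>2 \<le> (L2_set (\<lambda>_. 1) (out_edges v) * L2_set (\<lambda>e. cmod (f (tgt e))) (out_edges v))\<^sup>2"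
        by (intro power_mono) auto
      also have "\<dots> = real (card (out_edges v)) * (\<Sum>e\<in>out_edges v. (cmod (f (tgt e)))\<^sup>2)"
        by (simp add: L2_set_def power_mult_distrib sum_nonneg)
      also have "\<dots> \<le> real max_degree * (\<Sum>e\<in>out_edges v. (cmod (f (tgt e)))\<^sup>2)"
        using degree_le by (intro mult_right_mono) (auto simp: sum_nonneg)
      finally show ?thesis .
    qed
    have "(\<Sum>v\<in>F. (cmod (hop w f v))\<^sup>2) \<le> (\<Sum>v\<in>F. real max_degree * (\<Sum>e\<in>out_edges v. (cmod (f (tgt e)))\<^sup>2))"
      by (intro sum_mono pt)
    also have "\<dots> = real max_degree * (\<Sum>e\<in>(\<Union>v\<in>F. out_edges v). (cmod (f (tgt e)))\<^sup>2)"
      unfolding sum_distrib_left[symmetric]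
      by (subst sum.UNION_disjoint) (use F finite_out_edges in auto)
    also have "\<dots> \<le> real max_degree * (real max_degree * (ell2_norm V f)\<^sup>2)"
      using F(1) finite_out_edges by (intro mult_left_mono sum_tgt_le[OF f]) auto
    also have "\<dots> = (real max_degree * ell2_norm V f)\<^sup>2" by (simp add: power2_eq_square mult_ac)
    finally show ?thesis
      by (simp add: L2_set_def real_le_lsqrt sum_nonneg)
  qed
  from ell2_boundedI[OF hop_outside this]
  show "hop w f \<in> ell2 V" "ell2_norm V (hop w f) \<le> real max_degree * ell2_norm V f" by simp_all
qed

lemma summable_edges:
  assumes "f \<in> ell2 V" "g \<in> ell2 V" and w: "\<And>e. e \<in> A \<Longrightarrow> cmod (w e) \<le> 1"
  shows "(\<lambda>e. cnj (f (src e)) * (w e * g (tgt e))) summable_on A"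
proof (rule abs_summable_summable, rule nonneg_bdd_above_summable_on)
  show "bdd_above (sum (\<lambda>e. cmod (cnj (f (src e)) * (w e * g (tgt e)))) ` {F. F \<subseteq> A \<and> finite F})"
  proof (rule bdd_aboveI2)
    fix E assume "E \<in> {F. F \<subseteq> A \<and> finite F}"
    then have E: "finite E" "E \<subseteq> A" by auto
    have "(\<Sum>e\<in>E. cmod (cnj (f (src e)) * (w e * g (tgt e)))) \<le> (\<Sum>e\<in>E. \<bar>cmod (f (src e))\<bar> * \<bar>cmod (g (tgt e))\<bar>)"
      using w E(2) by (intro sum_mono) (auto simp: norm_mult intro!: mult_left_mono mult_left_le_one_le)
    also have "\<dots> \<le> L2_set (\<lambda>e. cmod (f (src e))) E * L2_set (\<lambda>e. cmod (g (tgt e))) E"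
      by (rule L2_set_mult_ineq)
    also have "\<dots> \<le> sqrt (real max_degree * (ell2_norm V f)\<^sup>2) * sqrt (real max_degree * (ell2_norm V g)\<^sup>2)"
      unfolding L2_set_def using assms E
      by (intro mult_mono real_sqrt_le_mono sum_src_le sum_tgt_le) (auto simp: sum_nonneg)
    finally show "(\<Sum>e\<in>E. cmod (cnj (f (src e)) * (w e * g (tgt e))))
        \<le> sqrt (real max_degree * (ell2_norm V f)\<^sup>2) * sqrt (real max_degree * (ell2_norm V g)\<^sup>2)" .
  qed
qed auto

text \<open>As a sum over oriented edges the form makes its symmetry visible: edge reversal permutes
  \<open>A\<close> and exchanges source and target.\<close>

lemma edge_sum:
  assumes "f \<in> ell2 V" "g \<in> ell2 V" and w: "\<And>e. e \<in> A \<Longrightarrow> cmod (w e) \<le> 1"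
  shows "ell2_inner V f (hop w g) = (\<Sum>\<^sub>\<infinity>e\<in>A. cnj (f (src e)) * (w e * g (tgt e)))"
proof -
  let ?F = "\<lambda>e. cnj (f (src e)) * (w e * g (tgt e))"
  have bij: "bij_betw snd (Sigma V out_edges) A"
    by (rule bij_betw_byWitness[where f'="\<lambda>e. (src e, e)"]) (auto intro: src_in)
  have sF: "(\<lambda>p. ?F (snd p)) summable_on Sigma V out_edges"
    using summable_edges[of f g w, OF assms] summable_on_reindex_bij_betw[OF bij, of ?F] by simp
  have "ell2_inner V f (hop w g) = (\<Sum>\<^sub>\<infinity>v\<in>V. \<Sum>\<^sub>\<infinity>e\<in>out_edges v. ?F e)"
    unfolding ell2_inner_def
  proof (rule infsum_cong)
    fix v
    have "cnj (f v) * hop w g v = (\<Sum>e\<in>out_edges v. ?F e)"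
      by (simp add: hop_def sum_distrib_left)
    also have "\<dots> = (\<Sum>\<^sub>\<infinity>e\<in>out_edges v. ?F e)" by (rule infsum_finite[OF finite_out_edges, symmetric])
    finally show "cnj (f v) * hop w g v = (\<Sum>\<^sub>\<infinity>e\<in>out_edges v. ?F e)" .
  qed
  also have "\<dots> = (\<Sum>\<^sub>\<infinity>p\<in>Sigma V out_edges. ?F (snd p))"
    using infsum_Sigma'_banach[of "\<lambda>_ e. ?F e" V out_edges] sF by (simp add: case_prod_unfold)
  also have "\<dots> = (\<Sum>\<^sub>\<infinity>e\<in>A. ?F e)"
    by (rule infsum_reindex_bij_betw[OF bij])
  finally show ?thesis .
qed

lemma hop_symmetric:
  assumes f: "f \<in> ell2 V" and g: "g \<in> ell2 V" and w: "\<And>e. e \<in> A \<Longrightarrow> cmod (w e) \<le> 1"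
    and wf: "\<And>e. e \<in> A \<Longrightarrow> w (flip e) = cnj (w e)"
  shows "ell2_inner V f (hop w g) = ell2_inner V (hop w f) g"
proof -
  have bij: "bij_betw flip A A" using inj_on_flip flip_image by (simp add: bij_betw_def)
  have "ell2_inner V (hop w f) g = cnj (ell2_inner V g (hop w f))"
    by (rule ell2_inner_commute)
  also have "\<dots> = (\<Sum>\<^sub>\<infinity>e\<in>A. cnj (cnj (g (src e)) * (w e * f (tgt e))))"
    by (simp only: edge_sum[of g f w, OF g f w] infsum_cnj)
  also have "\<dots> = (\<Sum>\<^sub>\<infinity>e\<in>A. cnj (cnj (g (src (flip e))) * (w (flip e) * f (tgt (flip e)))))"
    by (rule infsum_reindex_bij_betw[OF bij, symmetric])
  also have "\<dots> = (\<Sum>\<^sub>\<infinity>e\<in>A. cnj (f (src e)) * (w e * g (tgt e)))"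
    by (rule infsum_cong) (simp add: src_flip tgt_flip wf mult_ac)
  also have "\<dots> = ell2_inner V f (hop w g)" by (rule edge_sum[of f g w, OF f g w, symmetric])
  finally show ?thesis by simp
qed

lemma periodic_op_hop:
  assumes w: "\<And>e a. e \<in> A \<Longrightarrow> a \<in> \<Gamma> \<Longrightarrow> w (shift a e) = w e"
  shows "periodic_op (hop w)"
  unfolding periodic_op_def function_operator_def
proof (intro conjI allI ballI impI)
  show "hop w (\<lambda>v. f v + g v) = (\<lambda>v. hop w f v + hop w g v)" for f g
    by (simp add: hop_def distrib_left sum.distrib fun_eq_iff)
  show "hop w (\<lambda>v. c * f v) = (\<lambda>v. c * hop w f v)" for c f
    by (simp add: hop_def sum_distrib_left mult_ac fun_eq_iff)
  show "hop w (translate a f) = translate a (hop w f)" if a: "a \<in> \<Gamma>" for a f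
  proof
    fix v
    have "hop w (translate a f) v = (\<Sum>e\<in>out_edges (v - a + a). w e * f (tgt e - a))"
      by (simp add: hop_def translate_def)
    also have "\<dots> = (\<Sum>e\<in>out_edges (v - a). w (shift a e) * f (tgt (shift a e) - a))"
      by (rule sum.reindex_bij_betw[OF bij_betw_shift[OF a], symmetric])
    also have "\<dots> = (\<Sum>e\<in>out_edges (v - a). w e * f (tgt e))"
      using a by (intro sum.cong) (auto simp: w tgt_shift)
    finally show "hop w (translate a f) v = translate a (hop w f) v"
      by (simp add: hop_def translate_def)
  qed
  show "finitely_supported V (hop w f)" if f: "finitely_supported V f" for f
  proof -
    \<comment> \<open>A vertex with a nonzero value has an edge into the support of
      \<open>f\<close>; the reversed edge leaves the support, and only finitely many edges
      do.\<close>
    have sub: "{v. hop w f v \<noteq> 0} \<subseteq> (\<Union>u\<in>{u. f u \<noteq> 0}. tgt ` out_edges u)"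
    proof
      fix v assume v: "v \<in> {v. hop w f v \<noteq> 0}"
      have "\<exists>e\<in>out_edges v. w e * f (tgt e) \<noteq> 0"
      proof (rule ccontr)
        assume "\<not> (\<exists>e\<in>out_edges v. w e * f (tgt e) \<noteq> 0)"
        then have "hop w f v = 0" unfolding hop_def by (intro sum.neutral) auto
        with v show False by simp
      qed
      then obtain e where e: "e \<in> A" "src e = v" "f (tgt e) \<noteq> 0" by auto
      then have "flip e \<in> out_edges (tgt e)" "tgt (flip e) = v"
        by (auto simp: flip_in src_flip tgt_flip)
      with e(3) show "v \<in> (\<Union>u\<in>{u. f u \<noteq> 0}. tgt ` out_edges u)" by blast
    qed
    moreover have "finite (\<Union>u\<in>{u. f u \<noteq> 0}. tgt ` out_edges u)"
      using f finite_out_edges by (auto simp: finitely_supported_def)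
    moreover have "{v. hop w f v \<noteq> 0} \<subseteq> V"
      by (rule subsetI, rule ccontr) (simp add: hop_outside)
    ultimately show ?thesis
      unfolding finitely_supported_def using finite_subset[OF sub] by simp
  qed
qed

end


text \<open>Operators here act on arbitrary functions; this allows changing one outside
  \<open>ell2\<close>, in particular through the values of the potential off
  \<open>V\<close>.\<close>

lemma ac_spectrum_cong:
  assumes T': "bounded_selfadjoint T' V R" and eq: "\<And>f. f \<in> ell2 V \<Longrightarrow> T f = T' f"
  shows "ac_spectrum V T = ac_spectrum V T'"
proof -
  interpret T': bounded_selfadjoint T' V R by (rule T')
  have pow: "(T ^^ n) f = (T' ^^ n) f" if "f \<in> ell2 V" for f n
    by (induction n) (simp_all add: eq T'.op_power_ell2 that)
  have sm: "spectral_measure V T f \<mu> \<longleftrightarrow> spectral_measure V T' f \<mu>" if "f \<in> ell2 V" for f \<mu>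
    using pow[OF that] by (simp add: spectral_measure_def)
  have ac: "ac_subspace V T = ac_subspace V T'"
    using sm by (auto simp: ac_subspace_def)
  have eqK: "T f = T' f" if "f \<in> ac_subspace V T'" for f
    using that eq by (simp add: ac_subspace_def)
  have "bij_betw (\<lambda>f v. T f v - z * f v) (ac_subspace V T') (ac_subspace V T')
      \<longleftrightarrow> bij_betw (\<lambda>f v. T' f v - z * f v) (ac_subspace V T') (ac_subspace V T')" for z
    by (rule bij_betw_cong) (simp add: eqK)
  then show ?thesis
    unfolding ac_spectrum_def spectrum_on_def ac by (simp add: eqK cong: ball_cong)
qed

section \<open>The holomorphic family of Hamiltonians\<close>

context periodic_graph
begin

text \<open>The coupling \<open>z\<close> is complex so that kernel entries of powers are entire
  functions of it; real \<open>z\<close> gives the magnetic operators.\<close>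

definition hamiltonian :: "('e \<Rightarrow> real) \<Rightarrow> (real^'d \<Rightarrow> real) \<Rightarrow> complex \<Rightarrow> (real^'d \<Rightarrow> complex) \<Rightarrow> (real^'d \<Rightarrow> complex)" where
  "hamiltonian \<alpha> Q z f = (\<lambda>v. complex_of_real (real (card (out_edges v)) + Q v) * f v
     - hop (\<lambda>e. exp (\<i> * z * complex_of_real (\<alpha> e))) f v)"

lemma magnetic_schroedinger_eq:
  "magnetic_schroedinger A src tgt (\<lambda>e. t * \<alpha> e) Q = hamiltonian \<alpha> Q (complex_of_real t)"
  by (intro ext) (simp add: magnetic_schroedinger_def magnetic_laplacian_def hamiltonian_def hop_def
      sum_subtractf algebra_simps)

lemma function_operator_hop: "function_operator (hop w)"
  by unfold_locales (simp_all add: hop_def distrib_left sum.distrib sum_distrib_left mult_ac fun_eq_iff)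

lemma function_operator_hamiltonian: "function_operator (hamiltonian \<alpha> Q z)"
proof -
  interpret H: function_operator "hop (\<lambda>e. exp (\<i> * z * complex_of_real (\<alpha> e)))"
    by (rule function_operator_hop)
  show ?thesis
    by unfold_locales (simp_all only: hamiltonian_def H.op_add H.op_scale, simp_all add: algebra_simps)
qed

text \<open>Periodicity of \<open>Q\<close> is given on \<open>V\<close> only, while commutation
  with translations is tested on all functions; extending \<open>Q\<close> by 0 makes it periodic
  everywhere.\<close>

lemma periodic_op_hamiltonian:
  assumes \<alpha>: "periodic_under \<Gamma> A shift \<alpha>" and Q: "periodic_under \<Gamma> V (\<lambda>a v. v + a) Q"
    and Q0: "\<And>v. v \<notin> V \<Longrightarrow> Q v = 0"
  shows "periodic_op (hamiltonian \<alpha> Q z)"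
proof -
  let ?w = "\<lambda>e. exp (\<i> * z * complex_of_real (\<alpha> e))"
  have hop: "periodic_op (hop ?w)"
    by (rule periodic_op_hop) (use \<alpha> in \<open>simp add: periodic_under_def\<close>)
  have Qper: "Q (v + a) = Q v" if "a \<in> \<Gamma>" for v a
    using Q Q0 that shift_in_V_iff[OF that, of v] by (cases "v \<in> V") (simp_all add: periodic_under_def)
  show ?thesis
    unfolding periodic_op_def
  proof (intro conjI allI ballI impI)
    fix f
    show "hamiltonian \<alpha> Q z (translate a f) = translate a (hamiltonian \<alpha> Q z f)" if a: "a \<in> \<Gamma>" for a
    proof
      fix v
      have "card (out_edges v) = card (out_edges (v - a))" "Q v = Q (v - a)"
        using degree_periodic[OF a, of "v - a"] Qper[OF a, of "v - a"] by simp_all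
      moreover have "hop ?w (translate a f) v = hop ?w f (v - a)"
        using hop a by (simp add: periodic_op_def) (simp add: translate_def)
      ultimately show "hamiltonian \<alpha> Q z (translate a f) v = translate a (hamiltonian \<alpha> Q z f) v"
        by (simp add: hamiltonian_def translate_def)
    qed
    show "finitely_supported V (hamiltonian \<alpha> Q z f)" if f: "finitely_supported V f"
    proof -
      have "finitely_supported V (\<lambda>v. complex_of_real (real (card (out_edges v)) + Q v) * f v + (-1) * hop ?w f v)"
        using f hop by (intro finitely_supported_add finitely_supported_mult) (auto simp: periodic_op_def)
      then show ?thesis by (simp add: hamiltonian_def)
    qed
  qed (rule function_operator_hamiltonian)
qed

lemma potential_bounded:
  assumes Q: "periodic_under \<Gamma> V (\<lambda>a v. v + a) Q" and Q0: "\<And>v. v \<notin> V \<Longrightarrow> Q v = 0"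
  obtains B where "0 \<le> B" "\<And>v. \<bar>real (card (out_edges v)) + Q v\<bar> \<le> B"
proof -
  obtain C where C: "0 \<le> C" "\<And>v. v \<in> V \<Longrightarrow> \<bar>Q v\<bar> \<le> C"
    using bounded_of_periodic[of Q] Q unfolding periodic_under_def by metis
  have "\<bar>real (card (out_edges v)) + Q v\<bar> \<le> real max_degree + C" for v
    using C Q0[of v] degree_le[of v] by (cases "v \<in> V") (force simp: abs_if split: if_splits)+
  then show thesis using C(1) by (intro that[of "real max_degree + C"]) auto
qed

lemma bounded_selfadjoint_hamiltonian:
  assumes \<alpha>: "magnetic_potential A flip \<alpha>" and Q: "periodic_under \<Gamma> V (\<lambda>a v. v + a) Q"
    and Q0: "\<And>v. v \<notin> V \<Longrightarrow> Q v = 0"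
  obtains R where "bounded_selfadjoint (hamiltonian \<alpha> Q (complex_of_real t)) V R"
proof -
  obtain B where B: "0 \<le> B" "\<And>v. \<bar>real (card (out_edges v)) + Q v\<bar> \<le> B"
    using potential_bounded[OF Q Q0] by metis
  define d where "d v = real (card (out_edges v)) + Q v" for v
  have dB: "\<bar>d v\<bar> \<le> B" for v using B(2) by (simp add: d_def)
  define w where "w = (\<lambda>e. exp (\<i> * complex_of_real t * complex_of_real (\<alpha> e)))"
  have w1: "cmod (w e) \<le> 1" for e
    by (simp add: w_def norm_exp_eq_Re)
  \<comment> \<open>For a real coupling, edge reversal conjugates the phase; this is the source of
    the symmetry of the hopping part.\<close>
  have wf: "w (flip e) = cnj (w e)" if "e \<in> A" for e
    using \<alpha> that by (simp add: w_def magnetic_potential_def exp_cnj)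
  let ?H = "hamiltonian \<alpha> Q (complex_of_real t)"
  have H: "?H f = (\<lambda>v. complex_of_real (d v) * f v - hop w f v)" for f
    by (simp add: hamiltonian_def d_def w_def)
  have D: "(\<lambda>v. complex_of_real (d v) * f v) \<in> ell2 V"
    "ell2_norm V (\<lambda>v. complex_of_real (d v) * f v) \<le> B * ell2_norm V f" if f: "f \<in> ell2 V" for f
  proof -
    have "L2_set (\<lambda>v. cmod (complex_of_real (d v) * f v)) F \<le> B * ell2_norm V f" if "finite F" "F \<subseteq> V" for F
    proof -
      have "L2_set (\<lambda>v. cmod (complex_of_real (d v) * f v)) F \<le> L2_set (\<lambda>v. B * cmod (f v)) F"
        by (intro L2_set_mono) (auto simp: norm_mult intro: mult_right_mono dB)
      also have "\<dots> = B * L2_set (\<lambda>v. cmod (f v)) F" by (rule L2_set_right_distrib[OF B(1), symmetric])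
      also have "\<dots> \<le> B * ell2_norm V f" by (intro mult_left_mono L2_set_le_ell2_norm f that B)
      finally show ?thesis .
    qed
    moreover have "complex_of_real (d v) * f v = 0" if "v \<notin> V" for v
      using ell2_zero_outside[OF f that] by simp
    ultimately show "(\<lambda>v. complex_of_real (d v) * f v) \<in> ell2 V"
      "ell2_norm V (\<lambda>v. complex_of_real (d v) * f v) \<le> B * ell2_norm V f"
      by (intro ell2_boundedI; blast)+
  qed
  \<comment> \<open>The summand 1 makes the bound strictly positive.\<close>
  have "bounded_selfadjoint ?H V (B + real max_degree + 1)"
  proof (intro bounded_selfadjoint.intro bounded_selfadjoint_axioms.intro function_operator_hamiltonian)
    fix f assume f: "f \<in> ell2 V"
    note h = hop_bounded[of f w, OF f w1]
    show "?H f \<in> ell2 V" unfolding H by (rule ell2_diff[OF D(1)[OF f] h(1)])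
    have m: "(\<lambda>v. (-1) * hop w f v) \<in> ell2 V" "ell2_norm V (\<lambda>v. (-1) * hop w f v) = ell2_norm V (hop w f)"
      using ell2_scale[OF h(1), of "-1"] by simp_all
    have "ell2_norm V (?H f) \<le> B * ell2_norm V f + real max_degree * ell2_norm V f"
      using ell2_add(2)[OF D(1)[OF f] m(1)] D(2)[OF f] h(2) m(2) by (simp add: H)
    then show "ell2_norm V (?H f) \<le> (B + real max_degree + 1) * ell2_norm V f"
      using ell2_norm_nonneg[of V f] unfolding distrib_right mult_1 by linarith
    fix g assume g: "g \<in> ell2 V"
    have hg: "hop w g \<in> ell2 V" by (rule hop_bounded(1)[of g w, OF g w1])
    have "ell2_inner V f (\<lambda>v. complex_of_real (d v) * g v) = ell2_inner V (\<lambda>v. complex_of_real (d v) * f v) g"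
      by (simp add: ell2_inner_def mult_ac)
    moreover have "ell2_inner V f (hop w g) = ell2_inner V (hop w f) g"
      by (rule hop_symmetric[of f g w, OF f g w1 wf])
    ultimately show "ell2_inner V f (?H g) = ell2_inner V (?H f) g"
      unfolding H ell2_inner_diff_right[OF f D(1)[OF g] hg] ell2_inner_diff_left[OF D(1)[OF f] h(1) g]
      by simp
  qed (use B in simp)
  then show thesis by (rule that)
qed

text \<open>Every value is built by finite sums and products from exponentials in \<open>z\<close>;
  the induction must range over all \<open>v\<close>, since a step involves the neighbours.\<close>

lemma hamiltonian_power_holomorphic:
  "(\<lambda>z. ((\<lambda>f v. complex_of_real c * f v - hamiltonian \<alpha> Q z f v) ^^ n) f v) holomorphic_on UNIV"
proof (induction n arbitrary: v)
  case 0
  show ?case by simp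
next
  case (Suc n)
  show ?case
    unfolding funpow.simps o_apply hamiltonian_def hop_def
    by (intro holomorphic_intros Suc[unfolded hamiltonian_def hop_def])
qed

text \<open>Positivity spreads backwards along a path from \<open>v\<close> to \<open>u\<close>: one
  application of \<open>g\<close> carries it from the target of an edge to its source, and the
  nonnegative diagonal cannot cancel it.\<close>

lemma connected_power_positive:
  fixes d :: "real^'d \<Rightarrow> real"
  assumes d: "\<And>v. 0 \<le> d v" and u: "u \<in> V" "v \<in> V"
  defines "g \<equiv> \<lambda>r v. d v * r v + (\<Sum>e\<in>out_edges v. r (tgt e))"
  shows "\<exists>n. 0 < (g ^^ n) (\<lambda>x. if x = u then 1 else 0) v"
proof -
  let ?r = "\<lambda>n. (g ^^ n) (\<lambda>x. if x = u then 1 else 0)"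
  have nonneg: "0 \<le> ?r n x" for n x
    by (induction n arbitrary: x) (auto simp: g_def d intro!: add_nonneg_nonneg sum_nonneg)
  have "(v, u) \<in> {(src e, tgt e) | e. e \<in> A}\<^sup>*"
    by (rule connected_graph[OF u(2,1)])
  then show ?thesis
  proof (induction rule: converse_rtrancl_induct)
    case base
    show ?case by (rule exI[of _ 0]) simp
  next
    case (step x y)
    then obtain n e where n: "0 < ?r n y" and e: "e \<in> A" "x = src e" "y = tgt e" by auto
    have "?r n (tgt e) \<le> (\<Sum>e\<in>out_edges x. ?r n (tgt e))"
      by (rule member_le_sum) (use e nonneg finite_out_edges in auto)
    with n e(3) have "0 < (\<Sum>e\<in>out_edges x. ?r n (tgt e))" by simp
    then have "0 < ?r (Suc n) x"
      using d[of x] nonneg[of n x] by (simp add: g_def add_nonneg_pos)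
    then show ?case by blast
  qed
qed

lemma shifted_trace_zero_field_nonzero:
  assumes Q: "periodic_under \<Gamma> V (\<lambda>a v. v + a) Q" and Q0: "\<And>v. v \<notin> V \<Longrightarrow> Q v = 0"
    and m: "m \<in> \<Gamma>"
  obtains c n where "shifted_trace m ((\<lambda>f v. complex_of_real c * f v - hamiltonian \<alpha> Q 0 f v) ^^ n) \<noteq> 0"
proof -
  \<comment> \<open>With \<open>c\<close> above the diagonal of the Hamiltonian, every matrix entry
    of \<open>c - H\<close> at zero coupling is nonnegative.\<close>
  obtain c where c: "\<And>v. \<bar>real (card (out_edges v)) + Q v\<bar> \<le> c"
    using potential_bounded[OF Q Q0] by metis
  define d where "d v = c - (real (card (out_edges v)) + Q v)" for v
  have d: "0 \<le> d v" for v using c[of v] by (simp add: d_def)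
  define g where "g r v = d v * r v + (\<Sum>e\<in>out_edges v. r (tgt e))" for r and v :: "real^'d"
  let ?G = "\<lambda>f v. complex_of_real c * f v - hamiltonian \<alpha> Q 0 f v"
  have G: "(?G ^^ n) (\<lambda>v. complex_of_real (r v)) = (\<lambda>v. complex_of_real ((g ^^ n) r v))" for n r
    by (induction n) (simp_all add: hamiltonian_def hop_def g_def d_def algebra_simps)
  have del: "delta u = (\<lambda>x. complex_of_real (if x = u then 1 else 0))" for u :: "real^'d"
    by (auto simp: delta_def)
  have nonneg: "0 \<le> (g ^^ n) (\<lambda>x. if x = u then 1 else 0) v" for n u v
    by (induction n arbitrary: v) (auto simp: g_def d intro!: add_nonneg_nonneg sum_nonneg)
  obtain v where "v \<in> V" using infinite_vertices by fastforce
  then obtain v where v: "v \<in> cell" using cell_decomposition by blast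
  \<comment> \<open>One positive summand suffices, for some vertex \<open>v\<close> of the cell and
    its translate \<open>v + m\<close>; the other summands cannot cancel it.\<close>
  obtain n where n: "0 < (g ^^ n) (\<lambda>x. if x = v + m then 1 else 0) v"
    using connected_power_positive[of d, OF d shift_in_V[OF cell_subset[OF v] m] cell_subset[OF v]]
    unfolding g_def by blast
  define s where "s = (\<Sum>v\<in>cell. (g ^^ n) (\<lambda>x. if x = v + m then 1 else 0) v)"
  have "shifted_trace m (?G ^^ n) = complex_of_real s"
    by (simp only: shifted_trace_def del G of_real_sum s_def)
  moreover have "0 < s"
    unfolding s_def by (rule sum_pos2[OF finite_cell v]) (use n nonneg in auto)
  ultimately have "shifted_trace m (?G ^^ n) \<noteq> 0" by simp
  then show thesis by (rule that)
qed

lemma finite_exceptional_couplings: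
  assumes \<alpha>: "magnetic_potential A flip \<alpha>" "periodic_under \<Gamma> A shift \<alpha>"
    and Q: "periodic_under \<Gamma> V (\<lambda>a v. v + a) Q" and Q0: "\<And>v. v \<notin> V \<Longrightarrow> Q v = 0"
  shows "finite {t \<in> {0..1::real}. ac_spectrum V (hamiltonian \<alpha> Q (complex_of_real t)) = {}}"
proof -
  obtain m where m: "m \<in> \<Gamma>" "m \<noteq> 0" by (rule lattice_nontrivial)
  let ?G = "\<lambda>c z f v. complex_of_real c * f v - hamiltonian \<alpha> Q z f v"
  obtain c n where pos: "shifted_trace m (?G c 0 ^^ n) \<noteq> 0"
    by (rule shifted_trace_zero_field_nonzero[OF Q Q0 m(1)])
  define h where "h z = shifted_trace m (?G c z ^^ n)" for z
  have hol: "h holomorphic_on UNIV"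
    unfolding h_def shifted_trace_def by (intro holomorphic_intros hamiltonian_power_holomorphic)
  have "finite {z \<in> complex_of_real ` {0..1}. h z = 0}"
  \<comment> \<open>Zeros of a nonconstant entire function in a compact set are finite in number; a
    constant \<open>h\<close> has no zeros because its value at 0 is nonzero.\<close>
  proof (cases "h constant_on UNIV")
    case True
    then have "h z \<noteq> 0" for z using pos by (auto simp: constant_on_def h_def)
    then show ?thesis by simp
  next
    case False
    have "compact (complex_of_real ` {0..1})"
      by (intro compact_continuous_image continuous_intros) simp
    from holomorphic_compact_finite_zeros[OF hol open_UNIV connected_UNIV this subset_UNIV False]
    show ?thesis .
  qed
  moreover have "h (complex_of_real t) = 0" if empty: "ac_spectrum V (hamiltonian \<alpha> Q (complex_of_real t)) = {}" for t
  proof -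
    let ?H = "hamiltonian \<alpha> Q (complex_of_real t)"
    obtain R where R: "bounded_selfadjoint ?H V R"
      by (rule bounded_selfadjoint_hamiltonian[OF \<alpha>(1) Q Q0])
    interpret H: bounded_selfadjoint ?H V R by (rule R)
    have ac: "ac_subspace V ?H \<subseteq> {\<lambda>_. 0}" using H.ac_spectrum_nonempty empty by blast
    have per: "periodic_op ?H" by (rule periodic_op_hamiltonian[OF \<alpha>(2) Q Q0])
    \<comment> \<open>The polynomial \<open>(c - x)^n\<close> is real, so at a real coupling
      \<open>h\<close> is one of the shifted traces that vanish.\<close>
    have 0: "shifted_trace m (op_poly ?H ([:c, -1:] ^ n)) = 0"
      by (rule shifted_trace_vanishes[OF R per ac m])
    have lin: "op_poly ?H [:c, -1:] f = ?G c (complex_of_real t) f" for f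
      by (simp add: H.op_poly_pCons H.op_minus)
    have "op_poly ?H ([:c, -1:] ^ k) f = (?G c (complex_of_real t) ^^ k) f" for k f
    proof (induction k)
      case (Suc k)
      then show ?case by (simp only: power_Suc H.op_poly_mult lin funpow.simps o_apply)
    qed simp
    then have "op_poly ?H ([:c, -1:] ^ n) = ?G c (complex_of_real t) ^^ n" by (intro ext) simp
    with 0 show ?thesis by (simp add: h_def)
  qed
  then have "complex_of_real ` {t \<in> {0..1}. ac_spectrum V (hamiltonian \<alpha> Q (complex_of_real t)) = {}}
      \<subseteq> {z \<in> complex_of_real ` {0..1}. h z = 0}" by auto
  ultimately show ?thesis
    by (meson finite_imageD finite_subset inj_of_real inj_on_subset subset_UNIV)
qed

end

theorem theorem1p3:
  fixes \<Gamma> V :: "(real^'d::finite) set"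
    and A :: "'e set"
    and src tgt :: "'e \<Rightarrow> real^'d"
    and flip :: "'e \<Rightarrow> 'e"
    and shift :: "real^'d \<Rightarrow> 'e \<Rightarrow> 'e"
    and \<alpha> :: "'e \<Rightarrow> real"
    and Q :: "real^'d \<Rightarrow> real"
  assumes "periodic_graph \<Gamma> V A src tgt flip shift"
    and "magnetic_potential A flip \<alpha>"
    and "periodic_under \<Gamma> A shift \<alpha>"
    and "periodic_under \<Gamma> V (\<lambda>a v. v + a) Q"
  shows "finite {t \<in> {0..1::real}.
           ac_spectrum V (magnetic_schroedinger A src tgt (\<lambda>e. t * \<alpha> e) Q) = {}}"
proof -
  interpret periodic_graph \<Gamma> V A src tgt flip shift by fact
  \<comment> \<open>Values of \<open>Q\<close> off \<open>V\<close> are arbitrary; square-summable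
    functions vanish there, so setting them to 0 does not affect the absolutely continuous
    spectrum.\<close>
  define Q' where "Q' v = (if v \<in> V then Q v else 0)" for v
  have Q': "periodic_under \<Gamma> V (\<lambda>a v. v + a) Q'" and Q0: "\<And>v. v \<notin> V \<Longrightarrow> Q' v = 0"
    using assms(4) shift_in_V by (auto simp: Q'_def periodic_under_def)
  have "ac_spectrum V (magnetic_schroedinger A src tgt (\<lambda>e. t * \<alpha> e) Q)
      = ac_spectrum V (hamiltonian \<alpha> Q' (complex_of_real t))" for t
  proof -
    obtain R where "bounded_selfadjoint (hamiltonian \<alpha> Q' (complex_of_real t)) V R"
      by (rule bounded_selfadjoint_hamiltonian[OF assms(2) Q' Q0])
    then show ?thesis
    proof (rule ac_spectrum_cong)
      fix f assume f: "f \<in> ell2 V"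
      have "complex_of_real (x + Q v) * f v = complex_of_real (x + Q' v) * f v" for x v
        using ell2_zero_outside[OF f, of v] by (simp add: Q'_def)
      then show "magnetic_schroedinger A src tgt (\<lambda>e. t * \<alpha> e) Q f = hamiltonian \<alpha> Q' (complex_of_real t) f"
        by (simp only: magnetic_schroedinger_eq hamiltonian_def)
    qed
  qed
  then show ?thesis
    using finite_exceptional_couplings[OF assms(2,3) Q' Q0] by simp
qed

end
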